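(* For $n\ge1$ let $t(\mathbb{R}^n)$ be the smallest cardinality of a subset of $\mathbb{R}^n$ that is not $T$-shaped. Then: (1) $t(\mathbb{R}^1)=1$; (2) $t(\mathbb{R}^2)=3$; (3) $t(\mathbb{R}^3)=6$; (4) $t(\mathbb{R}^4)=12$; (5) $t(\mathbb{R}^n)\le n^2-n+1$ for every $n\ge1$; (6) $t(\mathbb{R}^n)\ge t(\mathbb{R}^{n-1})+n+1$ for every $n\ge4$; (7) $t(\mathbb{R}^n)\ge\frac12(n^2+3n-4)$ for every $n\ge4$.
   Context: Let $\mathbb{R}_+=[0,\infty)$. Define $T_0=\emptyset\subset\mathbb{R}^0$, $T_1=\{0\}\subset\mathbb{R}^1$, and $T_j=(\mathbb{R}^{j-1}\times\{0\})\cup(T_{j-1}\times\mathbb{R}_+)\subset\mathbb{R}^j$ for $j>1$. A set $C\subset\mathbb{R}^n$ is $T$-shaped if $f(C)\subset\mathbb{R}\times T_{n-1}$ for some affine transformation $f:\mathbb{R}^n\to\mathbb{R}\times\mathbb{R}^{n-1}$. *)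

theory Defs
  imports "Jordan_Normal_Form.Matrix" "HOL-Library.Extended_Real"
begin

text \<open>
  The space \<open>\<real>\<^sup>n\<close> is \<open>carrier_vec n\<close>, so that spaces of different dimensions can be related
  within one statement. The products \<open>A \<times> B \<subseteq> \<real>\<^sup>j \<times> \<real>\<close> and \<open>\<real> \<times> A \<subseteq> \<real> \<times> \<real>\<^sup>j\<close> are identified with
  subsets of \<open>\<real>\<^sup>j\<^sup>+\<^sup>1\<close> by appending, respectively prepending, the real coordinate.
\<close>

fun T_set :: "nat \<Rightarrow> real vec set" where
  "T_set 0 = {}"
| "T_set (Suc 0) = {0\<^sub>v 1}"
| "T_set (Suc (Suc j)) =
     {x @\<^sub>v vCons 0 vNil | x. x \<in> carrier_vec (Suc j)} \<union>
     {x @\<^sub>v vCons r vNil | x r. x \<in> T_set (Suc j) \<and> 0 \<le> r}"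

text \<open>
  Affine transformations are invertible; otherwise a constant map would make every subset
  of \<open>\<real>\<^sup>n\<close> with \<open>n \<ge> 2\<close> \<open>T\<close>-shaped.
\<close>

definition affine_transformation :: "nat \<Rightarrow> (real vec \<Rightarrow> real vec) \<Rightarrow> bool" where
  "affine_transformation n f \<longleftrightarrow>
     (\<exists>A \<in> carrier_mat n n. \<exists>b \<in> carrier_vec n.
        invertible_mat A \<and> (\<forall>x \<in> carrier_vec n. f x = A *\<^sub>v x + b))"

definition T_shaped :: "nat \<Rightarrow> real vec set \<Rightarrow> bool" where
  "T_shaped n C \<longleftrightarrow>
     (\<exists>f. affine_transformation n f \<and> f ` C \<subseteq> {vCons a y | a y. y \<in> T_set (n - 1)})"

text \<open>
  The smallest cardinality of a subset of \<open>\<real>\<^sup>n\<close> that is not \<open>T\<close>-shaped. Infinite cardinalities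
  count as \<open>\<infinity>\<close>, and the value is \<open>\<infinity>\<close> if no finite such set exists, so finiteness of
  the value is part of any finite upper bound for it.
\<close>

definition t_number :: "nat \<Rightarrow> enat" where
  "t_number n =
     (INF C \<in> {C. C \<subseteq> carrier_vec n \<and> \<not> T_shaped n C}. if finite C then enat (card C) else \<infinity>)"

end

theory Submission
  imports Defs "Jordan_Normal_Form.Determinant" "HOL-Computational_Algebra.Polynomial"
begin

text \<open>
  A set is \<open>T\<close>-shaped iff it can be exhausted by \<open>n - 1\<close> hyperplanes with independent normals, each one
  supporting what its predecessors leave over.

  Lower bounds: peel off a facet, which contains at least \<open>n\<close> points, and project the rest along a
  direction transversal to it. If the rest has \<open>t(\<real>\<^sup>n\<^sup>-\<^sup>1)\<close> points, projecting along the difference of two of them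
  saves one more point, unless the rest lies in a parallel hyperplane, which is then peeled off first.
  A set of six points of \<open>\<real>\<^sup>3\<close> that is not \<open>T\<close>-shaped is an affine regular octahedron. If a set of eleven
  points of \<open>\<real>\<^sup>4\<close> is not \<open>T\<close>-shaped, then the seven points off any facet project to octahedra, and their
  Gale diagram shows that they consist of an octahedron parallel to the facet and a point \<open>p\<close> beyond it.
  Applying this to the facets through \<open>p\<close> and rotating them about their ridges leads to a contradiction.

  Upper bounds: points on the moment curve for general \<open>n\<close>, the octahedron for \<open>n = 3\<close>, and the set
  \<open>{\<plusminus>e\<^sub>i, (1, 1, 1, 1) - e\<^sub>i}\<close> for \<open>n = 4\<close>.
\<close>

section \<open>T-shaped sets and affine functionals\<close>

text \<open>Where the dimension bounds come from: if the points off a facet in R^n all have the same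
  height, peeling their hyperplane leaves the \<open>n\<close> facet points, which is harmless once
  n < t(R^(n-1)). This fails for n = 2 and 3 and holds from 4 on. The recursion alone therefore
  gives 1, 3, 6, 11, and the last point in dimension 4, from which (7) starts, needs its own
  argument. On the other side the moment curve gives 1, 3, 7, 13, one too many for n = 3 and 4. Gale
  diagrams fit because projecting along \<open>x - y\<close> just adds the coefficients of
  \<open>x\<close> and \<open>y\<close> in every affine dependency. The shape of each projected
  octahedron becomes a set of equations between coefficients of the original points, one set for
  each pair at different heights. The twelve points are chosen so that many pairs share a midpoint:
  0, half of (1,1,1,1), and half of each \<open>e_i + e_j\<close>. Each midpoint with enough pairs
  off the first hyperplane prescribes a member of the plane spanned by the other two normals; three
  independent members, or members spanning the first normal, are impossible.\<close>

lemma T_set_Suc: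
  "T_set (Suc j) = {x @\<^sub>v vCons 0 vNil | x. x \<in> carrier_vec j} \<union>
     {x @\<^sub>v vCons r vNil | x r. x \<in> T_set j \<and> 0 \<le> r}"
proof (cases j)
  case 0
  have "x @\<^sub>v vCons 0 vNil = 0\<^sub>v 1" if "x \<in> carrier_vec 0" for x :: "real vec"
    using that by (intro eq_vecI) auto
  then show ?thesis using 0 by (auto intro!: exI[of _ "0\<^sub>v 0"])
qed simp

lemma snoc_vec_index:
  assumes "x \<in> carrier_vec j" "i < Suc j"
  shows "(x @\<^sub>v vCons r vNil) $ i = (if i < j then x $ i else r)"
  using assms by auto

lemma snoc_vec_eq:
  assumes "y \<in> carrier_vec (Suc j)"
  shows "y = vec j (\<lambda>i. y $ i) @\<^sub>v vCons (y $ j) vNil"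
  using assms by (intro eq_vecI) (auto simp: less_Suc_eq)

text \<open>The recursion unwound from the last coordinate: every level passed contributes a
  nonnegative coordinate, and \<open>k\<close> is the level where the unwinding stops at a vanishing
  one.\<close>

lemma T_set_iff:
  "y \<in> T_set j \<longleftrightarrow>
     y \<in> carrier_vec j \<and> (\<exists>k<j. y $ k = 0 \<and> (\<forall>i. k < i \<and> i < j \<longrightarrow> 0 \<le> y $ i))"
proof (induction j arbitrary: y)
  case 0
  then show ?case by simp
next
  case (Suc j)
  show ?case
  proof
    assume "y \<in> T_set (Suc j)"
    then consider x where "y = x @\<^sub>v vCons 0 vNil" "x \<in> carrier_vec j"
      | x r where "y = x @\<^sub>v vCons r vNil" "x \<in> T_set j" "0 \<le> r"
      unfolding T_set_Suc by blast
    then show "y \<in> carrier_vec (Suc j) \<and>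
        (\<exists>k<Suc j. y $ k = 0 \<and> (\<forall>i. k < i \<and> i < Suc j \<longrightarrow> 0 \<le> y $ i))"
    proof cases
      case 1
      then have "y \<in> carrier_vec (Suc j)" by (intro carrier_vecI) simp
      moreover have "y $ j = 0" using 1 by (simp add: snoc_vec_index)
      ultimately show ?thesis by (intro conjI exI[of _ j]) auto
    next
      case 2
      then obtain k where k: "x \<in> carrier_vec j" "k < j" "x $ k = 0"
        "\<And>i. k < i \<Longrightarrow> i < j \<Longrightarrow> 0 \<le> x $ i" using Suc by blast
      then have "y \<in> carrier_vec (Suc j)" using 2(1) by (intro carrier_vecI) simp
      moreover have "y $ i = (if i < j then x $ i else r)" if "i < Suc j" for i
        unfolding 2(1) using k that by (intro snoc_vec_index) 
      ultimately show ?thesis using k 2 by (intro conjI exI[of _ k]) (auto simp: less_Suc_eq)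
    qed
  next
    assume "y \<in> carrier_vec (Suc j) \<and>
        (\<exists>k<Suc j. y $ k = 0 \<and> (\<forall>i. k < i \<and> i < Suc j \<longrightarrow> 0 \<le> y $ i))"
    then obtain k where k: "y \<in> carrier_vec (Suc j)" "k < Suc j" "y $ k = 0"
        "\<And>i. k < i \<Longrightarrow> i < Suc j \<Longrightarrow> 0 \<le> y $ i" by blast
    note y = snoc_vec_eq[OF k(1)]
    show "y \<in> T_set (Suc j)"
    proof (cases "k = j")
      case True
      then have "y = vec j (\<lambda>i. y $ i) @\<^sub>v vCons 0 vNil" using y k by simp
      then show ?thesis unfolding T_set_Suc using vec_carrier by blast
    next
      case False
      then have "vec j (\<lambda>i. y $ i) \<in> T_set j" using k
        by (subst Suc) (auto intro!: exI[of _ k])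
      moreover have "0 \<le> y $ j" using False k by auto
      ultimately show ?thesis unfolding T_set_Suc using y by blast
    qed
  qed
qed

text \<open>Coordinate 0 is the free factor of the product, hence \<open>0 < k\<close>. The
  coordinate with the highest index belongs to the hyperplane that is peeled off first.\<close>

lemma T_shaped_iff:
  assumes "0 < n"
  shows "T_shaped n C \<longleftrightarrow> (\<exists>f. affine_transformation n f \<and> (\<forall>c\<in>C. f c \<in> carrier_vec n \<and>
     (\<exists>k. 0 < k \<and> k < n \<and> f c $ k = 0 \<and> (\<forall>i. k < i \<and> i < n \<longrightarrow> 0 \<le> f c $ i))))"
proof -
  obtain j where n: "n = Suc j" using assms by (cases n) auto
  have "y \<in> {vCons a x | a x. x \<in> T_set (n - 1)} \<longleftrightarrow> y \<in> carrier_vec n \<and>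
     (\<exists>k. 0 < k \<and> k < n \<and> y $ k = 0 \<and> (\<forall>i. k < i \<and> i < n \<longrightarrow> 0 \<le> y $ i))" (is "?L \<longleftrightarrow> ?R")
    for y :: "real vec"
  proof
    assume ?L
    then obtain a x where y: "y = vCons a x" and "x \<in> T_set j" using n by auto
    then obtain k where k: "x \<in> carrier_vec j" "k < j" "x $ k = 0"
        "\<And>i. k < i \<Longrightarrow> i < j \<Longrightarrow> 0 \<le> x $ i" unfolding T_set_iff by blast
    then show ?R unfolding y n
      by (intro conjI exI[of _ "Suc k"]) (auto simp: vec_index_vCons)
  next
    assume ?R
    then obtain k where k: "y \<in> carrier_vec n" "0 < k" "k < n" "y $ k = 0"
       "\<And>i. k < i \<Longrightarrow> i < n \<Longrightarrow> 0 \<le> y $ i" by blast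
    have "y = vCons (y $ 0) (vec j (\<lambda>i. y $ Suc i))"
      using k(1) n by (intro eq_vecI) (auto simp: vec_index_vCons)
    moreover have "vec j (\<lambda>i. y $ Suc i) \<in> T_set j"
      unfolding T_set_iff using k n by (intro conjI exI[of _ "k - 1"]) auto
    ultimately show ?L using n by auto
  qed
  then show ?thesis unfolding T_shaped_def image_subset_iff by simp
qed

text \<open>Linearity of \<open>f - f 0\<close> is required on the carrier only, so that functionals
  can be combined and composed with linear maps between different dimensions without
  matrices.\<close>

definition affine_fun :: "nat \<Rightarrow> (real vec \<Rightarrow> real) \<Rightarrow> bool" where
  "affine_fun n f \<longleftrightarrow> (\<forall>x\<in>carrier_vec n. \<forall>y\<in>carrier_vec n. \<forall>s t.
     f (s \<cdot>\<^sub>v x + t \<cdot>\<^sub>v y) - f (0\<^sub>v n) = s * (f x - f (0\<^sub>v n)) + t * (f y - f (0\<^sub>v n)))"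

definition linear_vec :: "nat \<Rightarrow> nat \<Rightarrow> (real vec \<Rightarrow> real vec) \<Rightarrow> bool" where
  "linear_vec n m L \<longleftrightarrow> (\<forall>x\<in>carrier_vec n. L x \<in> carrier_vec m) \<and>
     (\<forall>x\<in>carrier_vec n. \<forall>y\<in>carrier_vec n. \<forall>s t. L (s \<cdot>\<^sub>v x + t \<cdot>\<^sub>v y) = s \<cdot>\<^sub>v L x + t \<cdot>\<^sub>v L y)"

lemma affine_fun_comb:
  assumes "affine_fun n f" "affine_fun n g"
  shows "affine_fun n (\<lambda>x. s * f x + t * g x + r)"
  unfolding affine_fun_def
proof (intro ballI allI)
  fix x y :: "real vec" and u w :: real
  assume "x \<in> carrier_vec n" "y \<in> carrier_vec n"
  then have *: "f (u \<cdot>\<^sub>v x + w \<cdot>\<^sub>v y) = f (0\<^sub>v n) + u * (f x - f (0\<^sub>v n)) + w * (f y - f (0\<^sub>v n))"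
    "g (u \<cdot>\<^sub>v x + w \<cdot>\<^sub>v y) = g (0\<^sub>v n) + u * (g x - g (0\<^sub>v n)) + w * (g y - g (0\<^sub>v n))"
    using assms unfolding affine_fun_def by (metis add.assoc add_diff_cancel_left' diff_add_cancel add.commute)+
  show "s * f (u \<cdot>\<^sub>v x + w \<cdot>\<^sub>v y) + t * g (u \<cdot>\<^sub>v x + w \<cdot>\<^sub>v y) + r - (s * f (0\<^sub>v n) + t * g (0\<^sub>v n) + r) =
      u * (s * f x + t * g x + r - (s * f (0\<^sub>v n) + t * g (0\<^sub>v n) + r)) +
      w * (s * f y + t * g y + r - (s * f (0\<^sub>v n) + t * g (0\<^sub>v n) + r))"
    unfolding * by (simp add: algebra_simps)
qed

lemma affine_fun_scale: "affine_fun n f \<Longrightarrow> affine_fun n (\<lambda>x. s * f x + r)"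
  using affine_fun_comb[of n f f s 0 r] by simp

lemma affine_fun_add_scaled: "affine_fun n f \<Longrightarrow> affine_fun n g \<Longrightarrow> affine_fun n (\<lambda>x. f x + t * g x)"
  using affine_fun_comb[of n f g 1 t 0] by simp

lemma affine_fun_scalar_prod:
  assumes a: "a \<in> carrier_vec n"
  shows "affine_fun n (\<lambda>x. a \<bullet> x + b)"
  unfolding affine_fun_def
  using a by (simp add: scalar_prod_add_distrib[of a n])

lemma linear_vec_zero:
  assumes L: "linear_vec n m L"
  shows "L (0\<^sub>v n) = 0\<^sub>v m"
proof -
  have "L (0 \<cdot>\<^sub>v 0\<^sub>v n + 0 \<cdot>\<^sub>v 0\<^sub>v n) = 0 \<cdot>\<^sub>v L (0\<^sub>v n) + 0 \<cdot>\<^sub>v L (0\<^sub>v n)"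
    using L unfolding linear_vec_def by (meson zero_carrier_vec)
  moreover have "0 \<cdot>\<^sub>v 0\<^sub>v n + 0 \<cdot>\<^sub>v 0\<^sub>v n = (0\<^sub>v n :: real vec)" by (intro eq_vecI) simp_all
  moreover have "dim_vec (L (0\<^sub>v n)) = m"
    using L unfolding linear_vec_def by (meson zero_carrier_vec carrier_vecD)
  then have "0 \<cdot>\<^sub>v L (0\<^sub>v n) + 0 \<cdot>\<^sub>v L (0\<^sub>v n) = 0\<^sub>v m" by (intro eq_vecI) simp_all
  ultimately show ?thesis by simp
qed

lemma affine_fun_linear_vec:
  assumes "affine_fun m f" "linear_vec n m L"
  shows "affine_fun n (\<lambda>x. f (L x))"
  using assms linear_vec_zero[OF assms(2)] unfolding affine_fun_def linear_vec_def by simp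

lemma affine_fun_coordinates:
  assumes f: "affine_fun n f" and x: "x \<in> carrier_vec n"
  shows "f x = (\<Sum>i<n. x $ i * (f (unit_vec n i) - f (0\<^sub>v n))) + f (0\<^sub>v n)"
proof -
  have "f (vec n (\<lambda>i. if i < k then x $ i else 0)) =
      (\<Sum>i<k. x $ i * (f (unit_vec n i) - f (0\<^sub>v n))) + f (0\<^sub>v n)" if "k \<le> n" for k
    using that
  proof (induction k)
    case 0
    have "vec n (\<lambda>i. if i < 0 then x $ i else 0) = 0\<^sub>v n" by (intro eq_vecI) auto
    then show ?case by simp
  next
    case (Suc k)
    let ?v = "vec n (\<lambda>i. if i < k then x $ i else 0)"
    have "vec n (\<lambda>i. if i < Suc k then x $ i else 0) = 1 \<cdot>\<^sub>v ?v + (x $ k) \<cdot>\<^sub>v unit_vec n k"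
      using Suc by (intro eq_vecI) (auto simp: less_Suc_eq)
    moreover have "f (1 \<cdot>\<^sub>v ?v + (x $ k) \<cdot>\<^sub>v unit_vec n k) - f (0\<^sub>v n) =
        1 * (f ?v - f (0\<^sub>v n)) + x $ k * (f (unit_vec n k) - f (0\<^sub>v n))"
      using f unfolding affine_fun_def by (meson vec_carrier unit_vec_carrier)
    ultimately show ?case using Suc by simp
  qed
  moreover have "vec n (\<lambda>i. if i < n then x $ i else 0) = x" using x by (intro eq_vecI) auto
  ultimately show ?thesis by (metis order_refl)
qed

text \<open>Back to matrices: the columns are the images of the unit vectors, and a trivial kernel
  makes the determinant nonzero.\<close>

lemma affine_transformation_linear:
  assumes L: "linear_vec n n L" and ker: "\<And>x. x \<in> carrier_vec n \<Longrightarrow> L x = 0\<^sub>v n \<Longrightarrow> x = 0\<^sub>v n"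
    and b: "b \<in> carrier_vec n"
  shows "affine_transformation n (\<lambda>x. L x + b)"
proof -
  define A where "A = mat n n (\<lambda>(i,j). L (unit_vec n j) $ i)"
  have A: "A \<in> carrier_mat n n" by (simp add: A_def)
  have Ax: "A *\<^sub>v x = L x" if x: "x \<in> carrier_vec n" for x
  proof (intro eq_vecI)
    have Lx: "L x \<in> carrier_vec n" using L x by (auto simp: linear_vec_def)
    then show "dim_vec (A *\<^sub>v x) = dim_vec (L x)" using A by simp
    fix i assume "i < dim_vec (L x)"
    then have i: "i < n" using Lx by simp
    have "affine_fun n (\<lambda>x. unit_vec n i \<bullet> L x + 0)"
      by (rule affine_fun_linear_vec[OF affine_fun_scalar_prod L]) simp
    from affine_fun_coordinates[OF this x]
    have "L x $ i = (\<Sum>j<n. x $ j * L (unit_vec n j) $ i)"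
      using i L x linear_vec_zero[OF L] by (simp add: linear_vec_def)
    then show "(A *\<^sub>v x) $ i = L x $ i"
      using i x by (simp add: A_def scalar_prod_def lessThan_atLeast0 mult.commute)
  qed
  have "det A \<noteq> 0"
    using det_0_iff_vec_prod_zero_field[OF A] Ax ker by metis
  then obtain B where "B \<in> carrier_mat n n" "A * B = 1\<^sub>m n" "B * A = 1\<^sub>m n"
    using det_non_zero_imp_unit[OF A] by (auto simp: Units_def ring_mat_def)
  then have "invertible_mat A" using A unfolding invertible_mat_def inverts_mat_def square_mat.simps
    by (metis carrier_matD)
  then show ?thesis unfolding affine_transformation_def using A b Ax by metis
qed

text \<open>The quotient by the line of \<open>v\<close>, in coordinates: clear a coordinate
  \<open>k\<close> with \<open>v $ k \<noteq> 0\<close> by a multiple of \<open>v\<close> and delete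
  it. \<open>S\<close> reinserts a zero there.\<close>

lemma projection_along:
  assumes v: "v \<in> carrier_vec (Suc n)" "v \<noteq> 0\<^sub>v (Suc n)"
  obtains P S where "linear_vec (Suc n) n P" "linear_vec n (Suc n) S" "P v = 0\<^sub>v n"
    "\<And>x. x \<in> carrier_vec (Suc n) \<Longrightarrow> \<exists>t. x = 1 \<cdot>\<^sub>v S (P x) + t \<cdot>\<^sub>v v"
proof -
  obtain k where k: "k < Suc n" "v $ k \<noteq> 0"
    using v by (metis carrier_vecD eq_vecI index_zero_vec)
  define skip where "skip i = (if i < k then i else Suc i)" for i
  define P where "P x = vec n (\<lambda>i. x $ skip i - x $ k / v $ k * v $ skip i)" for x :: "real vec"
  define S where "S y = vec (Suc n) (\<lambda>j. if j < k then y $ j else if j = k then 0 else y $ (j - 1))"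
    for y :: "real vec"
  have skip: "skip i < Suc n" if "i < n" for i using that by (auto simp: skip_def)
  have 1: "linear_vec (Suc n) n P" unfolding linear_vec_def P_def
    using skip k by (auto intro!: eq_vecI simp: field_simps)
  have 2: "linear_vec n (Suc n) S" unfolding linear_vec_def S_def
    using k by (auto intro!: eq_vecI)
  have 3: "P v = 0\<^sub>v n" using k by (intro eq_vecI) (auto simp: P_def)
  have 4: "x = 1 \<cdot>\<^sub>v S (P x) + (x $ k / v $ k) \<cdot>\<^sub>v v" if x: "x \<in> carrier_vec (Suc n)" for x
  proof (intro eq_vecI)
    show "dim_vec x = dim_vec (1 \<cdot>\<^sub>v S (P x) + (x $ k / v $ k) \<cdot>\<^sub>v v)" using x v by simp
    fix j assume "j < dim_vec (1 \<cdot>\<^sub>v S (P x) + (x $ k / v $ k) \<cdot>\<^sub>v v)"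
    then have j: "j < Suc n" using v by simp
    consider "j < k" | "j = k" | i where "j = Suc i" "k \<le> i" by (cases j) force+
    then show "x $ j = (1 \<cdot>\<^sub>v S (P x) + (x $ k / v $ k) \<cdot>\<^sub>v v) $ j"
      by cases (use j k v in \<open>auto simp: S_def P_def skip_def\<close>)
  qed
  show ?thesis using that 1 2 3 4 by blast
qed

section \<open>Peeling off a hyperplane and projecting\<close>

lemma T_shaped_empty:
  assumes "0 < n"
  shows "T_shaped n {}"
proof -
  have "linear_vec n n (\<lambda>x. x)" by (simp add: linear_vec_def)
  then have "affine_transformation n (\<lambda>x. x + 0\<^sub>v n)" by (rule affine_transformation_linear) auto
  then show ?thesis using T_shaped_iff[OF assms] by blast
qed

text \<open>Append \<open>l\<close> as a new last coordinate to the transformation of the projected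
  set. Points with \<open>l c = 0\<close> are caught by it; all others keep the vanishing coordinate
  of their projection and need only \<open>0 \<le> l c\<close>. The combined map is injective, since
  the kernel of \<open>P\<close> is the line of \<open>v\<close> and \<open>l\<close> varies along
  it.\<close>

lemma T_shaped_peel:
  assumes n: "0 < n" and C: "C \<subseteq> carrier_vec (Suc n)" and l: "affine_fun (Suc n) l"
    and v: "v \<in> carrier_vec (Suc n)" "l v \<noteq> l (0\<^sub>v (Suc n))"
    and P: "linear_vec (Suc n) n P" and S: "linear_vec n (Suc n) S" and Pv: "P v = 0\<^sub>v n"
    and SP: "\<And>x. x \<in> carrier_vec (Suc n) \<Longrightarrow> \<exists>t. x = 1 \<cdot>\<^sub>v S (P x) + t \<cdot>\<^sub>v v"
    and nonneg: "\<And>c. c \<in> C \<Longrightarrow> 0 \<le> l c"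
    and T: "T_shaped n (P ` {c\<in>C. 0 < l c})"
  shows "T_shaped (Suc n) C"
proof -
  let ?z = "0\<^sub>v (Suc n)"
  obtain f where f: "affine_transformation n f" and
    fT: "\<And>c. c \<in> C \<Longrightarrow> 0 < l c \<Longrightarrow> f (P c) \<in> carrier_vec n \<and>
     (\<exists>k. 0 < k \<and> k < n \<and> f (P c) $ k = 0 \<and> (\<forall>i. k < i \<and> i < n \<longrightarrow> 0 \<le> f (P c) $ i))"
    using T T_shaped_iff[OF n] by auto
  obtain B b where B: "B \<in> carrier_mat n n" and b: "b \<in> carrier_vec n" and inv: "invertible_mat B"
    and fB: "\<And>x. x \<in> carrier_vec n \<Longrightarrow> f x = B *\<^sub>v x + b"
    using f unfolding affine_transformation_def by blast
  have Pc: "P x \<in> carrier_vec n" if "x \<in> carrier_vec (Suc n)" for x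
    using P that by (simp add: linear_vec_def)
  define L where "L x = vec (Suc n) (\<lambda>i. if i < n then (B *\<^sub>v P x) $ i else l x - l ?z)" for x
  define b' where "b' = vec (Suc n) (\<lambda>i. if i < n then b $ i else l ?z)"
  have L: "linear_vec (Suc n) (Suc n) L"
    unfolding linear_vec_def
  proof (intro conjI ballI allI)
    fix x y :: "real vec" and s t :: real assume x: "x \<in> carrier_vec (Suc n)" and y: "y \<in> carrier_vec (Suc n)"
    have Pxy: "P (s \<cdot>\<^sub>v x + t \<cdot>\<^sub>v y) = s \<cdot>\<^sub>v P x + t \<cdot>\<^sub>v P y"
      using P x y unfolding linear_vec_def by blast
    have "B *\<^sub>v (s \<cdot>\<^sub>v P x + t \<cdot>\<^sub>v P y) = s \<cdot>\<^sub>v (B *\<^sub>v P x) + t \<cdot>\<^sub>v (B *\<^sub>v P y)"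
      using B Pc[OF x] Pc[OF y] by (simp add: mult_add_distrib_mat_vec mult_mat_vec)
    moreover have "l (s \<cdot>\<^sub>v x + t \<cdot>\<^sub>v y) - l ?z = s * (l x - l ?z) + t * (l y - l ?z)"
      using l x y unfolding affine_fun_def by blast
    ultimately show "L (s \<cdot>\<^sub>v x + t \<cdot>\<^sub>v y) = s \<cdot>\<^sub>v L x + t \<cdot>\<^sub>v L y"
      unfolding L_def Pxy using B by (intro eq_vecI) auto
  qed (simp add: L_def)
  have "x = ?z" if x: "x \<in> carrier_vec (Suc n)" and L0: "L x = ?z" for x
  proof -
    have "L x $ i = 0" if "i < Suc n" for i using L0 that by simp
    then have L0i: "(if i < n then (B *\<^sub>v P x) $ i else l x - l ?z) = 0" if "i < Suc n" for i
      using that unfolding L_def by simp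
    have Li: "(B *\<^sub>v P x) $ i = 0" if "i < n" for i using L0i[of i] that by simp
    have ln: "l x = l ?z" using L0i[of n] by simp
    have "B *\<^sub>v P x = 0\<^sub>v n" using Li B by (intro eq_vecI) auto
    moreover obtain B' where "B' * B = 1\<^sub>m n" "B' \<in> carrier_mat n n"
      using inv B unfolding invertible_mat_def inverts_mat_def
      by (metis carrier_matD carrier_matI index_mult_mat(2,3) index_one_mat(2,3))
    moreover from this have "B' *\<^sub>v 0\<^sub>v n = 0\<^sub>v n" by (intro eq_vecI) auto
    ultimately have "P x = 0\<^sub>v n"
      using B Pc[OF x] by (metis assoc_mult_mat_vec one_mult_mat_vec)
    then obtain t where t: "x = 1 \<cdot>\<^sub>v S (0\<^sub>v n) + t \<cdot>\<^sub>v v" using SP[OF x] by auto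
    have "S (0\<^sub>v n) = ?z" by (rule linear_vec_zero[OF S])
    then have "l x - l ?z = 1 * (l ?z - l ?z) + t * (l v - l ?z)"
      unfolding t using l v(1) unfolding affine_fun_def by (metis zero_carrier_vec)
    then have "t = 0" using ln v(2) by simp
    then show ?thesis using t \<open>S (0\<^sub>v n) = ?z\<close> v(1) by (intro eq_vecI) auto
  qed
  then have "affine_transformation (Suc n) (\<lambda>x. L x + b')"
    by (intro affine_transformation_linear[OF L]) (auto simp: b'_def)
  moreover have "L c + b' \<in> carrier_vec (Suc n) \<and> (\<exists>k. 0 < k \<and> k < Suc n \<and> (L c + b') $ k = 0 \<and>
      (\<forall>i. k < i \<and> i < Suc n \<longrightarrow> 0 \<le> (L c + b') $ i))" if c: "c \<in> C" for c
  proof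
    show "L c + b' \<in> carrier_vec (Suc n)" by (simp add: L_def b'_def)
    have last: "(L c + b') $ n = l c" by (simp add: L_def b'_def)
    have init: "(L c + b') $ i = f (P c) $ i" if "i < n" for i
      using that fB[OF Pc] c C B b by (simp add: L_def b'_def subset_iff)
    show "\<exists>k. 0 < k \<and> k < Suc n \<and> (L c + b') $ k = 0 \<and>
      (\<forall>i. k < i \<and> i < Suc n \<longrightarrow> 0 \<le> (L c + b') $ i)"
    proof (cases "l c = 0")
      case True
      then show ?thesis using n last by (intro exI[of _ n]) auto
    next
      case False
      then have "0 < l c" using nonneg[OF c] by simp
      then obtain k where "0 < k" "k < n" "f (P c) $ k = 0"
        "\<And>i. k < i \<Longrightarrow> i < n \<Longrightarrow> 0 \<le> f (P c) $ i" using fT c by blast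
      then show ?thesis using init last \<open>0 < l c\<close> by (intro exI[of _ k]) (auto simp: less_Suc_eq)
    qed
  qed
  ultimately show ?thesis using T_shaped_iff[of "Suc n"] by blast
qed

text \<open>The inequality \<open>enat k \<le> t_number n\<close>, kept free of \<open>enat\<close>
  and infima for the geometric arguments.\<close>

definition T_bound :: "nat \<Rightarrow> nat \<Rightarrow> bool" where
  "T_bound n k \<longleftrightarrow> (\<forall>C. C \<subseteq> carrier_vec n \<and> finite C \<and> card C < k \<longrightarrow> T_shaped n C)"

lemma T_bound_iff: "T_bound n k \<longleftrightarrow> enat k \<le> t_number n"
  unfolding T_bound_def t_number_def le_INF_iff
  by (auto simp: not_less)

lemma affine_fun_nonconst:
  assumes "affine_fun n l" "p \<in> carrier_vec n" "q \<in> carrier_vec n" "l p \<noteq> l q"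
  shows "l (p - q) \<noteq> l (0\<^sub>v n)"
proof -
  have "p - q = 1 \<cdot>\<^sub>v p + (-1) \<cdot>\<^sub>v q" using assms by (intro eq_vecI) auto
  then have "l (p - q) - l (0\<^sub>v n) = 1 * (l p - l (0\<^sub>v n)) + (-1) * (l q - l (0\<^sub>v n))"
    using assms unfolding affine_fun_def by metis
  then show ?thesis using assms by simp
qed

lemma linear_vec_eq:
  assumes P: "linear_vec n m P" and pq: "p \<in> carrier_vec n" "q \<in> carrier_vec n" "P (p - q) = 0\<^sub>v m"
  shows "P p = P q"
proof -
  have c: "P p \<in> carrier_vec m" "P q \<in> carrier_vec m" using P pq unfolding linear_vec_def by auto
  have "p - q = 1 \<cdot>\<^sub>v p + (-1) \<cdot>\<^sub>v q" using pq by (intro eq_vecI) auto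
  then have eq: "1 \<cdot>\<^sub>v P p + (-1) \<cdot>\<^sub>v P q = 0\<^sub>v m" using P pq unfolding linear_vec_def by metis
  show ?thesis
  proof (intro eq_vecI)
    fix i assume i: "i < dim_vec (P q)"
    have "(1 \<cdot>\<^sub>v P p + (-1) \<cdot>\<^sub>v P q) $ i = 0\<^sub>v m $ i" using eq by simp
    then show "P p $ i = P q $ i" using i c by auto
  qed (use c in auto)
qed

text \<open>The direction \<open>p - q\<close> is transversal to the hyperplane because
  \<open>l p \<noteq> l q\<close>. If \<open>p\<close> and \<open>q\<close> are themselves among the
  remaining points, their images coincide, so one more remaining point can be afforded.\<close>

lemma T_shaped_peel_card:
  assumes n: "0 < n" and C: "C \<subseteq> carrier_vec (Suc n)" and fin: "finite C"
    and l: "affine_fun (Suc n) l"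
    and pq: "p \<in> carrier_vec (Suc n)" "q \<in> carrier_vec (Suc n)" "l p \<noteq> l q"
    and nonneg: "\<And>c. c \<in> C \<Longrightarrow> 0 \<le> l c"
    and k: "T_bound n k" "card {c\<in>C. 0 < l c} < k \<or>
      card {c\<in>C. 0 < l c} \<le> k \<and> p \<in> C \<and> q \<in> C \<and> 0 < l p \<and> 0 < l q"
  shows "T_shaped (Suc n) C"
proof -
  let ?v = "p - q" and ?D = "{c\<in>C. 0 < l c}"
  have v: "?v \<in> carrier_vec (Suc n)" "l ?v \<noteq> l (0\<^sub>v (Suc n))"
    using affine_fun_nonconst[OF l pq] pq by auto
  then have "?v \<noteq> 0\<^sub>v (Suc n)" by metis
  with v obtain P S where P: "linear_vec (Suc n) n P" "linear_vec n (Suc n) S" "P ?v = 0\<^sub>v n"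
    "\<And>x. x \<in> carrier_vec (Suc n) \<Longrightarrow> \<exists>t. x = 1 \<cdot>\<^sub>v S (P x) + t \<cdot>\<^sub>v ?v"
    using projection_along by blast
  have eq: "P p = P q" by (rule linear_vec_eq[OF P(1) pq(1,2) P(3)])
  have finD: "finite ?D" using fin by simp
  have "card (P ` ?D) < k" using k(2)
  proof
    assume "card ?D < k"
    then show ?thesis using card_image_le[OF finD, of P] by linarith
  next
    assume *: "card ?D \<le> k \<and> p \<in> C \<and> q \<in> C \<and> 0 < l p \<and> 0 < l q"
    then have "P ` ?D = P ` (?D - {p})" using eq pq(3) by auto
    then have "card (P ` ?D) \<le> card (?D - {p})" using card_image_le[of "?D - {p}" P] finD by simp
    also have "\<dots> < card ?D" using * finD by (intro card_Diff1_less) auto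
    finally show ?thesis using * by linarith
  qed
  moreover have "P ` ?D \<subseteq> carrier_vec n" using P(1) C unfolding linear_vec_def by auto
  ultimately have "T_shaped n (P ` ?D)" using k(1) finD unfolding T_bound_def by blast
  from T_shaped_peel[OF n C l v P nonneg this] show ?thesis by blast
qed

section \<open>Facets and the recursive lower bound\<close>

text \<open>Pad the system with zero rows to a square matrix. Row \<open>k\<close> vanishes, so the
  transpose kills a unit vector and the determinant is 0.\<close>

lemma homogeneous_system_nontrivial:
  fixes M :: "nat \<Rightarrow> nat \<Rightarrow> real"
  assumes "k < m"
  obtains x where "\<exists>j<m. x j \<noteq> 0" "\<And>i. i < k \<Longrightarrow> (\<Sum>j<m. M i j * x j) = 0"
proof -
  define A where "A = mat m m (\<lambda>(i,j). if i < k then M i j else 0)"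
  have A: "A \<in> carrier_mat m m" by (simp add: A_def)
  have "transpose_mat A *\<^sub>v unit_vec m k = 0\<^sub>v m"
    using assms by (intro eq_vecI) (auto simp: A_def)
  moreover have "unit_vec m k \<noteq> (0\<^sub>v m :: real vec)"
    using assms by (metis index_unit_vec(1) index_zero_vec(1) zero_neq_one)
  ultimately have "det (transpose_mat A) = 0"
    using det_0_iff_vec_prod_zero_field[of "transpose_mat A" m] A by (metis transpose_carrier_mat unit_vec_carrier)
  then have "det A = 0" using det_transpose[OF A] by simp
  then obtain v where v: "v \<in> carrier_vec m" "v \<noteq> 0\<^sub>v m" "A *\<^sub>v v = 0\<^sub>v m"
    using det_0_iff_vec_prod_zero_field[OF A] by blast
  have "\<exists>j<m. v $ j \<noteq> 0" using v(1,2) by (metis carrier_vecD eq_vecI index_zero_vec)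
  moreover have "(\<Sum>j<m. M i j * v $ j) = 0" if "i < k" for i
  proof -
    have "(A *\<^sub>v v) $ i = 0" using v(3) that assms by simp
    then show ?thesis using that assms v(1) by (simp add: A_def scalar_prod_def lessThan_atLeast0)
  qed
  ultimately show ?thesis using that by blast
qed

lemma affine_fun_vanishing:
  assumes Z: "finite Z" "Z \<subseteq> carrier_vec n" "card Z \<le> n"
  obtains g where "affine_fun n g" "\<forall>z\<in>Z. g z = 0" "\<exists>x\<in>carrier_vec n. g x \<noteq> 0"
proof -
  obtain h where h: "bij_betw h {0..<card Z} Z" using ex_bij_betw_nat_finite[OF Z(1)] by blast
  obtain a where a: "\<exists>j<Suc n. a j \<noteq> 0"
    "\<And>i. i < card Z \<Longrightarrow> (\<Sum>j<Suc n. (if j < n then h i $ j else 1) * a j) = 0"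
    using homogeneous_system_nontrivial[of "card Z" "Suc n" "\<lambda>i j. if j < n then h i $ j else 1"] Z(3)
    by (metis le_imp_less_Suc)
  define g where "g x = vec n a \<bullet> x + a n" for x
  have 1: "affine_fun n g" unfolding g_def by (rule affine_fun_scalar_prod) simp
  have 2: "g z = 0" if z: "z \<in> Z" for z
  proof -
    obtain i where i: "i < card Z" "z = h i"
      using bij_betw_imp_surj_on[OF h] z by force
    have "z \<in> carrier_vec n" using Z z by auto
    then have "g z = (\<Sum>j<n. z $ j * a j) + a n"
      by (simp add: g_def scalar_prod_def lessThan_atLeast0 mult.commute)
    then show ?thesis using a(2)[OF i(1)] i(2) by simp
  qed
  have 3: "\<exists>x\<in>carrier_vec n. g x \<noteq> 0"
  proof (rule ccontr)
    assume "\<not> ?thesis"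
    then have 0: "\<And>x. x \<in> carrier_vec n \<Longrightarrow> g x = 0" by blast
    have "a n = 0" using 0[of "0\<^sub>v n"] by (simp add: g_def)
    moreover have "a j = 0" if "j < n" for j
      using 0[of "unit_vec n j"] that \<open>a n = 0\<close> by (simp add: g_def)
    ultimately show False using a(1) by (auto simp: less_Suc_eq)
  qed
  show ?thesis using that 1 2 3 by blast
qed

text \<open>An affine dependency satisfies \<open>n + 1\<close> linear equations. With more than
  \<open>n + 2\<close> points there is room for one more, namely \<open>u c = 0\<close>.\<close>

lemma affine_dependency:
  assumes D: "finite D" "D \<subseteq> carrier_vec n" "n + 2 < card D"
  obtains u where "u c = 0" "\<exists>x\<in>D. u x \<noteq> (0::real)"
    "\<forall>f. affine_fun n f \<longrightarrow> (\<Sum>x\<in>D. u x * f x) = 0"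
proof -
  let ?m = "card D"
  obtain h where h: "bij_betw h {0..<?m} D" using ex_bij_betw_nat_finite[OF D(1)] by blast
  define M where "M i j = (if i < n then h j $ i else if i = n then 1 else if h j = c then 1 else 0)"
    for i j
  obtain a where a: "\<exists>j<?m. a j \<noteq> 0" "\<And>i. i < n + 2 \<Longrightarrow> (\<Sum>j<?m. M i j * a j) = 0"
    using homogeneous_system_nontrivial[OF D(3), of M] by blast
  define g where "g = the_inv_into {0..<?m} h"
  have gh: "g (h j) = j" if "j < ?m" for j
    using h that unfolding g_def bij_betw_def by (simp add: the_inv_into_f_f)
  define u where "u x = (if x \<in> D then a (g x) else 0)" for x
  have hD: "h j \<in> D" if "j < ?m" for j using h that by (auto simp: bij_betw_def)
  have sum: "(\<Sum>x\<in>D. u x * F x) = (\<Sum>j<?m. F (h j) * a j)" for F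
    using sum.reindex_bij_betw[OF h, of "\<lambda>x. u x * F x", symmetric] gh hD
    by (simp add: u_def lessThan_atLeast0 mult.commute)
  have "(\<Sum>j<?m. (if h j = c then 1 else 0) * a j) = 0" using a(2)[of "Suc n"] by (simp add: M_def)
  then have "(\<Sum>x\<in>D. u x * (if x = c then 1 else 0)) = 0" using sum[of "\<lambda>x. if x = c then 1 else 0"] by simp
  then have "u c = 0"
    using D(1) by (cases "c \<in> D") (simp_all add: u_def if_distrib cong: if_cong)
  moreover obtain j where "j < ?m" "a j \<noteq> 0" using a(1) by blast
  then have "\<exists>x\<in>D. u x \<noteq> 0" using gh hD by (intro bexI[of _ "h j"]) (auto simp: u_def)
  moreover have "(\<Sum>x\<in>D. u x * f x) = 0" if f: "affine_fun n f" for f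
  proof -
    have ones: "(\<Sum>x\<in>D. u x * 1) = 0" using a(2)[of n] sum[of "\<lambda>_. 1"] by (simp add: M_def)
    have coord: "(\<Sum>x\<in>D. u x * x $ i) = 0" if "i < n" for i
      using a(2)[of i] sum[of "\<lambda>x. x $ i"] that by (simp add: M_def)
    have "(\<Sum>x\<in>D. u x * f x) = (\<Sum>x\<in>D. u x * ((\<Sum>i<n. x $ i * (f (unit_vec n i) - f (0\<^sub>v n))) + f (0\<^sub>v n)))"
    proof (intro sum.cong refl arg_cong2[where f = "(*)"])
      fix x assume "x \<in> D"
      then show "f x = (\<Sum>i<n. x $ i * (f (unit_vec n i) - f (0\<^sub>v n))) + f (0\<^sub>v n)"
        using affine_fun_coordinates[OF f] D(2) by blast
    qed
    also have "\<dots> = (\<Sum>x\<in>D. \<Sum>i<n. (u x * x $ i) * (f (unit_vec n i) - f (0\<^sub>v n))) + (\<Sum>x\<in>D. u x * f (0\<^sub>v n))"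
      by (simp add: sum_distrib_left algebra_simps sum.distrib sum_subtractf)
    also have "\<dots> = (\<Sum>i<n. (\<Sum>x\<in>D. u x * x $ i) * (f (unit_vec n i) - f (0\<^sub>v n))) + (\<Sum>x\<in>D. u x * 1) * f (0\<^sub>v n)"
      by (subst sum.swap) (simp add: sum_distrib_right)
    also have "\<dots> = 0" using ones coord by simp
    finally show ?thesis .
  qed
  ultimately show ?thesis using that by blast
qed

section \<open>Supporting hyperplanes and facets\<close>

definition supporting :: "nat \<Rightarrow> real vec set \<Rightarrow> (real vec \<Rightarrow> real) \<Rightarrow> bool" where
  "supporting n C m \<longleftrightarrow> affine_fun n m \<and> (\<forall>c\<in>C. 0 \<le> m c) \<and> (\<exists>c\<in>C. m c = 0) \<and>
     (\<exists>x\<in>carrier_vec n. m x \<noteq> 0)"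

text \<open>Adds to \<open>g\<close> the smallest multiple of \<open>m\<close> that makes it nonnegative on \<open>C\<close>: the hyperplane
  is rotated about the common zeros of \<open>g\<close> and \<open>m\<close> until it hits a new point.\<close>

lemma rotate_hyperplane:
  fixes m g :: "'a \<Rightarrow> real"
  assumes C: "finite C" and m: "\<forall>c\<in>C. 0 \<le> m c" and ex: "\<exists>c\<in>C. 0 < m c"
    and g: "\<forall>c\<in>C. m c = 0 \<longrightarrow> 0 \<le> g c"
  obtains s y where "\<forall>c\<in>C. 0 \<le> g c + s * m c" "y \<in> C" "0 < m y" "g y + s * m y = 0"
proof -
  let ?D = "{c\<in>C. 0 < m c}"
  define s where "s = Max ((\<lambda>c. - g c / m c) ` ?D)"
  have fin: "finite ((\<lambda>c. - g c / m c) ` ?D)" and ne: "(\<lambda>c. - g c / m c) ` ?D \<noteq> {}"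
    using C ex by auto
  have "0 \<le> g c + s * m c" if "c \<in> C" for c
  proof (cases "m c = 0")
    case False
    then have c: "c \<in> ?D" using m that by auto
    then have "- g c / m c \<le> s" unfolding s_def using fin by (intro Max_ge) auto
    then show ?thesis using c by (simp add: field_simps)
  qed (use g that in simp)
  moreover have "s \<in> (\<lambda>c. - g c / m c) ` ?D" unfolding s_def using fin ne by (rule Max_in)
  then obtain y where "y \<in> C" "0 < m y" "s = - g y / m y" by blast
  moreover from this have "g y + s * m y = 0" by simp
  ultimately show ?thesis using that by blast
qed

text \<open>Each rotation adds a zero, so the induction is on the number of points off the
  hyperplane. The second alternative covers sets contained in a hyperplane.\<close>

lemma supporting_facet:
  assumes C: "finite C" "C \<subseteq> carrier_vec n" and m: "supporting n C m"
  obtains m' where "supporting n C m'" "{c\<in>C. m c = 0} \<subseteq> {c\<in>C. m' c = 0}"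
    "n \<le> card {c\<in>C. m' c = 0} \<or> {c\<in>C. m' c = 0} = C"
proof -
  have "\<exists>m'. supporting n C m' \<and> {c\<in>C. m c = 0} \<subseteq> {c\<in>C. m' c = 0} \<and>
    (n \<le> card {c\<in>C. m' c = 0} \<or> {c\<in>C. m' c = 0} = C)"
    using m
  proof (induction "card C - card {c\<in>C. m c = 0}" arbitrary: m rule: less_induct)
    case less
    let ?Z = "{c\<in>C. m c = 0}"
    show ?case
    proof (cases "n \<le> card ?Z \<or> ?Z = C")
      case True
      then show ?thesis using less.prems by blast
    next
      case False
      have aff: "affine_fun n m" and nn: "\<forall>c\<in>C. 0 \<le> m c"
        using less.prems by (auto simp: supporting_def)
      obtain w where w: "w \<in> carrier_vec n" "m w \<noteq> 0" using less.prems by (auto simp: supporting_def)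
      \<comment> \<open>Making \<open>g\<close> vanish at \<open>w\<close>, where \<open>m\<close>
        does not, keeps \<open>g\<close> from being a nonzero multiple of \<open>m\<close>; so
        \<open>g + s * m\<close> is not the zero functional.\<close>
      have fz: "finite (insert w ?Z)" "insert w ?Z \<subseteq> carrier_vec n" "card (insert w ?Z) \<le> n"
        using False C w by (auto simp: card_insert_if)
      obtain g where g: "affine_fun n g" "\<forall>z\<in>insert w ?Z. g z = 0"
        "\<exists>x\<in>carrier_vec n. g x \<noteq> 0"
        using affine_fun_vanishing[OF fz] by blast
      have ex: "\<exists>c\<in>C. 0 < m c" using False nn by force
      have g0: "\<forall>c\<in>C. m c = 0 \<longrightarrow> 0 \<le> g c" using g(2) by simp
      obtain s y where s: "\<forall>c\<in>C. 0 \<le> g c + s * m c" "y \<in> C" "0 < m y" "g y + s * m y = 0"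
        using rotate_hyperplane[OF C(1) nn ex g0] by blast
      let ?m = "\<lambda>x. g x + s * m x"
      have sub: "?Z \<subseteq> {c\<in>C. ?m c = 0}" using g(2) by auto
      have "?m x \<noteq> 0" if "g x \<noteq> 0" "x \<in> carrier_vec n" "?m w = 0" for x
        using that g(2) w by simp
      then have "\<exists>x\<in>carrier_vec n. ?m x \<noteq> 0" using g(3) w(1) by blast
      then have supp: "supporting n C ?m"
        unfolding supporting_def using affine_fun_add_scaled[OF g(1) aff] s by blast
      have "?Z \<subset> {c\<in>C. ?m c = 0}" using sub s by force
      then have "card ?Z < card {c\<in>C. ?m c = 0}" using C by (intro psubset_card_mono) auto
      moreover have "card {c\<in>C. ?m c = 0} \<le> card C" using C by (intro card_mono) auto
      ultimately have "card C - card {c\<in>C. ?m c = 0} < card C - card ?Z" by linarith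
      from less.hyps[OF this supp] sub show ?thesis by (meson order_trans)
    qed
  qed
  then show ?thesis using that by blast
qed

lemma supporting_exists:
  assumes "finite C" "C \<subseteq> carrier_vec n" "C \<noteq> {}" "0 < n"
  shows "\<exists>m. supporting n C m"
proof -
  define a where "a = Min ((\<lambda>x. x $ 0) ` C)"
  let ?m = "\<lambda>x. unit_vec n 0 \<bullet> x + - a"
  have f: "?m x = x $ 0 - a" if "x \<in> carrier_vec n" for x using that assms by simp
  have "affine_fun n ?m" by (rule affine_fun_scalar_prod) simp
  moreover have "0 \<le> ?m c" if "c \<in> C" for c
  proof -
    have "a \<le> c $ 0" unfolding a_def using assms that by (intro Min_le) auto
    then show ?thesis using f[of c] that assms by auto
  qed
  moreover have "a \<in> (\<lambda>x. x $ 0) ` C" unfolding a_def using assms by (intro Min_in) auto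
  then obtain c where "c \<in> C" "c $ 0 = a" by auto
  then have "\<exists>c\<in>C. ?m c = 0" using f[of c] assms by (intro bexI[of _ c]) auto
  moreover have "?m (0\<^sub>v n) \<noteq> 0 \<or> ?m (unit_vec n 0) \<noteq> 0" using assms by auto
  then have "\<exists>x\<in>carrier_vec n. ?m x \<noteq> 0" by (meson zero_carrier_vec unit_vec_carrier)
  ultimately show ?thesis unfolding supporting_def by blast
qed

lemma card_zero_pos:
  fixes m :: "'a \<Rightarrow> real"
  assumes "finite C" "\<And>c. c \<in> C \<Longrightarrow> 0 \<le> m c"
  shows "card {c\<in>C. m c = 0} + card {c\<in>C. 0 < m c} = card C"
proof -
  have "C = {c\<in>C. m c = 0} \<union> {c\<in>C. 0 < m c}" using assms(2) by force
  moreover have "card ({c\<in>C. m c = 0} \<union> {c\<in>C. 0 < m c}) = card {c\<in>C. m c = 0} + card {c\<in>C. 0 < m c}"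
    using assms(1) by (intro card_Un_disjoint) auto
  ultimately show ?thesis by simp
qed

lemma T_shaped_supporting_card:
  assumes n: "0 < n" and C: "C \<subseteq> carrier_vec (Suc n)" "finite C" and m: "supporting (Suc n) C m"
    and k: "T_bound n k" "card {c\<in>C. 0 < m c} < k"
  shows "T_shaped (Suc n) C"
proof -
  obtain p x where "p \<in> C" "m p = 0" "x \<in> carrier_vec (Suc n)" "m x \<noteq> 0"
    using m by (auto simp: supporting_def)
  moreover from this have "m p \<noteq> m x" "p \<in> carrier_vec (Suc n)" using C by auto
  ultimately show ?thesis
    using T_shaped_peel_card[OF n C, of m p x k] m k by (auto simp: supporting_def)
qed

lemma T_shaped_supporting_nonconst:
  assumes n: "0 < n" and C: "C \<subseteq> carrier_vec (Suc n)" "finite C" and m: "supporting (Suc n) C m"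
    and k: "T_bound n k" "card {c\<in>C. 0 < m c} \<le> k"
    and pq: "p \<in> C" "q \<in> C" "0 < m p" "0 < m q" "m p \<noteq> m q"
  shows "T_shaped (Suc n) C"
proof -
  have "p \<in> carrier_vec (Suc n)" "q \<in> carrier_vec (Suc n)" using C pq by auto
  then show ?thesis
    using T_shaped_peel_card[OF n C, of m p q k] m k pq by (auto simp: supporting_def)
qed

lemma supporting_opposite:
  assumes m: "supporting n C m" and s: "s \<noteq> 0" "\<And>c. c \<in> C \<Longrightarrow> m c \<le> s" "\<exists>c\<in>C. m c = s"
    and C: "C \<subseteq> carrier_vec n"
  shows "supporting n C (\<lambda>x. - 1 * m x + s)"
proof -
  obtain p where p: "p \<in> C" "m p = 0" using m by (auto simp: supporting_def)
  then have "p \<in> carrier_vec n" "- 1 * m p + s \<noteq> 0" using C s by auto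
  moreover have "affine_fun n (\<lambda>x. - 1 * m x + s)"
    using m by (intro affine_fun_scale) (simp add: supporting_def)
  ultimately show ?thesis unfolding supporting_def using s by fastforce
qed

text \<open>The critical case has exactly \<open>k\<close> points off the facet, all at one height,
  so that no difference of two of them is transversal. Their hyperplane is then supporting as well,
  and peeling it leaves \<open>Suc n\<close> points, fewer than \<open>k\<close>.\<close>

lemma T_shaped_step:
  assumes n: "0 < n" and k: "T_bound n k" "0 < k" and C: "C \<subseteq> carrier_vec (Suc n)" "finite C"
    and card: "card C \<le> k + Suc n" "card C = k + Suc n \<Longrightarrow> Suc n < k"
  shows "T_shaped (Suc n) C"
proof (cases "C = {}")
  case True
  then show ?thesis using T_shaped_empty by simp
next
  case False
  obtain m0 where "supporting (Suc n) C m0" using supporting_exists[OF C(2,1) False] by auto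
  then obtain m where m: "supporting (Suc n) C m"
    and Z: "Suc n \<le> card {c\<in>C. m c = 0} \<or> {c\<in>C. m c = 0} = C"
    using supporting_facet[OF C(2,1)] by blast
  let ?D = "{c\<in>C. 0 < m c}" and ?Z = "{c\<in>C. m c = 0}"
  have nn: "\<And>c. c \<in> C \<Longrightarrow> 0 \<le> m c" using m by (simp add: supporting_def)
  have sum: "card ?Z + card ?D = card C" using card_zero_pos[of C m] C nn by simp
  then have D: "card ?D \<le> k"
  proof -
    have "Suc n \<le> card ?Z \<or> card ?Z = card C" using Z by auto
    then show ?thesis using sum card(1) by linarith
  qed
  show ?thesis
  proof (cases "card ?D < k")
    case True
    then show ?thesis by (rule T_shaped_supporting_card[OF n C m k(1)])
  next
    case False
    then have "?D \<noteq> {}" using k(2) by (metis card.empty)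
    then obtain p where p: "p \<in> C" "0 < m p" by blast
    show ?thesis
    proof (cases "\<exists>q\<in>C. 0 < m q \<and> m p \<noteq> m q")
      case True
      then show ?thesis using T_shaped_supporting_nonconst[OF n C m k(1) D] p by blast
    next
      case const: False
      have val: "m c = 0 \<or> m c = m p" if "c \<in> C" for c
      proof (cases "m c = 0")
        case False
        then have "0 < m c" using nn[OF that] by simp
        then show ?thesis using const that by metis
      qed simp
      have "supporting (Suc n) C (\<lambda>x. - 1 * m x + m p)"
      proof (rule supporting_opposite[OF m _ _ _ C(1)])
        show "m c \<le> m p" if "c \<in> C" for c using val[OF that] p(2) by linarith
      qed (use p in auto)
      moreover have "0 < - 1 * m c + m p \<longleftrightarrow> m c = 0" if "c \<in> C" for c
        using val[OF that] p(2) by auto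
      then have "{c\<in>C. 0 < - 1 * m c + m p} = ?Z" by blast
      moreover have "card ?D \<noteq> 0" using False k(2) by linarith
      then have "?Z \<noteq> C" using sum by auto
      then have "card ?Z < k" using False D Z sum card by linarith
      ultimately show ?thesis using T_shaped_supporting_card[OF n C _ k(1)] by simp
    qed
  qed
qed

lemma T_bound_step:
  assumes "0 < n" "T_bound n k" "0 < k"
  shows "T_bound (Suc n) (k + Suc n)"
  unfolding T_bound_def
proof (intro allI impI)
  fix C :: "real vec set" assume C: "C \<subseteq> carrier_vec (Suc n) \<and> finite C \<and> card C < k + Suc n"
  show "T_shaped (Suc n) C"
    by (rule T_shaped_step[OF assms]) (use C in simp_all)
qed

lemma T_bound_step_large:
  assumes "0 < n" "T_bound n k" "Suc n < k"
  shows "T_bound (Suc n) (k + n + 2)"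
  unfolding T_bound_def
proof (intro allI impI)
  fix C :: "real vec set" assume C: "C \<subseteq> carrier_vec (Suc n) \<and> finite C \<and> card C < k + n + 2"
  show "T_shaped (Suc n) C"
    by (rule T_shaped_step[OF assms(1,2)]) (use C assms(3) in simp_all)
qed

lemma T_bound_1: "T_bound 1 1"
  unfolding T_bound_def using T_shaped_empty[of 1] by (metis card_0_eq less_one zero_less_one)

lemma T_bound_2: "T_bound 2 3"
  using T_bound_step[OF _ T_bound_1] by (simp add: eval_nat_numeral)

lemma T_bound_3: "T_bound 3 6"
  using T_bound_step[OF _ T_bound_2] by (simp add: eval_nat_numeral)

lemma T_bound_4_11: "T_bound 4 11"
  using T_bound_step_large[OF _ T_bound_3] by (simp add: eval_nat_numeral)

section \<open>Six points in dimension three\<close>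

text \<open>If \<open>l\<close> were constant along every direction in which \<open>m\<close> is,
  its linear part would be a multiple of that of \<open>m\<close>. The multiple is nonzero as
  \<open>l\<close> is not constant, so \<open>m\<close> would be an affine function of
  \<open>l\<close>.\<close>

lemma nonparallel_direction:
  assumes l: "affine_fun n l" and m: "affine_fun n m"
    and nonconst: "x0 \<in> carrier_vec n" "l x0 \<noteq> l (0\<^sub>v n)"
    and np: "\<not> (\<exists>k r. \<forall>x\<in>carrier_vec n. m x = k * l x + r)"
  obtains v w where "v \<in> carrier_vec n" "l v \<noteq> l (0\<^sub>v n)" "m v = m (0\<^sub>v n)"
    "w \<in> carrier_vec n" "m w \<noteq> m (0\<^sub>v n)"
proof -
  let ?z = "0\<^sub>v n"
  have "\<exists>w\<in>carrier_vec n. m w \<noteq> m ?z"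
  proof (rule ccontr)
    assume "\<not> ?thesis"
    then have "m x = 0 * l x + m ?z" if "x \<in> carrier_vec n" for x
      using that by (metis add_0 mult_zero_left)
    then show False using np by blast
  qed
  then obtain w where w: "w \<in> carrier_vec n" "m w \<noteq> m ?z" by blast
  have "\<exists>v\<in>carrier_vec n. l v \<noteq> l ?z \<and> m v = m ?z"
  proof (rule ccontr)
    assume "\<not> ?thesis"
    then have *: "l v = l ?z" if "v \<in> carrier_vec n" "m v = m ?z" for v using that by blast
    define r where "r = (l w - l ?z) / (m w - m ?z)"
    have lx: "l x - l ?z = r * (m x - m ?z)" if x: "x \<in> carrier_vec n" for x
    proof -
      define t where "t = (m x - m ?z) / (m w - m ?z)"
      let ?v = "1 \<cdot>\<^sub>v x + (- t) \<cdot>\<^sub>v w"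
      have v: "?v \<in> carrier_vec n" using x w by simp
      have "m ?v - m ?z = 1 * (m x - m ?z) + (- t) * (m w - m ?z)"
        using m x w unfolding affine_fun_def by blast
      then have "m ?v = m ?z" using w(2) by (simp add: t_def)
      then have "l ?v = l ?z" by (rule *[OF v])
      moreover have "l ?v - l ?z = 1 * (l x - l ?z) + (- t) * (l w - l ?z)"
        using l x w unfolding affine_fun_def by blast
      ultimately show ?thesis by (simp add: t_def r_def)
    qed
    have "r \<noteq> 0" using lx[OF nonconst(1)] nonconst(2) by auto
    have "m x = (1 / r) * l x + (m ?z - l ?z / r)" if "x \<in> carrier_vec n" for x
      using lx[OF that] \<open>r \<noteq> 0\<close> by (simp add: field_simps)
    then show False using np by blast
  qed
  then show ?thesis using that w by blast
qed

text \<open>Since \<open>m\<close> is constant along \<open>v\<close>, it descends to the projection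
  used for peeling \<open>l\<close> and can be peeled there next. What is left are the points off
  both hyperplanes, two dimensions lower.\<close>

lemma T_shaped_peel_two:
  assumes n: "0 < n" and C: "C \<subseteq> carrier_vec (Suc (Suc n))" "finite C"
    and l: "affine_fun (Suc (Suc n)) l" and m: "affine_fun (Suc (Suc n)) m"
    and v: "v \<in> carrier_vec (Suc (Suc n))" "l v \<noteq> l (0\<^sub>v (Suc (Suc n)))" "m v = m (0\<^sub>v (Suc (Suc n)))"
    and w: "w \<in> carrier_vec (Suc (Suc n))" "m w \<noteq> m (0\<^sub>v (Suc (Suc n)))"
    and nonneg: "\<And>c. c \<in> C \<Longrightarrow> 0 \<le> l c" "\<And>c. c \<in> C \<Longrightarrow> 0 < l c \<Longrightarrow> 0 \<le> m c"
    and k: "T_bound n k" "card {c\<in>C. 0 < l c \<and> 0 < m c} < k"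
  shows "T_shaped (Suc (Suc n)) C"
proof -
  let ?z = "0\<^sub>v (Suc (Suc n))" and ?D = "{c\<in>C. 0 < l c}"
  have "v \<noteq> ?z" using v(2) by blast
  then obtain P S where P: "linear_vec (Suc (Suc n)) (Suc n) P" "linear_vec (Suc n) (Suc (Suc n)) S"
    "P v = 0\<^sub>v (Suc n)" "\<And>x. x \<in> carrier_vec (Suc (Suc n)) \<Longrightarrow> \<exists>t. x = 1 \<cdot>\<^sub>v S (P x) + t \<cdot>\<^sub>v v"
    using projection_along[OF v(1)] by blast
  have Pc: "P x \<in> carrier_vec (Suc n)" if "x \<in> carrier_vec (Suc (Suc n))" for x
    using P(1) that by (simp add: linear_vec_def)
  have mP: "m (S (P x)) = m x" if x: "x \<in> carrier_vec (Suc (Suc n))" for x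
  proof -
    obtain t where t: "x = 1 \<cdot>\<^sub>v S (P x) + t \<cdot>\<^sub>v v" using P(4)[OF x] by blast
    have "S (P x) \<in> carrier_vec (Suc (Suc n))" using P(2) Pc[OF x] by (simp add: linear_vec_def)
    then have "m (1 \<cdot>\<^sub>v S (P x) + t \<cdot>\<^sub>v v) - m ?z = 1 * (m (S (P x)) - m ?z) + t * (m v - m ?z)"
      using m v(1) unfolding affine_fun_def by blast
    then show ?thesis using t v(3) by simp
  qed
  have sub: "P ` ?D \<subseteq> carrier_vec (Suc n)" using Pc C by auto
  have fin: "finite (P ` ?D)" using C by simp
  have "c \<in> carrier_vec (Suc (Suc n))" if "c \<in> C" for c using C that by blast
  then have "{c \<in> P ` ?D. 0 < m (S c)} = P ` {c\<in>C. 0 < l c \<and> 0 < m c}"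
    using mP by auto
  then have card: "card {c \<in> P ` ?D. 0 < m (S c)} < k"
    using k(2) card_image_le[of "{c\<in>C. 0 < l c \<and> 0 < m c}" P] C(2) by simp
  have "m (S (P w)) \<noteq> m (S (P ?z))" using mP w by simp
  moreover have "0 \<le> m (S c)" if "c \<in> P ` ?D" for c
    using that nonneg(2) mP C(1) by auto
  ultimately have "T_shaped (Suc n) (P ` ?D)"
    using T_shaped_peel_card[OF n sub fin affine_fun_linear_vec[OF m P(2)] Pc[OF w(1)] Pc _ _ k(1)]
      card zero_carrier_vec by blast
  from T_shaped_peel[OF _ C(1) l v(1,2) P nonneg(1) this] show ?thesis by simp
qed

lemma supporting_nonconst:
  assumes "supporting n C l" "C \<subseteq> carrier_vec n"
  obtains x where "x \<in> carrier_vec n" "l x \<noteq> l (0\<^sub>v n)"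
proof -
  obtain p x where "p \<in> C" "l p = 0" "x \<in> carrier_vec n" "l x \<noteq> 0"
    using assms(1) unfolding supporting_def by blast
  then have "l p \<noteq> l (0\<^sub>v n) \<or> l x \<noteq> l (0\<^sub>v n)" by auto
  then show ?thesis using that \<open>p \<in> C\<close> \<open>x \<in> carrier_vec n\<close> assms(2) by blast
qed

text \<open>The source of the rigidity statements below: if two hyperplanes leave too few points,
  they cannot be peeled one after the other, and the only obstruction is that \<open>m\<close>
  depends on \<open>l\<close> alone.\<close>

lemma not_T_shaped_parallel:
  assumes n: "0 < n" and C: "C \<subseteq> carrier_vec (Suc (Suc n))" "finite C"
    and T: "\<not> T_shaped (Suc (Suc n)) C"
    and l: "supporting (Suc (Suc n)) C l" and m: "affine_fun (Suc (Suc n)) m"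
    and nonneg: "\<forall>c\<in>C. 0 < l c \<longrightarrow> 0 \<le> m c"
    and k: "T_bound n k" "card {c\<in>C. 0 < l c \<and> 0 < m c} < k"
  obtains s r where "\<forall>x\<in>carrier_vec (Suc (Suc n)). m x = s * l x + r"
proof (rule ccontr)
  assume "\<not> thesis"
  then have np: "\<not> (\<exists>s r. \<forall>x\<in>carrier_vec (Suc (Suc n)). m x = s * l x + r)" using that by blast
  have la: "affine_fun (Suc (Suc n)) l" and nn: "\<And>c. c \<in> C \<Longrightarrow> 0 \<le> l c"
    using l by (auto simp: supporting_def)
  obtain x0 where "x0 \<in> carrier_vec (Suc (Suc n))" "l x0 \<noteq> l (0\<^sub>v (Suc (Suc n)))"
    using supporting_nonconst[OF l C(1)] .
  from nonparallel_direction[OF la m this np]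
  obtain v w where vw: "v \<in> carrier_vec (Suc (Suc n))" "l v \<noteq> l (0\<^sub>v (Suc (Suc n)))"
    "m v = m (0\<^sub>v (Suc (Suc n)))" "w \<in> carrier_vec (Suc (Suc n))" "m w \<noteq> m (0\<^sub>v (Suc (Suc n)))" .
  have "T_shaped (Suc (Suc n)) C"
    by (rule T_shaped_peel_two[OF n C la m vw _ _ k]) (use nn nonneg in auto)
  then show False using T by simp
qed

lemma card3_obtain:
  assumes "card A = 3"
  obtains x y z where "A = {x, y, z}" "x \<noteq> y" "x \<noteq> z" "y \<noteq> z"
  using assms unfolding card_3_iff by blast

lemma card_le_set3: "card {a, b, c} \<le> 3"
  by (simp add: card_insert_if)

lemma card_pos_ex:
  assumes "card {x\<in>X. Q x} \<noteq> 0"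
  obtains x where "x \<in> X" "Q x"
proof -
  have "{x\<in>X. Q x} \<noteq> {}" using assms by (metis card.empty)
  then show ?thesis using that by blast
qed

locale six_points =
  fixes X :: "real vec set"
  assumes X: "X \<subseteq> carrier_vec 3" "finite X" "card X = 6" and T: "\<not> T_shaped 3 X"
begin

text \<open>Scaled so that the opposite triangle has height 1. That its three points share one
  height at all is the content of \<open>facetI\<close>.\<close>

definition facet :: "(real vec \<Rightarrow> real) \<Rightarrow> bool" where
  "facet l \<longleftrightarrow> supporting 3 X l \<and> (\<forall>x\<in>X. l x = 0 \<or> l x = 1) \<and>
     card {x\<in>X. l x = 0} = 3 \<and> card {x\<in>X. l x = 1} = 3"

lemma three: "Suc 2 = 3" "Suc (Suc 1) = 3" by simp_all

text \<open>\<open>T_bound 2 3\<close> forces at least three points off the plane, hence exactly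
  three. Two different heights among them would allow a projection that merges two points.\<close>

lemma facetI:
  assumes l: "supporting 3 X l" "3 \<le> card {x\<in>X. l x = 0}"
  obtains s where "0 < s" "facet (\<lambda>x. s * l x)"
proof -
  have nn: "\<And>x. x \<in> X \<Longrightarrow> 0 \<le> l x" and la: "affine_fun 3 l" using l(1) by (auto simp: supporting_def)
  have "3 \<le> card {x\<in>X. 0 < l x}"
    using T_shaped_supporting_card[where n = 2, unfolded three, OF _ X(1,2) l(1) T_bound_2] T
    by linarith
  then have c: "card {x\<in>X. l x = 0} = 3" "card {x\<in>X. 0 < l x} = 3"
    using card_zero_pos[of X l, OF X(2) nn] l(2) X(3) by auto
  then have "card {x\<in>X. 0 < l x} \<noteq> 0" by simp
  then obtain p where p: "p \<in> X" "0 < l p" by (rule card_pos_ex)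
  have const: "l q = l p" if q: "q \<in> X" "0 < l q" for q
    using T_shaped_supporting_nonconst[where n = 2, unfolded three, OF _ X(1,2) l(1) T_bound_2 _ q(1) p(1) q(2) p(2)]
      T c(2) by linarith
  define s where "s = 1 / l p"
  have s: "0 < s" using p by (simp add: s_def)
  have val: "s * l x = (if l x = 0 then 0 else 1)" if "x \<in> X" for x
    using const[OF that] nn[OF that] p by (auto simp: s_def)
  have "supporting 3 X (\<lambda>x. s * l x)"
    using l(1) affine_fun_scale[OF la, of s 0] s unfolding supporting_def by simp
  moreover have "{x\<in>X. s * l x = 0} = {x\<in>X. l x = 0}" "{x\<in>X. s * l x = 1} = {x\<in>X. 0 < l x}"
    using val nn s by (auto simp: less_le)
  moreover have "\<forall>x\<in>X. s * l x = 0 \<or> s * l x = 1" using val by simp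
  ultimately have "facet (\<lambda>x. s * l x)" using c unfolding facet_def by simp
  then show ?thesis using that s by blast
qed

lemma facet_opposite:
  assumes "facet l"
  shows "facet (\<lambda>x. - 1 * l x + 1)"
proof -
  have "supporting 3 X (\<lambda>x. - 1 * l x + 1)"
  proof (rule supporting_opposite[OF _ _ _ _ X(1)])
    have "card {x\<in>X. l x = 1} \<noteq> 0" using assms by (simp add: facet_def)
    then show "\<exists>c\<in>X. l c = 1" by (rule card_pos_ex) blast
    show "l c \<le> 1" if "c \<in> X" for c using assms that unfolding facet_def by force
  qed (use assms in \<open>auto simp: facet_def\<close>)
  then show ?thesis using assms unfolding facet_def by (auto simp: algebra_simps)
qed

text \<open>The triangle \<open>l = 1\<close> is not collinear: otherwise a second plane through it
  could be peeled after \<open>l\<close>, and nothing would remain.\<close>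

lemma facet_parallel:
  assumes "facet l" "affine_fun 3 m" "\<And>x. x \<in> X \<Longrightarrow> l x = 1 \<Longrightarrow> m x = 0"
  obtains s r where "\<forall>x\<in>carrier_vec 3. m x = s * l x + r"
proof -
  have *: "m c = 0" if "c \<in> X" "0 < l c" for c
  proof -
    have "l c = 0 \<or> l c = 1" using assms(1) that(1) by (simp add: facet_def)
    then have "l c = 1" using that(2) by auto
    then show ?thesis by (rule assms(3)[OF that(1)])
  qed
  then have "{c\<in>X. 0 < l c \<and> 0 < m c} = {}" by fastforce
  then have card: "card {c\<in>X. 0 < l c \<and> 0 < m c} < 1" by (simp only: card.empty zero_less_one)
  have l: "supporting 3 X l" using assms(1) by (simp add: facet_def)
  have nonneg: "\<forall>c\<in>X. 0 < l c \<longrightarrow> 0 \<le> m c" using * by simp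
  show ?thesis
    by (rule not_T_shaped_parallel[where n = 1, unfolded three, OF _ X(1,2) T l assms(2) nonneg T_bound_1 card])
      (simp, rule that)
qed

lemma facet_exists: "\<exists>l. facet l"
proof -
  have "X \<noteq> {}" using X(3) by auto
  then obtain m0 where m0: "supporting 3 X m0" using supporting_exists[OF X(2,1)] by (metis zero_less_numeral)
  obtain m where m: "supporting 3 X m" "3 \<le> card {c\<in>X. m c = 0} \<or> {c\<in>X. m c = 0} = X"
    using supporting_facet[OF X(2,1) m0] .
  have "card {c\<in>X. m c = 0} = card X" if "{c\<in>X. m c = 0} = X" using that by (rule arg_cong)
  then have "3 \<le> card {c\<in>X. m c = 0}" using m(2) X(3) by linarith
  then show ?thesis using facetI[OF m(1)] by blast
qed

text \<open>Tilt the facet about the edge \<open>x1\<close>, \<open>x2\<close>, lifting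
  \<open>x3\<close>, until it meets the opposite triangle.\<close>

lemma facet_rotate:
  assumes l: "facet l" and Z: "{x\<in>X. l x = 0} = {x1, x2, x3}" "x1 \<noteq> x2" "x1 \<noteq> x3" "x2 \<noteq> x3"
  obtains m y where "facet m" "y \<in> X" "l y = 1" "m x1 = 0" "m x2 = 0" "m y = 0" "m x3 = 1"
proof -
  have xX: "x1 \<in> X" "x2 \<in> X" "x3 \<in> X" and lx: "l x1 = 0" "l x2 = 0" "l x3 = 0" using Z(1) by auto
  have la: "affine_fun 3 l" and nn: "\<forall>c\<in>X. 0 \<le> l c" using l by (auto simp: facet_def supporting_def)
  obtain w where w: "w \<in> carrier_vec 3" "l w \<noteq> 0" using l by (auto simp: facet_def supporting_def)
  have "{x1, x2, w} \<subseteq> carrier_vec 3" using xX X(1) w by auto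
  from affine_fun_vanishing[OF _ this card_le_set3]
  obtain g where g: "affine_fun 3 g" "\<forall>z\<in>{x1, x2, w}. g z = 0" "\<exists>x\<in>carrier_vec 3. g x \<noteq> 0" by auto
  \<comment> \<open>Otherwise \<open>g\<close> vanishes on the whole triangle \<open>l = 0\<close>
    and is a function of \<open>l\<close>; its zeros at \<open>x1\<close> and \<open>w\<close>,
    where \<open>l\<close> differs, would make it the zero functional.\<close>
  have gx3: "g x3 \<noteq> 0"
  proof
    assume "g x3 = 0"
    then have "g x = 0" if "x \<in> X" "- 1 * l x + 1 = 1" for x using g(2) Z(1) that by auto
    from facet_parallel[OF facet_opposite[OF l] g(1) this]
    obtain s r where sr: "\<forall>x\<in>carrier_vec 3. g x = s * (- 1 * l x + 1) + r" by blast
    have "s + r = 0" using sr xX(1) X(1) lx(1) g(2) by force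
    moreover have "s * (- 1 * l w + 1) + r = 0" using sr w(1) g(2) by force
    ultimately have "s * l w = 0" by (simp add: algebra_simps)
    then have "s = 0" "r = 0" using w(2) \<open>s + r = 0\<close> by auto
    then show False using sr g(3) by auto
  qed
  define h where "h x = sgn (g x3) * g x + 0" for x
  have h: "affine_fun 3 h" "h x1 = 0" "h x2 = 0" "0 < h x3"
    using affine_fun_scale[OF g(1), of "sgn (g x3)" 0] g(2) gx3
    unfolding h_def by (auto simp: sgn_if)
  have "card {x\<in>X. l x = 1} \<noteq> 0" using l by (simp add: facet_def)
  then obtain x where "x \<in> X" "l x = 1" by (rule card_pos_ex)
  then have ex: "\<exists>c\<in>X. 0 < l c" by (intro bexI[of _ x]) simp_all
  have "c \<in> {x1, x2, x3}" if "c \<in> X" "l c = 0" for c using Z(1) that by blast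
  then have "\<forall>c\<in>X. l c = 0 \<longrightarrow> 0 \<le> h c" using h by fastforce
  from rotate_hyperplane[OF X(2) nn ex this]
  obtain s y where s: "\<forall>c\<in>X. 0 \<le> h c + s * l c" "y \<in> X" "0 < l y" "h y + s * l y = 0" by blast
  let ?m = "\<lambda>x. h x + s * l x"
  have "?m x3 \<noteq> 0" using h lx by simp
  then have supp: "supporting 3 X ?m"
    unfolding supporting_def using affine_fun_add_scaled[OF h(1) la, of s] s xX X(1) by blast
  have "y \<noteq> x1" "y \<noteq> x2" using s(3) lx by auto
  then have "card {x1, x2, y} = 3" using Z(2) by auto
  moreover have "{x1, x2, y} \<subseteq> {x\<in>X. ?m x = 0}" using xX s h lx by auto
  ultimately have "3 \<le> card {x\<in>X. ?m x = 0}"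
    using card_mono[of "{x\<in>X. ?m x = 0}" "{x1, x2, y}"] X(2) by simp
  from facetI[OF supp this] obtain t where t: "0 < t" "facet (\<lambda>x. t * ?m x)" by blast
  have "t * ?m x3 \<noteq> 0" using t \<open>?m x3 \<noteq> 0\<close> by simp
  then have "t * ?m x3 = 1" using t(2) xX unfolding facet_def by blast
  moreover have "l y = 1" using s l unfolding facet_def by force
  ultimately show ?thesis using that[of "\<lambda>x. t * ?m x" y] t(2) s h lx by simp
qed

text \<open>The antipode \<open>y1\<close> of \<open>x1\<close> is the third vertex of the second
  facet through the edge \<open>x2\<close>, \<open>x3\<close>, and likewise for the others. A
  dependency sums to 0 over the points where a facet functional is 1; comparing the sums for
  \<open>l\<close> and for the tilted facets pairs off the coefficients.\<close>

lemma octahedron: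
  obtains x1 x2 x3 y1 y2 y3 where "X = {x1, x2, x3, y1, y2, y3}"
    "\<forall>u. (\<forall>f. affine_fun 3 f \<longrightarrow> (\<Sum>x\<in>X. u x * f x) = (0::real)) \<longrightarrow>
       u x1 = u y1 \<and> u x2 = u y2 \<and> u x3 = u y3"
proof -
  obtain l where l: "facet l" using facet_exists by blast
  have la: "affine_fun 3 l" using l by (auto simp: facet_def supporting_def)
  have "card {x\<in>X. l x = 0} = 3" using l by (simp add: facet_def)
  then obtain x1 x2 x3 where Z: "{x\<in>X. l x = 0} = {x1, x2, x3}" "x1 \<noteq> x2" "x1 \<noteq> x3" "x2 \<noteq> x3"
    by (rule card3_obtain)
  have xX: "x1 \<in> X" "x2 \<in> X" "x3 \<in> X" and lx: "l x1 = 0" "l x2 = 0" "l x3 = 0" using Z(1) by auto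
  obtain m3 y3 where m3: "facet m3" "y3 \<in> X" "l y3 = 1" "m3 x1 = 0" "m3 x2 = 0" "m3 y3 = 0" "m3 x3 = 1"
    using facet_rotate[OF l Z] .
  have Z2: "{x\<in>X. l x = 0} = {x1, x3, x2}" using Z(1) by blast
  obtain m2 y2 where m2: "facet m2" "y2 \<in> X" "l y2 = 1" "m2 x1 = 0" "m2 x3 = 0" "m2 y2 = 0" "m2 x2 = 1"
    using facet_rotate[OF l Z2] Z(2-4) by metis
  have Z1: "{x\<in>X. l x = 0} = {x2, x3, x1}" using Z(1) by blast
  obtain m1 y1 where m1: "facet m1" "y1 \<in> X" "l y1 = 1" "m1 x2 = 0" "m1 x3 = 0" "m1 y1 = 0" "m1 x1 = 1"
    using facet_rotate[OF l Z1] Z(2-4) by metis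
  have zeros: "m x = (if x \<in> {a, b, y} then 0 else 1)"
    if "facet m" "a \<noteq> b" "m a = 0" "m b = 0" "m y = 0" "a \<in> X" "b \<in> X" "y \<in> X" "l a = 0" "l b = 0" "l y = 1" "x \<in> X"
    for m a b y x
  proof -
    have "a \<noteq> y" "b \<noteq> y" using that by auto
    then have "{a, b, y} \<subseteq> {x\<in>X. m x = 0}" "card {a, b, y} = 3" "card {x\<in>X. m x = 0} = 3"
      using that by (auto simp: facet_def)
    then have "{a, b, y} = {x\<in>X. m x = 0}" using X(2) by (intro card_subset_eq) auto
    moreover have "m x = 0 \<or> m x = 1" using that unfolding facet_def by blast
    ultimately show ?thesis using \<open>x \<in> X\<close> by auto
  qed
  have v1: "\<And>x. x \<in> X \<Longrightarrow> m1 x = (if x \<in> {x2, x3, y1} then 0 else 1)"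
    by (rule zeros) (use m1 Z xX lx in auto)
  have v2: "\<And>x. x \<in> X \<Longrightarrow> m2 x = (if x \<in> {x1, x3, y2} then 0 else 1)"
    by (rule zeros) (use m2 Z xX lx in auto)
  have v3: "\<And>x. x \<in> X \<Longrightarrow> m3 x = (if x \<in> {x1, x2, y3} then 0 else 1)"
    by (rule zeros) (use m3 Z xX lx in auto)
  have xy: "x1 \<noteq> y1" "x1 \<noteq> y2" "x1 \<noteq> y3" "x2 \<noteq> y1" "x2 \<noteq> y2" "x2 \<noteq> y3" "x3 \<noteq> y1" "x3 \<noteq> y2" "x3 \<noteq> y3"
    using lx m1 m2 m3 by auto
  \<comment> \<open>With a common third vertex, \<open>m - m'\<close> would vanish on the triangle
    \<open>l = 1\<close> and so depend on \<open>l\<close> alone, yet it is 1 at \<open>a\<close>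
    and -1 at \<open>b\<close>.\<close>
  have neq: "y \<noteq> y'"
    if m: "facet m" "facet m'" "\<And>x. x \<in> X \<Longrightarrow> m x = (if x \<in> {b, c, y} then 0 else 1)"
      "\<And>x. x \<in> X \<Longrightarrow> m' x = (if x \<in> {a, c, y'} then 0 else 1)" and
      lab: "l a = 0" "l b = 0" "l c = 0" "a \<in> X" "b \<in> X" "a \<noteq> b" "a \<noteq> c" "b \<noteq> c" "l y = 1" "l y' = 1"
    for m m' a b c y y'
  proof
    assume "y = y'"
    have aff: "affine_fun 3 (\<lambda>x. m x + (- 1) * m' x)"
      using m(1,2) by (intro affine_fun_add_scaled) (auto simp: facet_def supporting_def)
    have "m x + (- 1) * m' x = 0" if "x \<in> X" "l x = 1" for x
      using m(3,4)[OF that(1)] that lab \<open>y = y'\<close> by auto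
    from facet_parallel[OF l aff this]
    obtain s r where "\<forall>x\<in>carrier_vec 3. m x + (- 1) * m' x = s * l x + r" by blast
    then have "m a + (- 1) * m' a = s * l a + r" "m b + (- 1) * m' b = s * l b + r"
      using lab X(1) by blast+
    then have "m a + (- 1) * m' a = m b + (- 1) * m' b" using lab by simp
    moreover have "m a = 1" "m' a = 0" "m b = 0" "m' b = 1" using m(3,4) lab by auto
    ultimately show False by simp
  qed
  have y: "y1 \<noteq> y2" "y1 \<noteq> y3" "y2 \<noteq> y3"
  proof -
    show "y1 \<noteq> y2"
      by (rule neq[OF m1(1) m2(1), of x2 x3 _ x1]) (use v1 v2 lx xX Z m1 m2 in auto)
    show "y1 \<noteq> y3"
      by (rule neq[OF m1(1) m3(1), of x3 x2 _ x1]) (use v1 v3 lx xX Z m1 m3 in auto)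
    show "y2 \<noteq> y3"
      by (rule neq[OF m2(1) m3(1), of x3 x1 _ x2]) (use v2 v3 lx xX Z m2 m3 in auto)
  qed
  have "card {x1, x2, x3, y1, y2, y3} = 6" using Z xy y by simp
  moreover have sub: "{x1, x2, x3, y1, y2, y3} \<subseteq> X" using xX m1 m2 m3 by auto
  ultimately have Xeq: "X = {x1, x2, x3, y1, y2, y3}" using X(2,3) card_subset_eq by metis
  have "u x1 = u y1 \<and> u x2 = u y2 \<and> u x3 = u y3"
    if u: "\<forall>f. affine_fun 3 f \<longrightarrow> (\<Sum>x\<in>X. u x * f x) = (0::real)" for u
  proof -
    have sum: "(\<Sum>x\<in>X. u x * f x) = u x1 * f x1 + u x2 * f x2 + u x3 * f x3 + u y1 * f y1 + u y2 * f y2 + u y3 * f y3"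
      for f unfolding Xeq using Z xy y by (simp add: add.assoc)
    have aff: "affine_fun 3 m1" "affine_fun 3 m2" "affine_fun 3 m3"
      using m1 m2 m3 by (auto simp: facet_def supporting_def)
    have "u y1 + u y2 + u y3 = 0" using u la sum[of l] lx m1 m2 m3 by simp
    moreover have "u x1 + u y2 + u y3 = 0"
      using u aff(1) sum[of m1] v1 sub Z xy y by auto
    moreover have "u x2 + u y1 + u y3 = 0"
      using u aff(2) sum[of m2] v2 sub Z xy y by auto
    moreover have "u x3 + u y1 + u y2 = 0"
      using u aff(3) sum[of m3] v3 sub Z xy y by auto
    ultimately show ?thesis by linarith
  qed
  then show ?thesis using that Xeq by blast
qed

end

section \<open>Eleven points in dimension four\<close>

lemma (in six_points) octahedron_pairing:
  assumes "w \<in> X"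
  obtains w' a a' b b' where "X = {w, w', a, a', b, b'}"
    "\<forall>u. (\<forall>f. affine_fun 3 f \<longrightarrow> (\<Sum>x\<in>X. u x * f x) = (0::real)) \<longrightarrow>
       u w = u w' \<and> u a = u a' \<and> u b = u b'"
proof -
  obtain x1 x2 x3 y1 y2 y3 where XX: "X = {x1, x2, x3, y1, y2, y3}"
    and u: "\<forall>u. (\<forall>f. affine_fun 3 f \<longrightarrow> (\<Sum>x\<in>X. u x * f x) = (0::real)) \<longrightarrow>
       u x1 = u y1 \<and> u x2 = u y2 \<and> u x3 = u y3" using octahedron .
  have "w = x1 \<or> w = x2 \<or> w = x3 \<or> w = y1 \<or> w = y2 \<or> w = y3" using assms XX by blast
  then show ?thesis
  proof (elim disjE)
    assume "w = x1" then show ?thesis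
      by (intro that[of y1 x2 y2 x3 y3]) (use XX u in \<open>blast, metis\<close>)
  next
    assume "w = x2" then show ?thesis
      by (intro that[of y2 x1 y1 x3 y3]) (use XX u in \<open>blast, metis\<close>)
  next
    assume "w = x3" then show ?thesis
      by (intro that[of y3 x1 y1 x2 y2]) (use XX u in \<open>blast, metis\<close>)
  next
    assume "w = y1" then show ?thesis
      by (intro that[of x1 x2 y2 x3 y3]) (use XX u in \<open>blast, metis\<close>)
  next
    assume "w = y2" then show ?thesis
      by (intro that[of x2 x1 y1 x3 y3]) (use XX u in \<open>blast, metis\<close>)
  next
    assume "w = y3" then show ?thesis
      by (intro that[of x3 x1 y1 x2 y2]) (use XX u in \<open>blast, metis\<close>)
  qed
qed

section \<open>Gale diagrams of seven points\<close>

definition dependency :: "nat \<Rightarrow> real vec set \<Rightarrow> (real vec \<Rightarrow> real) \<Rightarrow> bool" where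
  "dependency n D u \<longleftrightarrow> (\<forall>f. affine_fun n f \<longrightarrow> (\<Sum>x\<in>D. u x * f x) = 0)"

text \<open>The points \<open>(u1 c, u2 c)\<close> form a Gale diagram of seven points of \<open>\<real>\<^sup>4\<close>. Projecting along \<open>x - y\<close>
  merges \<open>x\<close> and \<open>y\<close>, and assumption \<open>oct\<close> says that the result is the Gale diagram of an octahedron.\<close>

locale gale_seven =
  fixes dep :: "('a \<Rightarrow> real) \<Rightarrow> bool" and D :: "'a set" and l :: "'a \<Rightarrow> real"
    and p q r a a' b b' :: 'a and u1 u2 :: "'a \<Rightarrow> real"
  assumes D: "D = {p, q, r, a, a', b, b'}" "distinct [p, q, r, a, a', b, b']"
    and oct: "\<And>x y. x \<in> D \<Longrightarrow> y \<in> D \<Longrightarrow> l x \<noteq> l y \<Longrightarrow> \<exists>e\<in>D - {x, y}. (\<forall>u. dep u \<longrightarrow> u e = u x + u y) \<and>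
      (\<forall>z\<in>D - {x, y, e}. \<exists>z'\<in>D - {x, y, e}. z' \<noteq> z \<and> (\<forall>u. dep u \<longrightarrow> u z = u z'))"
    and pq: "l p \<noteq> l q"
    and pairs: "\<And>u. dep u \<Longrightarrow> u a = u a' \<and> u b = u b' \<and> u r = u p + u q"
    and sum: "\<And>u. dep u \<Longrightarrow> u p + u q + u r + u a + u a' + u b + u b' = 0"
    and u: "dep u1" "dep u2" "u1 a = 0" "u1 b \<noteq> 0" "u2 b = 0" "u2 a \<noteq> 0"
begin

lemma coeffs:
  "u1 a' = 0" "u2 a' = u2 a" "u1 b' = u1 b" "u2 b' = 0" "u1 r = - u1 b" "u2 r = - u2 a"
  "u1 q = - u1 b - u1 p" "u2 q = - u2 a - u2 p"
  using pairs[OF u(1)] pairs[OF u(2)] sum[OF u(1)] sum[OF u(2)] u by linarith+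

lemma in_D: "p \<in> D" "q \<in> D" "r \<in> D" "a \<in> D" "a' \<in> D" "b \<in> D" "b' \<in> D"
  using D(1) by simp_all

lemma D_cases: "z \<in> D \<Longrightarrow> z = p \<or> z = q \<or> z = r \<or> z = a \<or> z = a' \<or> z = b \<or> z = b'"
  using D(1) by simp

lemma match:
  assumes "x \<in> D" "y \<in> D" "l x \<noteq> l y"
  obtains e where "e \<in> D - {x, y}" "u1 e = u1 x + u1 y" "u2 e = u2 x + u2 y"
    "\<forall>z\<in>D - {x, y, e}. \<exists>z'\<in>D - {x, y, e}. z' \<noteq> z \<and> u1 z = u1 z' \<and> u2 z = u2 z'"
  using oct[OF assms] u(1,2) by meson

text \<open>Put \<open>A = u2 a\<close> and \<open>B = u1 b\<close>. The diagram has
  \<open>a\<close>, \<open>a'\<close> at (0, A), \<open>b\<close>, \<open>b'\<close> at (B, 0),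
  \<open>r\<close> at (-B, -A), and the positions of \<open>p\<close> and \<open>q\<close> add up to
  (-B, -A). After merging \<open>a\<close> with \<open>p\<close>, a partner of \<open>r\<close> can
  only be \<open>q\<close>, which puts \<open>p\<close> at the origin. The exception is that
  \<open>r\<close> is the antipode of the merged point.\<close>

lemma zero_coeffs:
  assumes ap: "l a \<noteq> l p"
  shows "u1 p = 0" "u2 p = 0"
proof -
  obtain e where e: "e \<in> D - {a, p}"
    "\<forall>z\<in>D - {a, p, e}. \<exists>z'\<in>D - {a, p, e}. z' \<noteq> z \<and> u1 z = u1 z' \<and> u2 z = u2 z'"
    using match[OF in_D(4,1) ap] by metis
  have "u1 p = 0 \<and> u2 p = 0"
  proof (cases "e = r")
    case False
    then have mem: "r \<in> D - {a, p, e}" using D(2) in_D by auto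
    obtain z' where z': "z' \<in> D - {a, p, e}" "z' \<noteq> r" "u1 r = u1 z'" "u2 r = u2 z'"
      using bspec[OF e(2) mem] by blast
    then have "z' = q \<or> z' = a' \<or> z' = b \<or> z' = b'" using D_cases[of z'] by blast
    then show ?thesis using z' coeffs u(3-6) by (smt (verit))
  next
    case True
    \<comment> \<open>Here \<open>a'\<close> can only be matched with \<open>q\<close>, so
      \<open>q\<close> is at (0, A) and \<open>p\<close> at (-B, -2A). Merging \<open>b\<close> with
      one of \<open>p\<close>, \<open>q\<close> at a different height then leaves \<open>b'\<close>
      or \<open>r\<close> without a partner.\<close>
    then have mem: "a' \<in> D - {a, p, e}" using D(2) in_D by auto
    obtain z' where z': "z' \<in> D - {a, p, e}" "z' \<noteq> a'" "u1 a' = u1 z'" "u2 a' = u2 z'"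
      using bspec[OF e(2) mem] by blast
    then have "z' = q \<or> z' = b \<or> z' = b'" using D_cases[of z'] True by blast
    then have "u1 q = 0 \<and> u2 q = u2 a" using z' coeffs u(3-6) by (smt (verit))
    then have q: "u1 q = 0" "u2 q = u2 a" by auto
    then have p: "u1 p = - u1 b" "u2 p = - 2 * u2 a" using coeffs by linarith+
    have bp: False if neq: "l b \<noteq> l p"
    proof -
      obtain e where e: "e \<in> D - {b, p}"
        "\<forall>z\<in>D - {b, p, e}. \<exists>z'\<in>D - {b, p, e}. z' \<noteq> z \<and> u1 z = u1 z' \<and> u2 z = u2 z'"
        using match[OF in_D(6,1) neq] by metis
      show False
      proof (cases "e = b'")
        case False
        then have mem: "b' \<in> D - {b, p, e}" using D(2) in_D by auto
        obtain z' where z': "z' \<in> D - {b, p, e}" "z' \<noteq> b'" "u1 b' = u1 z'"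
          using bspec[OF e(2) mem] by blast
        then have "z' = q \<or> z' = r \<or> z' = a \<or> z' = a'" using D_cases[of z'] by blast
        then show ?thesis using z' coeffs u(3-6) q by (smt (verit))
      next
        case True
        then have mem: "r \<in> D - {b, p, e}" using D(2) in_D by auto
        obtain z' where z': "z' \<in> D - {b, p, e}" "z' \<noteq> r" "u1 r = u1 z'"
          using bspec[OF e(2) mem] by blast
        then have "z' = q \<or> z' = a \<or> z' = a'" using D_cases[of z'] True by blast
        then show ?thesis using z' coeffs u(3-6) q by (smt (verit))
      qed
    qed
    have bq: False if neq: "l b \<noteq> l q"
    proof -
      obtain e where e: "e \<in> D - {b, q}"
        "\<forall>z\<in>D - {b, q, e}. \<exists>z'\<in>D - {b, q, e}. z' \<noteq> z \<and> u1 z = u1 z' \<and> u2 z = u2 z'"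
        using match[OF in_D(6,2) neq] by metis
      show False
      proof (cases "e = b'")
        case False
        then have mem: "b' \<in> D - {b, q, e}" using D(2) in_D by auto
        obtain z' where z': "z' \<in> D - {b, q, e}" "z' \<noteq> b'" "u1 b' = u1 z'"
          using bspec[OF e(2) mem] by blast
        then have "z' = p \<or> z' = r \<or> z' = a \<or> z' = a'" using D_cases[of z'] by blast
        then show ?thesis using z' coeffs u(3-6) p by (smt (verit))
      next
        case True
        then have mem: "r \<in> D - {b, q, e}" using D(2) in_D by auto
        obtain z' where z': "z' \<in> D - {b, q, e}" "z' \<noteq> r" "u1 r = u1 z'" "u2 r = u2 z'"
          using bspec[OF e(2) mem] by blast
        then have "z' = p \<or> z' = a \<or> z' = a'" using D_cases[of z'] True by blast
        then show ?thesis using z' coeffs u(3-6) p by (smt (verit))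
      qed
    qed
    from bp bq have "l b = l p" "l b = l q" by blast+
    then show ?thesis using pq by simp
  qed
  then show "u1 p = 0" "u2 p = 0" by auto
qed

text \<open>Only \<open>p\<close> sits at the origin, so it has no partner and must be the antipode
  of any merged pair of other points. But no two of the other positions are opposite, so no such
  pair can be merged.\<close>

lemma level_eq:
  assumes p: "u1 p = 0" "u2 p = 0" and xy: "x \<in> D - {p}" "y \<in> D - {p}"
  shows "l x = l y"
proof (rule ccontr)
  assume neq: "l x \<noteq> l y"
  have val: "(u1 z = 0 \<and> u2 z = u2 a) \<or> (u1 z = u1 b \<and> u2 z = 0) \<or> (u1 z = - u1 b \<and> u2 z = - u2 a)"
    if "z \<in> D - {p}" for z
    using that D coeffs u p by auto
  obtain e where e: "u1 e = u1 x + u1 y" "u2 e = u2 x + u2 y"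
    "\<forall>z\<in>D - {x, y, e}. \<exists>z'\<in>D - {x, y, e}. z' \<noteq> z \<and> u1 z = u1 z' \<and> u2 z = u2 z'"
    by (rule match[of x y]) (use neq xy in auto)
  have "e = p"
  proof (rule ccontr)
    assume "e \<noteq> p"
    then have "p \<in> D - {x, y, e}" using D xy by auto
    with e(3) obtain z' where "z' \<in> D - {p}" "u1 z' = 0" "u2 z' = 0" using p by (metis Diff_iff insert_iff singletonD)
    then show False using val[of z'] u by auto
  qed
  then show False using e(1,2) p val[OF xy(1)] val[OF xy(2)] u by auto
qed

end

section \<open>Facets of eleven points in dimension four\<close>

locale eleven_points =
  fixes C :: "real vec set"
  assumes C: "C \<subseteq> carrier_vec 4" "finite C" "card C = 11" and T: "\<not> T_shaped 4 C"
begin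

lemma four: "Suc 3 = 4" "Suc (Suc 2) = 4" by simp_all

lemma card_pos_ge:
  assumes "supporting 4 C l"
  shows "6 \<le> card {c\<in>C. 0 < l c}"
  using T_shaped_supporting_card[where n = 3, unfolded four, OF _ C(1,2) assms T_bound_3] T
  by linarith

text \<open>The opposite hyperplane \<open>l = s\<close> also supports \<open>C\<close> and leaves
  out just the points of \<open>l = 0\<close>. So there are at least six of these among the
  eleven.\<close>

lemma not_const_on_pos:
  assumes l: "supporting 4 C l" and s: "0 < s" "\<And>c. c \<in> C \<Longrightarrow> 0 < l c \<Longrightarrow> l c = s"
  shows "card {c\<in>C. 0 < l c} \<le> 5"
proof -
  have nn: "\<And>c. c \<in> C \<Longrightarrow> 0 \<le> l c" using l by (simp add: supporting_def)
  have val: "l c = 0 \<or> l c = s" if "c \<in> C" for c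
    using nn[OF that] s(2)[OF that] by linarith
  have "card {c\<in>C. 0 < l c} \<noteq> 0" using card_pos_ge[OF l] by linarith
  then obtain p where "p \<in> C" "0 < l p" by (rule card_pos_ex)
  then have "\<exists>c\<in>C. l c = s" using s(2) by blast
  moreover have "l c \<le> s" if "c \<in> C" for c using val[OF that] s(1) by linarith
  ultimately have "supporting 4 C (\<lambda>x. - 1 * l x + s)"
    using s(1) by (intro supporting_opposite[OF l _ _ _ C(1)]) auto
  then have "6 \<le> card {c\<in>C. 0 < - 1 * l c + s}" by (rule card_pos_ge)
  moreover have "0 < - 1 * l c + s \<longleftrightarrow> l c = 0" if "c \<in> C" for c
    using val[OF that] s(1) by auto
  then have "{c\<in>C. 0 < - 1 * l c + s} = {c\<in>C. l c = 0}" by blast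
  ultimately have "6 \<le> card {c\<in>C. l c = 0}" by (simp only:)
  then show ?thesis using card_zero_pos[of C l, OF C(2) nn] C(3) by linarith
qed

lemma facet_card:
  assumes l: "supporting 4 C l" "4 \<le> card {c\<in>C. l c = 0}"
  shows "card {c\<in>C. l c = 0} = 4" "card {c\<in>C. 0 < l c} = 7"
    "\<exists>p\<in>C. \<exists>q\<in>C. 0 < l p \<and> 0 < l q \<and> l p \<noteq> l q"
proof -
  have nn: "\<And>c. c \<in> C \<Longrightarrow> 0 \<le> l c" using l by (simp add: supporting_def)
  have sum: "card {c\<in>C. l c = 0} + card {c\<in>C. 0 < l c} = 11" using card_zero_pos[of C l, OF C(2) nn] C(3) by simp
  have "card {c\<in>C. 0 < l c} \<noteq> 0" using card_pos_ge[OF l(1)] by linarith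
  then obtain p where p: "p \<in> C" "0 < l p" by (rule card_pos_ex)
  show ex: "\<exists>p\<in>C. \<exists>q\<in>C. 0 < l p \<and> 0 < l q \<and> l p \<noteq> l q"
  proof (rule ccontr)
    assume "\<not> ?thesis"
    then have "l c = l p" if "c \<in> C" "0 < l c" for c using p that by blast
    from not_const_on_pos[OF l(1) p(2) this] card_pos_ge[OF l(1)] show False by linarith
  qed
  then obtain p q where pq: "p \<in> C" "q \<in> C" "0 < l p" "0 < l q" "l p \<noteq> l q" by blast
  have "\<not> card {c\<in>C. 0 < l c} \<le> 6"
    using T_shaped_supporting_nonconst[where n = 3, unfolded four, OF _ C(1,2) l(1) T_bound_3 _ pq] T
    by linarith
  then show "card {c\<in>C. l c = 0} = 4" "card {c\<in>C. 0 < l c} = 7" using sum l(2) by linarith+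
qed

text \<open>The projection along \<open>p - q\<close> merges these two points and no others, because
  the image needs six points. Dependencies push forward by summing over fibres, so the octahedron
  relations can be read on \<open>D\<close>; \<open>r\<close> lies over the antipode of the merged
  point.\<close>

lemma pairing:
  assumes l: "supporting 4 C l" "4 \<le> card {c\<in>C. l c = 0}" and D: "D = {c\<in>C. 0 < l c}"
    and pq: "p \<in> D" "q \<in> D" "l p \<noteq> l q"
  obtains r a a' b b' where "D = {p, q, r, a, a', b, b'}"
    "\<forall>u. dependency 4 D u \<longrightarrow> u a = u a' \<and> u b = u b' \<and> u r = u p + u q"
proof -
  have la: "affine_fun 4 l" and nn: "\<And>c. c \<in> C \<Longrightarrow> 0 \<le> l c" using l by (auto simp: supporting_def)
  have Dc: "D \<subseteq> carrier_vec 4" and finD: "finite D" and cardD: "card D = 7"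
    using D C facet_card[OF l] by auto
  have pqc: "p \<in> carrier_vec 4" "q \<in> carrier_vec 4" using pq Dc by auto
  let ?v = "p - q"
  have v: "?v \<in> carrier_vec 4" "l ?v \<noteq> l (0\<^sub>v 4)"
    using affine_fun_nonconst[OF la pqc pq(3)] pqc by auto
  then have v0: "?v \<noteq> 0\<^sub>v 4" by metis
  obtain P S where P: "linear_vec 4 3 P" "linear_vec 3 4 S" "P ?v = 0\<^sub>v 3"
    "\<And>x. x \<in> carrier_vec 4 \<Longrightarrow> \<exists>t. x = 1 \<cdot>\<^sub>v S (P x) + t \<cdot>\<^sub>v ?v"
    using projection_along[where n = 3, unfolded four, OF v(1) v0] by blast
  have eq: "P p = P q" by (rule linear_vec_eq[OF P(1) pqc P(3)])
  define X where "X = P ` D"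
  have Xc: "X \<subseteq> carrier_vec 3" unfolding X_def using P(1) Dc by (auto simp: linear_vec_def)
  have finX: "finite X" using finD by (simp add: X_def)
  have XT: "\<not> T_shaped 3 X"
  proof
    assume "T_shaped 3 X"
    then have "T_shaped 3 (P ` {c\<in>C. 0 < l c})" by (simp add: X_def D)
    then have "T_shaped 4 C"
      by (intro T_shaped_peel[where n = 3, unfolded four, OF _ C(1) la v P(1-3)])
        (simp, rule P(4), assumption, rule nn, assumption+)
    then show False using T by simp
  qed
  have pqD: "q \<in> D - {p}" "p \<noteq> q" using pq by auto
  have XD: "X = P ` (D - {p})" unfolding X_def
  proof (intro equalityI subsetI)
    fix x assume "x \<in> P ` D"
    then obtain c where "c \<in> D" "x = P c" by blast
    then show "x \<in> P ` (D - {p})" using eq pq by (cases "c = p") auto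
  qed auto
  have card6: "card (D - {p}) = 6" using cardD pq(1) by simp
  have "6 \<le> card X"
  proof (rule ccontr)
    assume "\<not> ?thesis"
    then have "card X < 6" by simp
    then show False using T_bound_3 Xc finX XT unfolding T_bound_def by blast
  qed
  moreover have "card X \<le> card (D - {p})" unfolding XD using finD by (intro card_image_le) simp
  ultimately have cardX: "card X = 6" using card6 by linarith
  then have inj: "inj_on P (D - {p})"
    using XD card6 finD by (intro eq_card_imp_inj_on) auto
  interpret six_points X by unfold_locales (use Xc finX cardX XT in auto)
  have "P q \<in> X" using pq by (simp add: X_def)
  then obtain w' \<alpha> \<alpha>' \<beta> \<beta>' where X6: "X = {P q, w', \<alpha>, \<alpha>', \<beta>, \<beta>'}" and
    Xu: "\<forall>u. (\<forall>f. affine_fun 3 f \<longrightarrow> (\<Sum>x\<in>X. u x * f x) = (0::real)) \<longrightarrow>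
       u (P q) = u w' \<and> u \<alpha> = u \<alpha>' \<and> u \<beta> = u \<beta>'" by (rule octahedron_pairing)
  have "distinct [P q, w', \<alpha>, \<alpha>', \<beta>, \<beta>']"
    using cardX unfolding X6 by (intro card_distinct) simp
  then have ne: "w' \<noteq> P q" "\<alpha> \<noteq> P q" "\<alpha>' \<noteq> P q" "\<beta> \<noteq> P q" "\<beta>' \<noteq> P q" by auto
  have pre: "\<exists>c\<in>D - {p, q}. P c = x" if x: "x \<in> X" "x \<noteq> P q" for x
    using x XD by auto
  have inX: "w' \<in> X" "\<alpha> \<in> X" "\<alpha>' \<in> X" "\<beta> \<in> X" "\<beta>' \<in> X" using X6 by auto
  obtain r where r: "r \<in> D - {p, q}" "P r = w'" using pre[OF inX(1) ne(1)] by blast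
  obtain a where a: "a \<in> D - {p, q}" "P a = \<alpha>" using pre[OF inX(2) ne(2)] by blast
  obtain a' where a': "a' \<in> D - {p, q}" "P a' = \<alpha>'" using pre[OF inX(3) ne(3)] by blast
  obtain b where b: "b \<in> D - {p, q}" "P b = \<beta>" using pre[OF inX(4) ne(4)] by blast
  obtain b' where b': "b' \<in> D - {p, q}" "P b' = \<beta>'" using pre[OF inX(5) ne(5)] by blast
  note c = r(1) a(1) a'(1) b(1) b'(1) and Pc = r(2) a(2) a'(2) b(2) b'(2)
  have "D - {p} = {q, r, a, a', b, b'}"
  proof
    show "{q, r, a, a', b, b'} \<subseteq> D - {p}" using c pq by auto
    show "D - {p} \<subseteq> {q, r, a, a', b, b'}"
    proof
      fix d assume d: "d \<in> D - {p}"
      then have "P d \<in> X" unfolding XD by (rule imageI)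
      then have "P d \<in> {P q, P r, P a, P a', P b, P b'}" unfolding X6 Pc .
      then obtain e where e: "e \<in> {q, r, a, a', b, b'}" "P d = P e" by blast
      then have "e \<in> D - {p}" using c pq by auto
      then have "d = e" using inj_onD[OF inj e(2) d] by simp
      then show "d \<in> {q, r, a, a', b, b'}" using e(1) by simp
    qed
  qed
  then have "D = {p, q, r, a, a', b, b'}" using pq(1) by blast
  moreover have "u a = u a' \<and> u b = u b' \<and> u r = u p + u q" if u: "dependency 4 D u" for u
  proof -
    define u' where "u' x = (\<Sum>c\<in>{c\<in>D. P c = x}. u c)" for x
    have "(\<Sum>x\<in>X. u' x * f x) = 0" if f: "affine_fun 3 f" for f
    proof -
      have "(\<Sum>x\<in>X. u' x * f x) = (\<Sum>x\<in>X. \<Sum>c\<in>{c\<in>D. P c = x}. u c * f (P c))"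
        unfolding u'_def sum_distrib_right by (intro sum.cong) auto
      also have "\<dots> = (\<Sum>c\<in>D. u c * f (P c))"
        using sum.image_gen[OF finD, of "\<lambda>c. u c * f (P c)" P] by (simp add: X_def)
      also have "\<dots> = 0"
        by (rule u[unfolded dependency_def, rule_format, OF affine_fun_linear_vec[OF f P(1)]])
      finally show ?thesis .
    qed
    then have "u' (P q) = u' (P r) \<and> u' (P a) = u' (P a') \<and> u' (P b) = u' (P b')" using Xu Pc by blast
    moreover have "u' (P c) = u c" if "c \<in> D - {p, q}" for c
    proof -
      have cq: "P c \<noteq> P q"
      proof
        assume "P c = P q"
        then have "c = q" by (rule inj_onD[OF inj]) (use \<open>c \<in> D - {p, q}\<close> pqD in blast)+
        then show False using \<open>c \<in> D - {p, q}\<close> by blast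
      qed
      have "d = c" if d: "d \<in> D" "P d = P c" for d
      proof -
        have "d \<noteq> p" using d(2) eq cq by metis
        then show ?thesis using inj_onD[OF inj d(2)] d(1) \<open>c \<in> D - {p, q}\<close> by blast
      qed
      then have "{d\<in>D. P d = P c} = {c}" using \<open>c \<in> D - {p, q}\<close> by blast
      then show ?thesis by (simp add: u'_def)
    qed
    moreover have "u' (P q) = u p + u q"
    proof -
      have "d = p \<or> d = q" if d: "d \<in> D" "P d = P q" for d
        using inj_onD[OF inj d(2)] d(1) pqD by blast
      then have "{d\<in>D. P d = P q} = {p, q}" using pq(1,2) eq by blast
      then show ?thesis using pqD by (simp add: u'_def)
    qed
    ultimately show ?thesis using c by simp
  qed
  ultimately show ?thesis using that by blast
qed

end

context eleven_points
begin

text \<open>A facet \<open>l = 0\<close> with four points, an octahedron in the parallel hyperplane \<open>l = 1\<close> with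
  antipodal pairs \<open>(x, x')\<close>, \<open>(y, y')\<close>, \<open>(z, z')\<close>, and one point \<open>p\<close> beyond it.\<close>

definition star :: "(real vec \<Rightarrow> real) \<Rightarrow> real vec \<Rightarrow> real vec \<Rightarrow> real vec \<Rightarrow> real vec \<Rightarrow> real vec \<Rightarrow>
    real vec \<Rightarrow> real vec \<Rightarrow> bool" where
  "star l p x x' y y' z z' \<longleftrightarrow> supporting 4 C l \<and> card {c\<in>C. l c = 0} = 4 \<and>
     C = {c\<in>C. l c = 0} \<union> {p, x, x', y, y', z, z'} \<and> distinct [p, x, x', y, y', z, z'] \<and> 1 < l p \<and>
     (\<forall>c\<in>{x, x', y, y', z, z'}. l c = 1) \<and>
     (\<forall>f. affine_fun 4 f \<longrightarrow> f x + f x' = f y + f y' \<and> f x + f x' = f z + f z')"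

text \<open>Once \<open>p\<close> has coefficient 0 in \<open>u1\<close> and \<open>u2\<close>,
  these dependencies are multiples of \<open>b + b' - r - q\<close> and
  \<open>a + a' - r - q\<close>: three segments have a common midpoint.\<close>

lemma pair_sums_exist:
  assumes l: "supporting 4 C l" "4 \<le> card {c\<in>C. l c = 0}"
  obtains p x x' y y' z z' where "{c\<in>C. 0 < l c} = {p, x, x', y, y', z, z'}"
    "distinct [p, x, x', y, y', z, z']"
    "\<forall>c\<in>{x, x', y, y', z, z'}. l c = l x"
    "\<forall>f. affine_fun 4 f \<longrightarrow> f x + f x' = f y + f y' \<and> f x + f x' = f z + f z'"
proof -
  note result = that
  define D where "D = {c\<in>C. 0 < l c}"
  have Dc: "D \<subseteq> carrier_vec 4" and finD: "finite D" and cardD: "card D = 7"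
    using D_def C facet_card[OF l] by auto
  have la: "affine_fun 4 l" using l by (simp add: supporting_def)
  obtain p q where pq: "p \<in> D" "q \<in> D" "l p \<noteq> l q" using facet_card(3)[OF l] D_def by blast
  have main: thesis if pq: "p \<in> D" "q \<in> D" "l p \<noteq> l q" and D7: "D = {p, q, r, a, a', b, b'}"
    and pairs: "\<forall>u. dependency 4 D u \<longrightarrow> u a = u a' \<and> u b = u b' \<and> u r = u p + u q" and ap: "l a \<noteq> l p"
  for p q r a a' b b'
  proof -
    have dist: "distinct [p, q, r, a, a', b, b']"
      using cardD unfolding D7 by (intro card_distinct) simp
    have sumD: "(\<Sum>x\<in>D. F x) = F p + F q + F r + F a + F a' + F b + F b'" for F :: "real vec \<Rightarrow> real"
      unfolding D7 using dist by (simp add: add.assoc)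
    have one: "affine_fun 4 (\<lambda>_. 1)" using affine_fun_scale[OF la, of 0 1] by simp
    have sum: "u p + u q + u r + u a + u a' + u b + u b' = 0" if "dependency 4 D u" for u
      using that one sumD[of "\<lambda>x. u x * 1"] unfolding dependency_def by auto
    have suml: "u p * l p + u q * l q + u r * l r + u a * l a + u a' * l a' + u b * l b + u b' * l b' = 0"
      if "dependency 4 D u" for u
      using that la sumD[of "\<lambda>x. u x * l x"] unfolding dependency_def by auto
    \<comment> \<open>Otherwise the dependency would be supported on \<open>p\<close> and
      \<open>q\<close>, which have different heights.\<close>
    have nontriv: "u a \<noteq> 0 \<or> u b \<noteq> 0" if u: "dependency 4 D u" "\<exists>x\<in>D. u x \<noteq> 0" for u
    proof (rule ccontr)
      assume "\<not> ?thesis"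
      then have z: "u a = 0" "u b = 0" "u a' = 0" "u b' = 0" using pairs u(1) by auto
      then have "u r = 0" "u q = - u p" using sum[OF u(1)] pairs u(1) by auto
      then have "u p * (l p - l q) = 0" using suml[OF u(1)] z by (simp add: algebra_simps)
      then have "u p = 0" using pq(3) by simp
      then show False using u(2) z \<open>u r = 0\<close> \<open>u q = - u p\<close> unfolding D7 by auto
    qed
    have c7: "4 + 2 < card D" using cardD by simp
    obtain u1 where u1: "u1 a = 0" "\<exists>x\<in>D. u1 x \<noteq> 0" "\<forall>f. affine_fun 4 f \<longrightarrow> (\<Sum>x\<in>D. u1 x * f x) = 0"
      using affine_dependency[OF finD Dc c7, of a] by blast
    obtain u2 where u2: "u2 b = 0" "\<exists>x\<in>D. u2 x \<noteq> 0" "\<forall>f. affine_fun 4 f \<longrightarrow> (\<Sum>x\<in>D. u2 x * f x) = 0"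
      using affine_dependency[OF finD Dc c7, of b] by blast
    have dep: "dependency 4 D u1" "dependency 4 D u2" using u1(3) u2(3) by (simp_all add: dependency_def)
    have oct: "\<exists>e\<in>D - {x, y}. (\<forall>u. dependency 4 D u \<longrightarrow> u e = u x + u y) \<and>
      (\<forall>z\<in>D - {x, y, e}. \<exists>z'\<in>D - {x, y, e}. z' \<noteq> z \<and> (\<forall>u. dependency 4 D u \<longrightarrow> u z = u z'))"
      if xy: "x \<in> D" "y \<in> D" "l x \<noteq> l y" for x y
    proof -
      obtain e c c' d d' where D7: "D = {x, y, e, c, c', d, d'}"
        and ps: "\<forall>u. dependency 4 D u \<longrightarrow> u c = u c' \<and> u d = u d' \<and> u e = u x + u y"
        using pairing[OF l D_def xy] .
      have dist: "distinct [x, y, e, c, c', d, d']"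
        using cardD unfolding D7 by (intro card_distinct) simp
      have rest: "D - {x, y, e} = {c, c', d, d'}" using D7 dist by auto
      have "e \<in> D - {x, y}" using D7 dist by auto
      moreover have "\<exists>z'\<in>D - {x, y, e}. z' \<noteq> z \<and> (\<forall>u. dependency 4 D u \<longrightarrow> u z = u z')"
        if "z \<in> D - {x, y, e}" for z
        using that ps dist unfolding rest by auto
      ultimately show ?thesis using ps by blast
    qed
    interpret gale_seven "dependency 4 D" D l p q r a a' b b' u1 u2
    proof (unfold_locales, goal_cases)
      case 3 then show ?case by (rule oct)
    qed (use D7 dist pq pairs sum dep u1 u2 nontriv[OF dep(1) u1(2)] nontriv[OF dep(2) u2(2)] in auto)
    note p0 = zero_coeffs[OF ap]
    have lev: "l c = l a" if "c \<in> {a, a', b, b', r, q}" for c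
      using level_eq[OF p0, of c a] that D7 dist by auto
    have q1: "u1 q = - u1 b" "u2 q = - u2 a" using coeffs p0 by auto
    have fb: "f b + f b' = f r + f q" and fa: "f a + f a' = f r + f q" if f: "affine_fun 4 f" for f
    proof -
      have "(\<Sum>x\<in>D. u1 x * f x) = 0" "(\<Sum>x\<in>D. u2 x * f x) = 0" using u1(3) u2(3) f by blast+
      then have "u1 b * (f b + f b' - f r - f q) = 0" "u2 a * (f a + f a' - f r - f q) = 0"
        unfolding sumD using coeffs p0 q1 u1(1) u2(1) by (simp_all add: algebra_simps)
      then show "f b + f b' = f r + f q" "f a + f a' = f r + f q" using u by auto
    qed
    show thesis
    proof (rule result)
      show "{c\<in>C. 0 < l c} = {p, a, a', b, b', r, q}" using D7 D_def by blast
      show "distinct [p, a, a', b, b', r, q]" using dist by auto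
      show "\<forall>c\<in>{a, a', b, b', r, q}. l c = l a" using lev by blast
      show "\<forall>f. affine_fun 4 f \<longrightarrow> f a + f a' = f b + f b' \<and> f a + f a' = f r + f q"
        using fa fb by simp
    qed
  qed
  obtain r a a' b b' where D7: "D = {p, q, r, a, a', b, b'}"
    and pairs: "\<forall>u. dependency 4 D u \<longrightarrow> u a = u a' \<and> u b = u b' \<and> u r = u p + u q"
    using pairing[OF l D_def pq] .
  show thesis
  \<comment> \<open>\<open>p\<close> and \<open>q\<close> are interchangeable, and \<open>a\<close>
    cannot share the height of both.\<close>
  proof (cases "l a = l p")
    case False
    then show thesis by (rule main[OF pq D7 pairs])
  next
    case True
    then have aq: "l a \<noteq> l q" using pq(3) by simp
    have D7': "D = {q, p, r, a, a', b, b'}" using D7 by auto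
    have pairs': "\<forall>u. dependency 4 D u \<longrightarrow> u a = u a' \<and> u b = u b' \<and> u r = u q + u p"
      using pairs by auto
    show thesis using main[OF pq(2,1) _ D7' pairs' aq] pq(3) by simp
  qed
qed

lemma star_exists:
  assumes l: "supporting 4 C l" "4 \<le> card {c\<in>C. l c = 0}"
  obtains s p x x' y y' z z' where "0 < s" "star (\<lambda>c. s * l c) p x x' y y' z z'"
proof -
  obtain p x x' y y' z z' where D7: "{c\<in>C. 0 < l c} = {p, x, x', y, y', z, z'}"
    and dist: "distinct [p, x, x', y, y', z, z']"
    and lev: "\<forall>c\<in>{x, x', y, y', z, z'}. l c = l x"
    and sums: "\<forall>f. affine_fun 4 f \<longrightarrow> f x + f x' = f y + f y' \<and> f x + f x' = f z + f z'"
    using pair_sums_exist[OF l] .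
  have nn: "\<And>c. c \<in> C \<Longrightarrow> 0 \<le> l c" using l by (simp add: supporting_def)
  have inD: "\<And>c. c \<in> {p, x, x', y, y', z, z'} \<Longrightarrow> c \<in> C \<and> 0 < l c" using D7 by blast
  have lx: "0 < l x" and xC: "x \<in> C" using inD by auto
  have val: "l c = 0 \<or> c = p \<or> l c = l x" if "c \<in> C" for c
  proof (cases "l c = 0")
    case False
    then have "c \<in> {c\<in>C. 0 < l c}" using that nn[OF that] by auto
    then show ?thesis unfolding D7 using lev by blast
  qed simp
  \<comment> \<open>Otherwise the hyperplane of the octahedron would support \<open>C\<close> and
    leave out at most \<open>p\<close> and the four facet points, contrary to
    \<open>card_pos_ge\<close>.\<close>
  have lp: "l x < l p"
  proof (rule ccontr)
    assume np: "\<not> ?thesis"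
    have le: "l c \<le> l x" if "c \<in> C" for c using val[OF that] np lx by auto
    have "supporting 4 C (\<lambda>c. - 1 * l c + l x)"
      by (rule supporting_opposite[OF l(1) _ le _ C(1)]) (use lx xC in auto)
    then have "6 \<le> card {c\<in>C. 0 < - 1 * l c + l x}" by (rule card_pos_ge)
    moreover have "{c\<in>C. 0 < - 1 * l c + l x} \<subseteq> insert p {c\<in>C. l c = 0}"
      using val by fastforce
    then have "card {c\<in>C. 0 < - 1 * l c + l x} \<le> card (insert p {c\<in>C. l c = 0})"
      using C(2) by (intro card_mono) auto
    moreover have "card (insert p {c\<in>C. l c = 0}) \<le> Suc (card {c\<in>C. l c = 0})"
      by (rule card_insert_le_m1) simp_all
    ultimately show False using facet_card(1)[OF l] by linarith
  qed
  define s where "s = 1 / l x"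
  have s: "0 < s" "s * l x = 1" "1 < s * l p" using lx lp by (simp_all add: s_def field_simps)
  have zer: "{c\<in>C. s * l c = 0} = {c\<in>C. l c = 0}" using s(1) by simp
  have "supporting 4 C (\<lambda>c. s * l c)"
    using l(1) affine_fun_scale[of 4 l s 0] s unfolding supporting_def by simp
  moreover have "C = {c\<in>C. s * l c = 0} \<union> {p, x, x', y, y', z, z'}"
    unfolding zer D7[symmetric] using nn by force
  moreover have "\<forall>c\<in>{x, x', y, y', z, z'}. s * l c = 1" using lev s(2) by metis
  ultimately have "star (\<lambda>c. s * l c) p x x' y y' z z'"
    unfolding star_def using dist s(3) sums facet_card(1)[OF l] zer by metis
  then show ?thesis using that s(1) by blast
qed

lemma star_permute:
  assumes "star l p x x' y y' z z'"
  shows "star l p x' x y y' z z'" "star l p y y' x x' z z'" "star l p z z' y y' x x'"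
    "star l p x x' z' z y y'"
  using assms unfolding star_def by (auto simp: insert_commute)

end

lemma card_le_set4: "card {a, b, c, d} \<le> 4"
  by (simp add: card_insert_if)

section \<open>Facets through the apex \<open>p\<close> of a star\<close>

context eleven_points
begin

text \<open>A star with the labels of its octahedron forgotten; the single high point
  \<open>q\<close> is its apex.\<close>

definition unit_facet :: "(real vec \<Rightarrow> real) \<Rightarrow> bool" where
  "unit_facet m \<longleftrightarrow> supporting 4 C m \<and> card {c\<in>C. m c = 0} = 4 \<and>
     (\<exists>q\<in>C. 1 < m q \<and> (\<forall>c\<in>C. c \<noteq> q \<longrightarrow> m c = 0 \<or> m c = 1))"

lemma unit_facet_exists:
  assumes "supporting 4 C m" "4 \<le> card {c\<in>C. m c = 0}"
  obtains s where "0 < s" "unit_facet (\<lambda>c. s * m c)"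
proof -
  obtain s p x x' y y' z z' where s: "0 < s" and st: "star (\<lambda>c. s * m c) p x x' y y' z z'"
    using star_exists[OF assms] .
  have Ceq: "C = {c\<in>C. s * m c = 0} \<union> {p, x, x', y, y', z, z'}"
    and one: "\<forall>c\<in>{x, x', y, y', z, z'}. s * m c = 1" and p1: "1 < s * m p"
    using st unfolding star_def by blast+
  have "p \<in> C" using Ceq by blast
  moreover have "s * m c = 0 \<or> s * m c = 1" if "c \<in> C" "c \<noteq> p" for c
    using that Ceq one by blast
  ultimately have "unit_facet (\<lambda>c. s * m c)" using st p1 unfolding unit_facet_def star_def by blast
  then show ?thesis using that s by blast
qed

text \<open>The octahedron spans its hyperplane, so \<open>g\<close> is a multiple of
  \<open>l - 1\<close>; the equation is this with the factor determined at \<open>p\<close>. Indeed,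
  peeling \<open>l\<close> and then \<open>g\<close>, with its sign chosen to be nonnegative at
  \<open>p\<close>, leaves at most the point \<open>p\<close>.\<close>

lemma star_parallel:
  assumes st: "star l p x x' y y' z z'" and g: "affine_fun 4 g" "\<forall>c\<in>{x, x', y, y', z, z'}. g c = 0"
    and c: "c \<in> carrier_vec 4"
  shows "g c * (l p - 1) = g p * (l c - 1)"
proof -
  have l: "supporting 4 C l" and Ceq: "C = {c\<in>C. l c = 0} \<union> {p, x, x', y, y', z, z'}"
    and one: "\<forall>c\<in>{x, x', y, y', z, z'}. l c = 1"
    using st unfolding star_def by blast+
  define e :: real where "e = (if 0 \<le> g p then 1 else - 1)"
  have e: "e * e = 1" "0 \<le> e * g p" by (auto simp: e_def)
  let ?h = "\<lambda>c. e * g c + 0"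
  have h: "affine_fun 4 ?h" by (rule affine_fun_scale[OF g(1)])
  have val: "c = p \<or> ?h c = 0" if "c \<in> C" "0 < l c" for c
  proof -
    have "c \<in> {c\<in>C. l c = 0} \<or> c \<in> {p, x, x', y, y', z, z'}" using that(1) Ceq by blast
    then have "c \<in> {p, x, x', y, y', z, z'}" using that(2) by auto
    then have "c = p \<or> g c = 0" using g(2) by blast
    then show ?thesis by auto
  qed
  have nonneg: "\<forall>c\<in>C. 0 < l c \<longrightarrow> 0 \<le> ?h c"
  proof (intro ballI impI)
    fix c assume "c \<in> C" "0 < l c"
    then have "c = p \<or> ?h c = 0" by (rule val)
    then show "0 \<le> ?h c" using e(2) by auto
  qed
  have "{c\<in>C. 0 < l c \<and> 0 < ?h c} \<subseteq> {p}"
  proof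
    fix c assume "c \<in> {c\<in>C. 0 < l c \<and> 0 < ?h c}"
    then have "c \<in> C" "0 < l c" "?h c \<noteq> 0" by auto
    then show "c \<in> {p}" using val[of c] by simp
  qed
  from card_mono[OF _ this] have card: "card {c\<in>C. 0 < l c \<and> 0 < ?h c} < 3" by simp
  obtain s r where sr: "\<forall>x\<in>carrier_vec 4. ?h x = s * l x + r"
    by (rule not_T_shaped_parallel[where n = 2, unfolded four, OF _ C(1,2) T l h nonneg T_bound_2 card]) simp
  have "x \<in> carrier_vec 4" "p \<in> carrier_vec 4" using Ceq C(1) by auto
  then have "?h x = s * l x + r" "?h p = s * l p + r" "?h c = s * l c + r" using sr c by blast+
  moreover have "g x = 0" "l x = 1" using g(2) one by auto
  ultimately have "e * g p = s * (l p - 1)" "e * g c = s * (l c - 1)" by (simp_all add: algebra_simps)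
  then have "e * g c * (l p - 1) = e * g p * (l c - 1)" by simp
  moreover have "e \<noteq> 0" using e(1) by auto
  ultimately show ?thesis by simp
qed

text \<open>All antipodal pairs have the same sum of \<open>m\<close>-values. Sum 0 gives too many
  zeros, and a pair without \<open>q\<close> has values in {0, 1}, so the sum is 1 or 2. In the
  latter case \<open>q\<close> turns out to be one of the six points, opposite to a zero.\<close>

lemma unit_facet_types:
  assumes st: "star l p x x' y y' z z'" and m: "unit_facet m" "m p = 0"
  obtains "m x + m x' = 1" "\<forall>c\<in>{x, x', y, y', z, z'}. m c = 0 \<or> m c = 1"
  | e e' f f' g g' where "star l p e e' f f' g g'" "m e = 0" "m e' = 2" "m f = 1" "m f' = 1" "m g = 1" "m g' = 1"
proof -
  note second = that(2)
  have Ceq: "C = {c\<in>C. l c = 0} \<union> {p, x, x', y, y', z, z'}"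
    and one: "\<forall>c\<in>{x, x', y, y', z, z'}. l c = 1" and dist: "distinct [p, x, x', y, y', z, z']"
    and sums: "\<forall>f. affine_fun 4 f \<longrightarrow> f x + f x' = f y + f y' \<and> f x + f x' = f z + f z'"
    and p1: "1 < l p" and c4: "card {c\<in>C. l c = 0} = 4"
    using st unfolding star_def by blast+
  have ma: "affine_fun 4 m" and nn: "\<And>c. c \<in> C \<Longrightarrow> 0 \<le> m c" and z4: "card {c\<in>C. m c = 0} = 4"
    using m(1) unfolding unit_facet_def supporting_def by auto
  obtain q where q: "q \<in> C" "1 < m q" "\<forall>c\<in>C. c \<noteq> q \<longrightarrow> m c = 0 \<or> m c = 1"
    using m(1) unfolding unit_facet_def by blast
  have s: "m x + m x' = m y + m y'" "m x + m x' = m z + m z'" using sums ma by blast+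
  have inC: "p \<in> C" "x \<in> C" "x' \<in> C" "y \<in> C" "y' \<in> C" "z \<in> C" "z' \<in> C" using Ceq by blast+
  have nn6: "0 \<le> m x" "0 \<le> m x'" "0 \<le> m y" "0 \<le> m y'" "0 \<le> m z" "0 \<le> m z'" using nn inC by auto
  have v: "c = q \<or> m c = 0 \<or> m c = 1" if "c \<in> {x, x', y, y', z, z'}" for c
    using q(3) inC that by blast
  have "m x + m x' \<noteq> 0"
  proof
    assume "m x + m x' = 0"
    then have "m x = 0" "m x' = 0" "m y = 0" "m y' = 0" using s nn6 by linarith+
    then have "{p, x, x', y, y'} \<subseteq> {c\<in>C. m c = 0}" using inC m(2) by auto
    then have "card {p, x, x', y, y'} \<le> 4" using card_mono[of "{c\<in>C. m c = 0}" "{p, x, x', y, y'}"] C(2) z4 by simp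
    then show False using dist by simp
  qed
  moreover have "m x + m x' = 0 \<or> m x + m x' = 1 \<or> m x + m x' = 2"
  proof -
    have "(q \<noteq> x \<and> q \<noteq> x') \<or> (q \<noteq> y \<and> q \<noteq> y')" using dist by auto
    then show ?thesis
    proof
      assume "q \<noteq> x \<and> q \<noteq> x'"
      then have "m x = 0 \<or> m x = 1" "m x' = 0 \<or> m x' = 1" using v[of x] v[of x'] by auto
      then show ?thesis by linarith
    next
      assume "q \<noteq> y \<and> q \<noteq> y'"
      then have "m y = 0 \<or> m y = 1" "m y' = 0 \<or> m y' = 1" using v[of y] v[of y'] by auto
      then show ?thesis using s by linarith
    qed
  qed
  ultimately consider "m x + m x' = 1" | "m x + m x' = 2" by linarith
  then show ?thesis
  proof cases
    case 1
    have "m c = 0 \<or> m c = 1" if c: "c \<in> {x, x', y, y', z, z'}" for c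
    proof -
      have "m c \<le> 1" using c 1 s nn6 by auto
      then show ?thesis using v[OF c] q(2) by auto
    qed
    then show ?thesis using that(1) 1 by blast
  next
    case 2
    have ones: "m c = 1 \<and> m c' = 1" if "m c + m c' = 2" "q \<noteq> c" "q \<noteq> c'"
      "c \<in> {x, x', y, y', z, z'}" "c' \<in> {x, x', y, y', z, z'}" for c c'
      using v[OF that(4)] v[OF that(5)] that(1-3) by auto
    have II: "m c = 0 \<and> m q = 2" if "m c + m q = 2" "c \<noteq> q" "c \<in> {x, x', y, y', z, z'}" for c
      using v[OF that(3)] that(1,2) q(2) by auto
    have two: "m x + m x' = 2" "m y + m y' = 2" "m z + m z' = 2" using 2 s by linarith+
    have "q = x \<or> q = x' \<or> q = y \<or> q = y' \<or> q = z \<or> q = z'"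
    proof (rule ccontr)
      \<comment> \<open>Then \<open>1 - m\<close> vanishes on the octahedron and is 1 at
        \<open>p\<close>, hence negative at the four points of \<open>l = 0\<close>; but
        \<open>m\<close> exceeds 1 at \<open>q\<close> alone.\<close>
      assume nq: "\<not> ?thesis"
      have all1: "\<forall>c\<in>{x, x', y, y', z, z'}. - 1 * m c + 1 = 0"
        using ones[of x x'] ones[of y y'] ones[of z z'] two nq by auto
      have "m c > 1" if c: "c \<in> C" "l c = 0" for c
      proof -
        have "c \<in> carrier_vec 4" using c C(1) by auto
        from star_parallel[OF st affine_fun_scale[OF ma] all1 this]
        have "(1 - m c) * (l p - 1) = - 1" using m(2) c(2) by simp
        then have "\<not> 0 \<le> 1 - m c" using p1 by (smt (verit) mult_nonneg_nonneg)
        then show ?thesis by simp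
      qed
      then have "c = q" if "c \<in> C" "l c = 0" for c using q(3) that by fastforce
      then have "{c\<in>C. l c = 0} \<subseteq> {q}" by blast
      from card_mono[OF _ this] c4 show False by simp
    qed
    moreover have fin: thesis if e: "star l p e q f f' g g'" "{e, f, f', g, g'} \<subseteq> {x, x', y, y', z, z'}"
      "m e + m q = 2" "m f + m f' = 2" "m g + m g' = 2" for e f f' g g'
    proof -
      have "distinct [p, e, q, f, f', g, g']" using e(1) unfolding star_def by blast
      then show thesis
        using second[OF e(1)] II[of e] ones[of f f'] ones[of g g'] e by auto
    qed
    ultimately show ?thesis
    proof (elim disjE)
      assume "q = x"
      then show ?thesis using star_permute(1)[OF st] two by (intro fin[of x' y y' z z']) auto
    next
      assume "q = x'"
      then show ?thesis using st two by (intro fin[of x y y' z z']) auto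
    next
      assume "q = y"
      then show ?thesis using star_permute(1)[OF star_permute(2)[OF st]] two
        by (intro fin[of y' x x' z z']) auto
    next
      assume "q = y'"
      then show ?thesis using star_permute(2)[OF st] two by (intro fin[of y x x' z z']) auto
    next
      assume "q = z"
      then show ?thesis using star_permute(1)[OF star_permute(3)[OF st]] two
        by (intro fin[of z' y y' x x']) auto
    next
      assume "q = z'"
      then show ?thesis using star_permute(3)[OF st] two by (intro fin[of z y y' x x']) auto
    qed
  qed
qed

lemma unit_facet_rotate:
  assumes m: "unit_facet m" and Z: "{c\<in>C. m c = 0} = {a, b, c, d}"
  obtains m' where "unit_facet m'" "m' a = 0" "m' b = 0" "m' c = 0" "0 < m' d"
proof -
  have ms: "supporting 4 C m" and z4: "card {c\<in>C. m c = 0} = 4" using m unfolding unit_facet_def by auto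
  have ma: "affine_fun 4 m" and nn: "\<forall>c\<in>C. 0 \<le> m c" using ms unfolding supporting_def by auto
  have inC: "a \<in> C" "b \<in> C" "c \<in> C" "d \<in> C" and m0: "m a = 0" "m b = 0" "m c = 0" "m d = 0" using Z by auto
  have dist: "distinct [a, b, c, d]" using z4 unfolding Z by (intro card_distinct) simp
  obtain w where w: "w \<in> carrier_vec 4" "m w \<noteq> 0" using ms by (auto simp: supporting_def)
  have "{a, b, c, w} \<subseteq> carrier_vec 4" using inC C(1) w by auto
  from affine_fun_vanishing[OF _ this card_le_set4]
  obtain g where g: "affine_fun 4 g" "\<forall>z\<in>{a, b, c, w}. g z = 0" "\<exists>x\<in>carrier_vec 4. g x \<noteq> 0" by auto
  obtain q where "q \<in> C" "1 < m q" using m unfolding unit_facet_def by blast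
  then have ex: "\<exists>c\<in>C. 0 < m c" by (intro bexI[of _ q]) simp_all
  \<comment> \<open>If \<open>g\<close> vanished on all four points, rotating would produce a
    supporting hyperplane with five points, against \<open>facet_card\<close>.\<close>
  have gd: "g d \<noteq> 0"
  proof
    assume "g d = 0"
    have g0: "\<forall>c\<in>C. m c = 0 \<longrightarrow> 0 \<le> g c"
    proof (intro ballI impI)
      fix x assume "x \<in> C" "m x = 0"
      then have "x \<in> {a, b, c, d}" using Z by blast
      then show "0 \<le> g x" using g(2) \<open>g d = 0\<close> by auto
    qed
    obtain s y where s: "\<forall>c\<in>C. 0 \<le> g c + s * m c" "y \<in> C" "0 < m y" "g y + s * m y = 0"
      using rotate_hyperplane[OF C(2) nn ex g0] by blast
    let ?m = "\<lambda>x. g x + s * m x"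
    have "?m x \<noteq> 0" if "g x \<noteq> 0" "?m w = 0" for x using that g(2) w by simp
    then have "\<exists>x\<in>carrier_vec 4. ?m x \<noteq> 0" using g(3) w(1) by blast
    then have supp: "supporting 4 C ?m"
      unfolding supporting_def using affine_fun_add_scaled[OF g(1) ma] s by blast
    have sub: "{a, b, c, d, y} \<subseteq> {c\<in>C. ?m c = 0}" using inC m0 g(2) \<open>g d = 0\<close> s by auto
    have "y \<notin> {a, b, c, d}" using s(3) m0 by auto
    then have "card {a, b, c, d, y} = 5" using dist by auto
    then have "5 \<le> card {c\<in>C. ?m c = 0}" using card_mono[OF _ sub] C(2) by simp
    then show False using facet_card(1)[OF supp] by linarith
  qed
  define h where "h x = sgn (g d) * g x + 0" for x
  have h: "affine_fun 4 h" "h a = 0" "h b = 0" "h c = 0" "0 < h d"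
    using affine_fun_scale[OF g(1), of "sgn (g d)" 0] g(2) gd
    unfolding h_def by (auto simp: sgn_if)
  have h0: "\<forall>c\<in>C. m c = 0 \<longrightarrow> 0 \<le> h c"
  proof (intro ballI impI)
    fix x assume "x \<in> C" "m x = 0"
    then have "x \<in> {a, b, c, d}" using Z by blast
    then show "0 \<le> h x" using h by auto
  qed
  obtain s y where s: "\<forall>c\<in>C. 0 \<le> h c + s * m c" "y \<in> C" "0 < m y" "h y + s * m y = 0"
    using rotate_hyperplane[OF C(2) nn ex h0] by blast
  let ?m = "\<lambda>x. h x + s * m x"
  have "?m d \<noteq> 0" using h m0 by simp
  then have supp: "supporting 4 C ?m"
    unfolding supporting_def using affine_fun_add_scaled[OF h(1) ma, of s] s inC C(1) by blast
  have sub: "{a, b, c, y} \<subseteq> {c\<in>C. ?m c = 0}" using inC m0 h s by auto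
  have "y \<notin> {a, b, c}" using s(3) m0 by auto
  then have "card {a, b, c, y} = 4" using dist by auto
  then have "4 \<le> card {c\<in>C. ?m c = 0}" using card_mono[OF _ sub] C(2) by simp
  from unit_facet_exists[OF supp this] obtain t where t: "0 < t" "unit_facet (\<lambda>x. t * ?m x)" .
  show ?thesis using that[OF t(2)] t(1) h m0 by simp
qed

text \<open>The two zeros \<open>d1\<close>, \<open>d2\<close> besides \<open>p\<close> and
  \<open>x\<close> are off the octahedron. Rotate about \<open>p\<close>, \<open>x\<close>,
  \<open>d1\<close>. A new facet of the first type would have five zeros; one of the second type
  agrees with \<open>m\<close> on the octahedron and at \<open>p\<close>, hence also at
  \<open>d2\<close>, which was lifted.\<close>

lemma no_second_type:
  assumes st: "star l p x x' y y' z z'" and m: "unit_facet m" "m p = 0"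
    "m x = 0" "m x' = 2" "m y = 1" "m y' = 1" "m z = 1" "m z' = 1"
  shows False
proof -
  have Ceq: "C = {c\<in>C. l c = 0} \<union> {p, x, x', y, y', z, z'}" and dist: "distinct [p, x, x', y, y', z, z']"
    and p1: "1 < l p"
    using st unfolding star_def by blast+
  have inC: "p \<in> C" "x \<in> C" using Ceq by blast+
  have z4: "card {c\<in>C. m c = 0} = 4" using m unfolding unit_facet_def by auto
  have "card ({c\<in>C. m c = 0} - {p, x}) = 2"
    using z4 inC m dist C(2) by (subst card_Diff_subset) auto
  then obtain d1 d2 where d: "{c\<in>C. m c = 0} - {p, x} = {d1, d2}" "d1 \<noteq> d2" by (meson card_2_iff)
  have Z: "{c\<in>C. m c = 0} = {p, x, d1, d2}" using d inC m by blast
  have d1: "d1 \<in> C" "d1 \<noteq> p" "d1 \<noteq> x" "m d1 = 0" "d2 \<in> C" "m d2 = 0" using d by auto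
  obtain m' where m': "unit_facet m'" "m' p = 0" "m' x = 0" "m' d1 = 0" "0 < m' d2"
    using unit_facet_rotate[OF m(1) Z] .
  have z4': "card {c\<in>C. m' c = 0} = 4" using m' unfolding unit_facet_def by auto
  have six: "d1 \<notin> {x, x', y, y', z, z'}" using d1 m by auto
  from st m'(1,2) show False
  proof (rule unit_facet_types)
    assume 1: "m' x + m' x' = 1" and v: "\<forall>c\<in>{x, x', y, y', z, z'}. m' c = 0 \<or> m' c = 1"
    have "affine_fun 4 m'" using m' unfolding unit_facet_def supporting_def by auto
    then have s: "m' x + m' x' = m' y + m' y'" "m' x + m' x' = m' z + m' z'" using st unfolding star_def by blast+
    have "m' y = 0 \<or> m' y' = 0" "m' z = 0 \<or> m' z' = 0" using s 1 v by auto
    then obtain f g where f: "f \<in> {y, y'}" "m' f = 0" and g: "g \<in> {z, z'}" "m' g = 0" by blast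
    have "f \<in> C" "g \<in> C" using f g Ceq by blast+
    then have sub: "{p, x, d1, f, g} \<subseteq> {c\<in>C. m' c = 0}" using inC d1 m' f g by auto
    have "f = y \<or> f = y'" "g = z \<or> g = z'" using f(1) g(1) by auto
    then have "distinct [p, x, d1, f, g]" using dist d1(2,3) six by (elim disjE) simp_all
    then have "card {p, x, d1, f, g} = 5" using distinct_card[of "[p, x, d1, f, g]"] by simp
    then have "5 \<le> card {c\<in>C. m' c = 0}" using card_mono[OF _ sub] C(2) by simp
    then show False using z4' by simp
  next
    fix e e' f f' g g'
    assume st': "star l p e e' f f' g g'" and v: "m' e = 0" "m' e' = 2" "m' f = 1" "m' f' = 1" "m' g = 1" "m' g' = 1"
    have six: "{x, x', y, y', z, z'} = {e, e', f, f', g, g'}"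
    proof -
      have "{x, x', y, y', z, z'} = {c\<in>C. l c = 1}" if "star l p x x' y y' z z'" for x x' y y' z z'
      proof -
        have C': "C = {c\<in>C. l c = 0} \<union> {p, x, x', y, y', z, z'}" "\<forall>c\<in>{x, x', y, y', z, z'}. l c = 1" "1 < l p"
          using that unfolding star_def by blast+
        show ?thesis
        proof (intro equalityI subsetI)
          fix c assume "c \<in> {x, x', y, y', z, z'}"
          then show "c \<in> {c\<in>C. l c = 1}" using C' by blast
        next
          fix c assume c: "c \<in> {c\<in>C. l c = 1}"
          then have "l c = 0 \<or> c = p \<or> c \<in> {x, x', y, y', z, z'}" using C'(1) by blast
          then show "c \<in> {x, x', y, y', z, z'}" using c C'(3) by auto
        qed
      qed
      from this[OF st] this[OF st'] show ?thesis by simp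
    qed
    have "affine_fun 4 f \<Longrightarrow> f x + f x' = f y + f y' \<and> f x + f x' = f z + f z'" for f
      using st unfolding star_def by blast
    moreover have ma: "affine_fun 4 m" "affine_fun 4 m'"
      using m m' unfolding unit_facet_def supporting_def by auto
    ultimately have s: "m' x + m' x' = m' y + m' y'" "m' x + m' x' = m' z + m' z'" by blast+
    have "x = e"
      using six m'(3) v by (metis insert_iff zero_neq_one zero_neq_numeral singletonD)
    have val: "m' c = 1 \<or> c = e \<or> c = e'" if "c \<in> {x, x', y, y', z, z'}" for c
      using that v unfolding six by auto
    have "m' c = 1 \<or> m' c = 2" if "c \<in> {x', y, y', z, z'}" for c
    proof -
      have "c \<noteq> e" using that dist \<open>x = e\<close> by auto
      moreover have "m' c = 1 \<or> c = e \<or> c = e'" using that by (intro val) blast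
      ultimately show ?thesis using v(2) by blast
    qed
    from this[of x'] this[of y] this[of y'] this[of z] this[of z']
    have "m' x' = 2" "m' y = 1" "m' y' = 1" "m' z = 1" "m' z' = 1" using s m'(3) by auto
    then have "\<forall>c\<in>{x, x', y, y', z, z'}. m c + (- 1) * m' c = 0" using m m' by auto
    from star_parallel[OF st affine_fun_add_scaled[OF ma] this, of d2]
    have "(m d2 + (- 1) * m' d2) * (l p - 1) = 0" using d1 C(1) m m' by auto
    then have "m d2 = m' d2" using p1 by simp
    then show False using m'(5) d1 by simp
  qed
qed

lemma first_type:
  assumes st: "star l p x x' y y' z z'" and m: "unit_facet m" "m p = 0"
  shows "m x + m x' = 1" "m y + m y' = 1" "m z + m z' = 1" "\<forall>c\<in>{x, x', y, y', z, z'}. m c = 0 \<or> m c = 1"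
proof -
  have *: "m x + m x' = 1 \<and> (\<forall>c\<in>{x, x', y, y', z, z'}. m c = 0 \<or> m c = 1)"
    using st m by (rule unit_facet_types) (blast, use no_second_type m in blast)
  have "affine_fun 4 m" using m unfolding unit_facet_def supporting_def by auto
  then have s: "m x + m x' = m y + m y'" "m x + m x' = m z + m z'" using st unfolding star_def by blast+
  show "m x + m x' = 1" "m y + m y' = 1" "m z + m z' = 1" "\<forall>c\<in>{x, x', y, y', z, z'}. m c = 0 \<or> m c = 1"
    using * s by auto
qed

lemma first_type_zeros:
  assumes st: "star l p x x' y y' z z'" and m: "unit_facet m" "m p = 0" "m x = 0" "m y = 0" "m z = 0"
  shows "{c\<in>C. m c = 0} = {p, x, y, z}"
proof -
  have "{p, x, y, z} \<subseteq> C" "distinct [p, x, x', y, y', z, z']" using st unfolding star_def by blast+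
  then have sub: "{p, x, y, z} \<subseteq> {c\<in>C. m c = 0}" and "card {p, x, y, z} = 4" using m by auto
  then show ?thesis using m(1) C(2) card_subset_eq[OF _ sub] unfolding unit_facet_def by simp
qed

text \<open>The rotated facet is of the first type again, so lifting \<open>z\<close> makes its
  antipode a zero.\<close>

lemma first_type_flip:
  assumes st: "star l p x x' y y' z z'" and m: "unit_facet m" "m p = 0" "m x = 0" "m y = 0" "m z = 0"
  obtains m' where "unit_facet m'" "m' p = 0" "m' x = 0" "m' y = 0" "m' z' = 0"
proof -
  obtain m' where m': "unit_facet m'" "m' p = 0" "m' x = 0" "m' y = 0" "0 < m' z"
    using unit_facet_rotate[OF m(1) first_type_zeros[OF st m]] .
  have "m' z + m' z' = 1" "m' z = 0 \<or> m' z = 1" using first_type(3,4)[OF st m'(1,2)] by auto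
  then have "m' z' = 0" using m'(5) by auto
  then show ?thesis using that m' by blast
qed

lemma eleven_false: False
proof -
  have "C \<noteq> {}" using C(3) by auto
  have facet: "\<exists>m. supporting 4 C m \<and> {c\<in>C. m0 c = 0} \<subseteq> {c\<in>C. m c = 0} \<and> 4 \<le> card {c\<in>C. m c = 0}"
    if m0: "supporting 4 C m0" for m0
  proof -
    obtain m where m: "supporting 4 C m" "{c\<in>C. m0 c = 0} \<subseteq> {c\<in>C. m c = 0}"
      "4 \<le> card {c\<in>C. m c = 0} \<or> {c\<in>C. m c = 0} = C"
      using supporting_facet[OF C(2,1) m0] .
    have "card {c\<in>C. m c = 0} = card C" if "{c\<in>C. m c = 0} = C" using that by (rule arg_cong)
    then have "4 \<le> card {c\<in>C. m c = 0}" using m(3) C(3) by linarith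
    then show ?thesis using m by blast
  qed
  obtain m0 where "supporting 4 C m0" using supporting_exists[OF C(2,1) \<open>C \<noteq> {}\<close>] by (metis zero_less_numeral)
  then obtain m1 where m1: "supporting 4 C m1" "4 \<le> card {c\<in>C. m1 c = 0}" using facet by blast
  obtain s p x x' y y' z z' where "0 < s" and st: "star (\<lambda>c. s * m1 c) p x x' y y' z z'"
    using star_exists[OF m1] .
  define l where "l = (\<lambda>c. s * m1 c)"
  have st: "star l p x x' y y' z z'" using st by (simp add: l_def)
  have ls: "supporting 4 C l" and Ceq: "C = {c\<in>C. l c = 0} \<union> {p, x, x', y, y', z, z'}"
    and one: "\<forall>c\<in>{x, x', y, y', z, z'}. l c = 1" and p1: "1 < l p"
    using st unfolding star_def by blast+
  have inC: "p \<in> C" using Ceq by blast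
  have "l c \<le> l p" if "c \<in> C" for c
  proof -
    have "l c = 0 \<or> c = p \<or> l c = 1" using that Ceq one by blast
    then show ?thesis using p1 by auto
  qed
  then have "supporting 4 C (\<lambda>c. - 1 * l c + l p)"
    using p1 inC by (intro supporting_opposite[OF ls _ _ _ C(1)]) auto
  from facet[OF this] obtain m2 where m2: "supporting 4 C m2"
    "{c\<in>C. - 1 * l c + l p = 0} \<subseteq> {c\<in>C. m2 c = 0}" "4 \<le> card {c\<in>C. m2 c = 0}" by blast
  have m2p: "m2 p = 0" using m2(2) inC by auto
  obtain t where t: "0 < t" "unit_facet (\<lambda>c. t * m2 c)" using unit_facet_exists[OF m2(1,3)] .
  have main: False if st: "star l p x x' y y' z z'" and m: "unit_facet m" "m p = 0" "m x = 0" "m y = 0" "m z = 0"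
    for m x x' y y' z z'
  proof -
    obtain k1 where k1: "unit_facet k1" "k1 p = 0" "k1 x = 0" "k1 y = 0" "k1 z' = 0"
      using first_type_flip[OF st m] .
    have st1: "star l p x x' z' z y y'" by (rule star_permute(4)[OF st])
    obtain k2 where k2: "unit_facet k2" "k2 p = 0" "k2 x = 0" "k2 z' = 0" "k2 y' = 0"
      using first_type_flip[OF st1 k1(1,2,3,5,4)] .
    have st2: "star l p z' z y' y x x'" by (rule star_permute(3)[OF star_permute(4)[OF st1]])
    obtain k where k: "unit_facet k" "k p = 0" "k z' = 0" "k y' = 0" "k x' = 0"
      using first_type_flip[OF st2 k2(1,2,4,5,3)] .
    have ma: "affine_fun 4 m" "affine_fun 4 k" using m k unfolding unit_facet_def supporting_def by auto
    \<comment> \<open>After three flips \<open>k\<close> is zero at the antipodes of the zeros of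
      \<open>m\<close>, so the two are complementary on the octahedron. Both vanish at
      \<open>p\<close>, so \<open>star_parallel\<close> makes \<open>m + k\<close> constant on the
      base \<open>l = 0\<close>.\<close>
    have sum1: "\<forall>c\<in>{x, x', y, y', z, z'}. 1 * m c + 1 * k c + - 1 = 0"
      using first_type(1-3)[OF st m(1,2)] first_type(1-3)[OF st k(1,2)] m k by auto
    have Ceq: "C = {c\<in>C. l c = 0} \<union> {p, x, x', y, y', z, z'}" and c4: "card {c\<in>C. l c = 0} = 4"
      and one: "\<forall>c\<in>{x, x', y, y', z, z'}. l c = 1"
      using st unfolding star_def by blast+
    have st': "star l p x' x y' y z' z"
      using star_permute(1)[OF star_permute(3)[OF st2]] .
    obtain q where q: "q \<in> C" "1 < m q" "\<forall>c\<in>C. c \<noteq> q \<longrightarrow> m c = 0 \<or> m c = 1"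
      using m(1) unfolding unit_facet_def by blast
    obtain q' where q': "q' \<in> C" "1 < k q'" "\<forall>c\<in>C. c \<noteq> q' \<longrightarrow> k c = 0 \<or> k c = 1"
      using k(1) unfolding unit_facet_def by blast
    define \<kappa> where "\<kappa> = 1 + 1 / (l p - 1)"
    have base: "m c + k c = \<kappa> \<and> 1 \<le> m c \<and> 1 \<le> k c" if c: "c \<in> C" "l c = 0" for c
    proof -
      have "c \<in> carrier_vec 4" using c C(1) by auto
      from star_parallel[OF st affine_fun_comb[OF ma] sum1 this]
      have "(m c + k c - 1) * (l p - 1) = 1" using m(2) k(2) c(2) by simp
      then have "m c + k c = \<kappa>" using p1 by (simp add: \<kappa>_def field_simps)
      moreover have "c \<notin> {p, x, y, z}" "c \<notin> {p, x', y', z'}" using c(2) one p1 by auto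
      then have "m c \<noteq> 0" "k c \<noteq> 0"
        using first_type_zeros[OF st m] first_type_zeros[OF st' k(1,2,5,4,3)] c(1) by blast+
      then have "1 \<le> m c" "1 \<le> k c"
        using q(2) q(3)[rule_format, OF c(1)] q'(2) q'(3)[rule_format, OF c(1)] by force+
      ultimately show ?thesis by simp
    qed
    \<comment> \<open>At most two of the four base points are exceptional for \<open>m\<close> or
      \<open>k\<close>; at another one both values are 1, so \<kappa> is 2. Then both are 1 on the
      whole base, and no place is left for \<open>q\<close>.\<close>
    have "\<not> {c\<in>C. l c = 0} \<subseteq> {q, q'}"
    proof
      assume "{c\<in>C. l c = 0} \<subseteq> {q, q'}"
      from card_mono[OF _ this] have "4 \<le> card {q, q'}" using c4 by simp
      moreover have "card {q, q'} \<le> 2" by (simp add: card_insert_if)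
      ultimately show False by linarith
    qed
    then obtain c where c: "c \<in> C" "l c = 0" "c \<noteq> q" "c \<noteq> q'" by blast
    then have "m c = 1" "k c = 1" using q(3) q'(3) base[of c] by force+
    then have "\<kappa> = 2" using base[OF c(1,2)] by linarith
    have "l q \<noteq> 0" using base[OF q(1)] q(2) \<open>\<kappa> = 2\<close> by fastforce
    then have "q = p \<or> q \<in> {x, x', y, y', z, z'}" using q(1) Ceq by blast
    then have "m q = 0 \<or> m q = 1" using m(2) first_type(4)[OF st m(1,2)] by blast
    then show False using q(2) by auto
  qed
  let ?m = "\<lambda>c. t * m2 c"
  have p0: "?m p = 0" using m2p by simp
  note ft = first_type[OF st t(2) p0]
  have "?m x = 0 \<or> ?m x' = 0" using ft(1,4) by auto
  then obtain a a' where a: "star l p a a' y y' z z'" "?m a = 0" using st star_permute(1)[OF st] by blast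
  have "?m y = 0 \<or> ?m y' = 0" using ft(2,4) by auto
  then obtain b b' where b: "star l p b b' a a' z z'" "?m b = 0"
    using star_permute(2)[OF a(1)] star_permute(1)[OF star_permute(2)[OF a(1)]] by blast
  have "?m z = 0 \<or> ?m z' = 0" using ft(3,4) by auto
  then obtain c c' where c: "star l p c c' a a' b b'" "?m c = 0"
    using star_permute(3)[OF b(1)] star_permute(1)[OF star_permute(3)[OF b(1)]] by blast
  show False using main[OF c(1) t(2) p0 c(2) a(2) b(2)] .
qed

end

lemma T_bound_4_12: "T_bound 4 12"
  unfolding T_bound_def
proof (intro allI impI)
  fix C :: "real vec set" assume C: "C \<subseteq> carrier_vec 4 \<and> finite C \<and> card C < 12"
  show "T_shaped 4 C"
  proof (cases "card C = 11")
    case True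
    show ?thesis
    proof (rule ccontr)
      assume "\<not> ?thesis"
      then interpret eleven_points C by unfold_locales (use C True in auto)
      show False by (rule eleven_false)
    qed
  next
    case False
    then have "card C < 11" using C by linarith
    then show ?thesis using T_bound_4_11 C unfolding T_bound_def by blast
  qed
qed

section \<open>Twelve points in dimension four\<close>

definition in_T2 :: "real \<Rightarrow> real \<Rightarrow> bool" where
  "in_T2 y1 y2 \<longleftrightarrow> y2 = 0 \<or> 0 \<le> y2 \<and> y1 = 0"

definition in_T3 :: "real \<Rightarrow> real \<Rightarrow> real \<Rightarrow> bool" where
  "in_T3 y1 y2 y3 \<longleftrightarrow> y3 = 0 \<or> 0 \<le> y3 \<and> in_T2 y1 y2"

text \<open>The differences of the pairs of points of \<open>T\<^sub>2\<close> with a given midpoint lie on one line.\<close>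

lemma in_T2_common_line:
  obtains x y where "x \<noteq> 0 \<or> y \<noteq> 0"
    "\<And>u1 u2 v1 v2. in_T2 u1 u2 \<Longrightarrow> in_T2 v1 v2 \<Longrightarrow> u1 + v1 = s1 \<Longrightarrow> u2 + v2 = s2 \<Longrightarrow>
       x * (u1 - v1) + y * (u2 - v2) = 0"
proof (cases "0 < s2")
  case True
  \<comment> \<open>The points are not both on \<open>y2 = 0\<close>: either both have first
    coordinate 0, or they are (0, s2) and (s1, 0) in some order.\<close>
  show ?thesis
  proof (rule that[of s2 s1])
    fix u1 u2 v1 v2 assume "in_T2 u1 u2" "in_T2 v1 v2" and s: "u1 + v1 = s1" "u2 + v2 = s2"
    then have "(u2 = 0 \<or> u1 = 0) \<and> (v2 = 0 \<or> v1 = 0)" by (auto simp: in_T2_def)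
    then have "(u2 = 0 \<or> u1 = 0) \<and> (v2 = 0 \<or> v1 = 0) \<and> \<not> (u2 = 0 \<and> v2 = 0)" using True s by auto
    then show "s2 * (u1 - v1) + s1 * (u2 - v2) = 0"
      unfolding s[symmetric] by (auto simp: algebra_simps)
  qed (use True in simp)
next
  case False
  show ?thesis
  proof (rule that[of 0 1])
    fix u1 u2 v1 v2 assume "in_T2 u1 u2" "in_T2 v1 v2" and "u1 + v1 = s1" "u2 + v2 = s2"
    then show "0 * (u1 - v1) + 1 * (u2 - v2) = 0" using False by (auto simp: in_T2_def)
  qed simp
qed

text \<open>Three functionals with linear parts \<open>\<gamma>\<close>, \<open>\<beta>\<close>, \<open>\<alpha>\<close> and constant terms \<open>b1\<close>, \<open>b2\<close>, \<open>1\<close>, evaluated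
  at the points \<open>e\<^sub>i\<close>, \<open>-e\<^sub>i\<close> and \<open>(1, 1, 1, 1) - e\<^sub>i\<close> of \<open>\<real>\<^sup>4\<close>. For a center of symmetry of several pairs of
  these points, the common line yields a nonzero \<open>\<theta>\<close> in the plane spanned by \<open>\<beta>\<close> and \<open>\<gamma>\<close> that vanishes
  on all differences of pairs not lying on the first hyperplane.\<close>

locale twelve_points =
  fixes \<alpha> \<beta> \<gamma> :: "nat \<Rightarrow> real" and b1 b2 :: real and I :: "nat set"
  defines "I \<equiv> {0, 1, 2, 3}"
  assumes plus: "\<And>i. i \<in> I \<Longrightarrow> in_T3 (b1 + \<gamma> i) (b2 + \<beta> i) (1 + \<alpha> i)"
    and minus: "\<And>i. i \<in> I \<Longrightarrow> in_T3 (b1 - \<gamma> i) (b2 - \<beta> i) (1 - \<alpha> i)"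
    and comp: "\<And>i. i \<in> I \<Longrightarrow> in_T3 (b1 + sum \<gamma> I - \<gamma> i) (b2 + sum \<beta> I - \<beta> i) (1 + sum \<alpha> I - \<alpha> i)"
    and indep: "\<And>x y z. (\<forall>i\<in>I. x * \<gamma> i + y * \<beta> i + z * \<alpha> i = 0) \<Longrightarrow> x = 0 \<and> y = 0 \<and> z = 0"
begin

definition plane :: "(nat \<Rightarrow> real) \<Rightarrow> bool" where
  "plane \<theta> \<longleftrightarrow> (\<exists>x y. (x \<noteq> 0 \<or> y \<noteq> 0) \<and> \<theta> = (\<lambda>i. x * \<gamma> i + y * \<beta> i))"

definition enum :: "nat \<Rightarrow> nat \<Rightarrow> nat \<Rightarrow> nat \<Rightarrow> bool" where
  "enum i j k l \<longleftrightarrow> I = {i, j, k, l} \<and> distinct [i, j, k, l]"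

lemma enum_sum: "enum i j k l \<Longrightarrow> sum f I = f i + f j + f k + f l"
  unfolding enum_def by (simp add: add.assoc)

lemma enum_in: "enum i j k l \<Longrightarrow> i \<in> I \<and> j \<in> I \<and> k \<in> I \<and> l \<in> I"
  unfolding enum_def by auto

lemma enum_all: "enum i j k l \<Longrightarrow> (\<forall>m\<in>I. Q m) \<longleftrightarrow> Q i \<and> Q j \<and> Q k \<and> Q l"
  unfolding enum_def by auto

lemma enum_swap: "enum i j k l \<Longrightarrow> enum j i k l" "enum i j k l \<Longrightarrow> enum i k j l" "enum i j k l \<Longrightarrow> enum i j l k"
  unfolding enum_def by auto

lemma enum_exists:
  assumes "l \<in> I"
  shows "\<exists>i j k. enum i j k l"
proof -
  have "enum 1 2 3 0" "enum 0 2 3 1" "enum 0 1 3 2" "enum 0 1 2 3"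
    unfolding enum_def I_def by auto
  then show ?thesis using assms unfolding I_def by blast
qed

lemma bounds:
  assumes "i \<in> I"
  shows "- 1 \<le> \<alpha> i" "\<alpha> i \<le> 1" "\<alpha> i \<le> 1 + sum \<alpha> I"
  using plus[OF assms] minus[OF assms] comp[OF assms] by (auto simp: in_T3_def)

text \<open>Points strictly above the first hyperplane are the ones that constrain \<beta> and
  \<gamma>.\<close>

lemma alive:
  assumes "i \<in> I"
  shows "- 1 < \<alpha> i \<Longrightarrow> in_T2 (b1 + \<gamma> i) (b2 + \<beta> i)"
    "\<alpha> i < 1 \<Longrightarrow> in_T2 (b1 - \<gamma> i) (b2 - \<beta> i)"
    "\<alpha> i < 1 + sum \<alpha> I \<Longrightarrow> in_T2 (b1 + sum \<gamma> I - \<gamma> i) (b2 + sum \<beta> I - \<beta> i)"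
  using plus[OF assms] minus[OF assms] comp[OF assms] by (auto simp: in_T3_def)

lemma plane_alpha: "plane \<theta> \<Longrightarrow> \<not> (\<forall>i\<in>I. \<theta> i = s * \<alpha> i)"
  using indep[of _ _ "- s"] unfolding plane_def by auto

lemma plane_nonzero: "plane \<theta> \<Longrightarrow> \<not> (\<forall>i\<in>I. \<theta> i = 0)"
  using plane_alpha[of \<theta> 0] by simp

lemma plane_alpha2:
  assumes "plane \<theta>" "plane \<theta>'"
  shows "\<not> (\<forall>i\<in>I. \<alpha> i = s * \<theta> i + t * \<theta>' i)"
proof
  assume a: "\<forall>i\<in>I. \<alpha> i = s * \<theta> i + t * \<theta>' i"
  obtain x y x' y' where "\<theta> = (\<lambda>i. x * \<gamma> i + y * \<beta> i)" "\<theta>' = (\<lambda>i. x' * \<gamma> i + y' * \<beta> i)"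
    using assms unfolding plane_def by blast
  then have "\<forall>i\<in>I. (s * x + t * x') * \<gamma> i + (s * y + t * y') * \<beta> i + (- 1) * \<alpha> i = 0"
    using a by (simp add: algebra_simps)
  from indep[OF this] show False by simp
qed

text \<open>The coefficients are the 2 by 2 minors; if that of the first two functionals vanishes,
  these are already proportional.\<close>

lemma plane_dependent:
  assumes "plane \<theta>1" "plane \<theta>2" "plane \<theta>3"
  obtains x y z where "x \<noteq> 0 \<or> y \<noteq> 0 \<or> z \<noteq> 0" "\<forall>i\<in>I. x * \<theta>1 i + y * \<theta>2 i + z * \<theta>3 i = 0"
proof -
  obtain p1 q1 p2 q2 p3 q3 where n: "p1 \<noteq> 0 \<or> q1 \<noteq> 0"
    and t: "\<theta>1 = (\<lambda>i. p1 * \<gamma> i + q1 * \<beta> i)" "\<theta>2 = (\<lambda>i. p2 * \<gamma> i + q2 * \<beta> i)" "\<theta>3 = (\<lambda>i. p3 * \<gamma> i + q3 * \<beta> i)"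
    using assms unfolding plane_def by blast
  show ?thesis
  proof (cases "p1 * q2 = p2 * q1")
    case False
    show ?thesis
      by (rule that[of "p2 * q3 - p3 * q2" "p3 * q1 - p1 * q3" "p1 * q2 - p2 * q1"])
        (use False in \<open>auto simp: t algebra_simps\<close>)
  next
    case True
    show ?thesis
    proof (cases "p1 = 0")
      case True
      then show ?thesis using \<open>p1 * q2 = p2 * q1\<close> n
        by (intro that[of q2 "- q1" 0]) (auto simp: t algebra_simps)
    next
      case False
      have "p2 * (p1 * \<gamma> i + q1 * \<beta> i) - p1 * (p2 * \<gamma> i + q2 * \<beta> i) = 0" for i
        using True by (simp add: algebra_simps)
      then show ?thesis using False by (intro that[of p2 "- p1" 0]) (auto simp: t)
    qed
  qed
qed

text \<open>Centre 0, with the pairs \<open>e_i\<close> and \<open>-e_i\<close>.\<close>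

lemma plane_center:
  obtains \<theta> where "plane \<theta>" "\<And>i. i \<in> I \<Longrightarrow> - 1 < \<alpha> i \<Longrightarrow> \<alpha> i < 1 \<Longrightarrow> \<theta> i = 0"
proof -
  obtain x y where xy: "x \<noteq> 0 \<or> y \<noteq> 0"
    "\<And>u1 u2 v1 v2. in_T2 u1 u2 \<Longrightarrow> in_T2 v1 v2 \<Longrightarrow> u1 + v1 = 2 * b1 \<Longrightarrow> u2 + v2 = 2 * b2 \<Longrightarrow>
       x * (u1 - v1) + y * (u2 - v2) = 0"
    using in_T2_common_line[of "2 * b1" "2 * b2"] by metis
  show ?thesis
  proof (rule that[of "\<lambda>i. x * \<gamma> i + y * \<beta> i"])
    show "plane (\<lambda>i. x * \<gamma> i + y * \<beta> i)" using xy(1) unfolding plane_def by blast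
    fix i assume "i \<in> I" "- 1 < \<alpha> i" "\<alpha> i < 1"
    then show "x * \<gamma> i + y * \<beta> i = 0"
      using xy(2)[OF alive(1) alive(2), of i i] by (simp add: algebra_simps)
  qed
qed

text \<open>Centre (1,1,1,1)/2, with the pairs \<open>e_i\<close> and
  \<open>(1,1,1,1) - e_i\<close>, whose difference is \<open>2 e_i - (1,1,1,1)\<close>.\<close>

lemma plane_half:
  obtains \<theta> where "plane \<theta>"
    "\<forall>i\<in>I. - 1 < \<alpha> i \<and> \<alpha> i < 1 + sum \<alpha> I \<longrightarrow> 2 * \<theta> i = sum \<theta> I"
proof -
  obtain x y where xy: "x \<noteq> 0 \<or> y \<noteq> 0"
    "\<And>u1 u2 v1 v2. in_T2 u1 u2 \<Longrightarrow> in_T2 v1 v2 \<Longrightarrow> u1 + v1 = 2 * b1 + sum \<gamma> I \<Longrightarrow> u2 + v2 = 2 * b2 + sum \<beta> I \<Longrightarrow>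
       x * (u1 - v1) + y * (u2 - v2) = 0"
    using in_T2_common_line[of "2 * b1 + sum \<gamma> I" "2 * b2 + sum \<beta> I"] by metis
  show ?thesis
  proof (rule that[of "\<lambda>i. x * \<gamma> i + y * \<beta> i"])
    show "plane (\<lambda>i. x * \<gamma> i + y * \<beta> i)" using xy(1) unfolding plane_def by blast
    show "\<forall>i\<in>I. - 1 < \<alpha> i \<and> \<alpha> i < 1 + sum \<alpha> I \<longrightarrow>
        2 * (x * \<gamma> i + y * \<beta> i) = (\<Sum>i\<in>I. x * \<gamma> i + y * \<beta> i)"
    proof (intro ballI impI)
      fix i assume "i \<in> I" "- 1 < \<alpha> i \<and> \<alpha> i < 1 + sum \<alpha> I"
      then have "x * (b1 + \<gamma> i - (b1 + sum \<gamma> I - \<gamma> i)) + y * (b2 + \<beta> i - (b2 + sum \<beta> I - \<beta> i)) = 0"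
        by (intro xy(2) alive) simp_all
      then show "2 * (x * \<gamma> i + y * \<beta> i) = (\<Sum>i\<in>I. x * \<gamma> i + y * \<beta> i)"
        unfolding sum.distrib sum_distrib_left[symmetric] by (simp add: algebra_simps)
    qed
  qed
qed

text \<open>Centre \<open>(e_i + e_j) / 2\<close>: besides \<open>e_i\<close> and
  \<open>e_j\<close>, it is the midpoint of \<open>(1,1,1,1) - e_l\<close> and \<open>-e_k\<close>,
  and of \<open>(1,1,1,1) - e_k\<close> and \<open>-e_l\<close>.\<close>

lemma plane_pair:
  assumes e: "enum i j k l"
  obtains \<theta> where "plane \<theta>" "- 1 < \<alpha> i \<Longrightarrow> - 1 < \<alpha> j \<Longrightarrow> \<theta> i = \<theta> j"
    "\<alpha> k < 1 \<Longrightarrow> \<alpha> l < 1 + sum \<alpha> I \<Longrightarrow> \<theta> i + \<theta> j + 2 * \<theta> k = 0"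
    "\<alpha> l < 1 \<Longrightarrow> \<alpha> k < 1 + sum \<alpha> I \<Longrightarrow> \<theta> i + \<theta> j + 2 * \<theta> l = 0"
proof -
  obtain x y where xy: "x \<noteq> 0 \<or> y \<noteq> 0"
    "\<And>u1 u2 v1 v2. in_T2 u1 u2 \<Longrightarrow> in_T2 v1 v2 \<Longrightarrow> u1 + v1 = 2 * b1 + \<gamma> i + \<gamma> j \<Longrightarrow>
      u2 + v2 = 2 * b2 + \<beta> i + \<beta> j \<Longrightarrow> x * (u1 - v1) + y * (u2 - v2) = 0"
    using in_T2_common_line[of "2 * b1 + \<gamma> i + \<gamma> j" "2 * b2 + \<beta> i + \<beta> j"] by metis
  note m = enum_in[OF e]
  note s = enum_sum[OF e, of \<beta>] enum_sum[OF e, of \<gamma>]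
  show ?thesis
  proof (rule that[of "\<lambda>i. x * \<gamma> i + y * \<beta> i"])
    show "plane (\<lambda>i. x * \<gamma> i + y * \<beta> i)" using xy(1) unfolding plane_def by blast
    show "x * \<gamma> i + y * \<beta> i = x * \<gamma> j + y * \<beta> j" if "- 1 < \<alpha> i" "- 1 < \<alpha> j"
    proof -
      have "x * (b1 + \<gamma> i - (b1 + \<gamma> j)) + y * (b2 + \<beta> i - (b2 + \<beta> j)) = 0"
        by (intro xy(2) alive) (use m that in simp_all)
      then show ?thesis by (simp add: algebra_simps)
    qed
    show "x * \<gamma> i + y * \<beta> i + (x * \<gamma> j + y * \<beta> j) + 2 * (x * \<gamma> k + y * \<beta> k) = 0"
      if "\<alpha> k < 1" "\<alpha> l < 1 + sum \<alpha> I"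
    proof -
      have "x * (b1 + sum \<gamma> I - \<gamma> l - (b1 - \<gamma> k)) + y * (b2 + sum \<beta> I - \<beta> l - (b2 - \<beta> k)) = 0"
        by (intro xy(2) alive) (use m that s in simp_all)
      then show ?thesis unfolding s by (simp add: algebra_simps)
    qed
    show "x * \<gamma> i + y * \<beta> i + (x * \<gamma> j + y * \<beta> j) + 2 * (x * \<gamma> l + y * \<beta> l) = 0"
      if "\<alpha> l < 1" "\<alpha> k < 1 + sum \<alpha> I"
    proof -
      have "x * (b1 + sum \<gamma> I - \<gamma> k - (b1 - \<gamma> l)) + y * (b2 + sum \<beta> I - \<beta> k - (b2 - \<beta> l)) = 0"
        by (intro xy(2) alive) (use m that s in simp_all)
      then show ?thesis unfolding s by (simp add: algebra_simps)
    qed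
  qed
qed

lemma plane_pair_alive:
  assumes e: "enum i j k l" and "- 1 < \<alpha> i" "- 1 < \<alpha> j" "\<alpha> k < 1" "\<alpha> l < 1"
    "\<alpha> k < 1 + sum \<alpha> I" "\<alpha> l < 1 + sum \<alpha> I"
  obtains \<theta> where "plane \<theta>" "\<theta> j = \<theta> i" "\<theta> k = - \<theta> i" "\<theta> l = - \<theta> i" "\<theta> i \<noteq> 0"
proof (rule plane_pair[OF e])
  fix \<theta> assume t: "plane \<theta>" "- 1 < \<alpha> i \<Longrightarrow> - 1 < \<alpha> j \<Longrightarrow> \<theta> i = \<theta> j"
    "\<alpha> k < 1 \<Longrightarrow> \<alpha> l < 1 + sum \<alpha> I \<Longrightarrow> \<theta> i + \<theta> j + 2 * \<theta> k = 0"
    "\<alpha> l < 1 \<Longrightarrow> \<alpha> k < 1 + sum \<alpha> I \<Longrightarrow> \<theta> i + \<theta> j + 2 * \<theta> l = 0"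
  have v: "\<theta> j = \<theta> i" "\<theta> k = - \<theta> i" "\<theta> l = - \<theta> i"
    using t(2)[OF assms(2,3)] t(3)[OF assms(4,7)] t(4)[OF assms(5,6)] by linarith+
  moreover have "\<theta> i \<noteq> 0" using plane_nonzero[OF t(1)] enum_all[OF e] v by auto
  ultimately show thesis using that t(1) by blast
qed

text \<open>Three pairs force the values (t, t, t, -t); a fourth pair would require
  \<open>-t = t\<close>.\<close>

lemma plane_half_alive:
  assumes e: "enum i j k l" and a: "\<forall>m\<in>{i, j, k}. - 1 < \<alpha> m \<and> \<alpha> m < 1 + sum \<alpha> I"
  obtains \<theta> where "plane \<theta>" "\<theta> j = \<theta> i" "\<theta> k = \<theta> i" "\<theta> l = - \<theta> i" "\<theta> i \<noteq> 0"
    "\<alpha> l = - 1 \<or> 1 + sum \<alpha> I = \<alpha> l"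
proof (rule plane_half)
  fix \<theta> assume t: "plane \<theta>" "\<forall>i\<in>I. - 1 < \<alpha> i \<and> \<alpha> i < 1 + sum \<alpha> I \<longrightarrow> 2 * \<theta> i = sum \<theta> I"
  note m = enum_in[OF e]
  have "2 * \<theta> i = sum \<theta> I" "2 * \<theta> j = sum \<theta> I" "2 * \<theta> k = sum \<theta> I" using t(2) a m by blast+
  then have v: "\<theta> j = \<theta> i" "\<theta> k = \<theta> i" "\<theta> l = - \<theta> i" using enum_sum[OF e, of \<theta>] by linarith+
  have nz: "\<theta> i \<noteq> 0" using plane_nonzero[OF t(1)] enum_all[OF e] v by auto
  have "\<alpha> l = - 1 \<or> 1 + sum \<alpha> I = \<alpha> l"
  proof (rule ccontr)
    assume "\<not> ?thesis"
    then have "2 * \<theta> l = sum \<theta> I" using t(2) bounds(1,3)[of l] m by force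
    then show False using enum_sum[OF e, of \<theta>] v nz by simp
  qed
  then show thesis using that t(1) v nz by blast
qed

section \<open>Excluding the possible values of \<alpha>, with vectors written in the order i, j, k,
  l\<close>

lemma no_all_alive:
  assumes e: "enum i j k l" and a: "\<forall>i\<in>I. - 1 < \<alpha> i \<and> \<alpha> i < 1 + sum \<alpha> I"
  shows False
proof -
  have "\<forall>m\<in>{i, j, k}. - 1 < \<alpha> m \<and> \<alpha> m < 1 + sum \<alpha> I" using a enum_in[OF e] by blast
  then show False
  proof (rule plane_half_alive[OF e])
    assume "\<alpha> l = - 1 \<or> 1 + sum \<alpha> I = \<alpha> l"
    then show False using a enum_in[OF e] by force
  qed
qed

lemma no_all_inner:
  assumes "\<forall>i\<in>I. - 1 < \<alpha> i \<and> \<alpha> i < 1"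
  shows False
proof -
  obtain \<theta> where "plane \<theta>" "\<And>i. i \<in> I \<Longrightarrow> - 1 < \<alpha> i \<Longrightarrow> \<alpha> i < 1 \<Longrightarrow> \<theta> i = 0"
    using plane_center by metis
  then show False using plane_nonzero assms by blast
qed

lemma three_inner:
  assumes e: "enum i j k l" and inner: "\<forall>m\<in>{i, j, k}. - 1 < \<alpha> m \<and> \<alpha> m < 1"
  obtains \<theta> where "plane \<theta>" "\<theta> i = 0" "\<theta> j = 0" "\<theta> k = 0" "\<theta> l \<noteq> 0"
proof -
  obtain \<theta> where t: "plane \<theta>" "\<And>i. i \<in> I \<Longrightarrow> - 1 < \<alpha> i \<Longrightarrow> \<alpha> i < 1 \<Longrightarrow> \<theta> i = 0"
    using plane_center by metis
  have "\<theta> i = 0" "\<theta> j = 0" "\<theta> k = 0" using t(2) inner enum_in[OF e] by auto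
  moreover from this have "\<theta> l \<noteq> 0" using plane_nonzero[OF t(1)] enum_all[OF e] by auto
  ultimately show ?thesis using that t(1) by blast
qed

text \<open>Up to factors, (0,0,0,1), (1,-1,-1,1) and (-1,1,-1,1) would be three independent members
  of a plane.\<close>

lemma no_inner3_plus:
  assumes e: "enum i j k l" and inner: "\<forall>m\<in>{i, j, k}. - 1 < \<alpha> m \<and> \<alpha> m < 1"
    and l: "\<alpha> l = 1" "\<alpha> i + \<alpha> j + \<alpha> k = - 1"
  shows False
proof -
  have A: "sum \<alpha> I = 0" unfolding enum_sum[OF e] using l by simp
  obtain \<theta>0 where t0: "plane \<theta>0" "\<theta>0 i = 0" "\<theta>0 j = 0" "\<theta>0 k = 0" "\<theta>0 l \<noteq> 0"
    using three_inner[OF e inner] by metis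
  have e1: "enum i l j k" "enum j l i k" using e unfolding enum_def by auto
  obtain \<theta>1 where t1: "plane \<theta>1" "\<theta>1 l = \<theta>1 i" "\<theta>1 j = - \<theta>1 i" "\<theta>1 k = - \<theta>1 i" "\<theta>1 i \<noteq> 0"
    by (rule plane_pair_alive[OF e1(1)]) (use inner l A in auto)
  obtain \<theta>2 where t2: "plane \<theta>2" "\<theta>2 l = \<theta>2 j" "\<theta>2 i = - \<theta>2 j" "\<theta>2 k = - \<theta>2 j" "\<theta>2 j \<noteq> 0"
    by (rule plane_pair_alive[OF e1(2)]) (use inner l A in auto)
  obtain x y z where xyz: "x \<noteq> 0 \<or> y \<noteq> 0 \<or> z \<noteq> 0" "\<forall>i\<in>I. x * \<theta>0 i + y * \<theta>1 i + z * \<theta>2 i = 0"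
    using plane_dependent[OF t0(1) t1(1) t2(1)] .
  have "y * \<theta>1 i - z * \<theta>2 j = 0" "- (y * \<theta>1 i) - z * \<theta>2 j = 0" "x * \<theta>0 l + y * \<theta>1 i + z * \<theta>2 j = 0"
    using xyz(2) enum_in[OF e] t0 t1 t2 by force+
  then have "y * \<theta>1 i = 0" "z * \<theta>2 j = 0" "x * \<theta>0 l = 0" by linarith+
  then show False using xyz(1) t1(5) t2(5) t0(5) by simp
qed

text \<open>As \<open>\<alpha> l = - 1\<close>, the condition
  \<open>0 < \<alpha> i + \<alpha> j\<close> says \<open>\<alpha> k < 1 + sum \<alpha> I\<close>, so
  the pair with \<open>(1,1,1,1) - e_k\<close> is available.\<close>

lemma inner3_minus:
  assumes e: "enum i j k l" and inner: "\<forall>m\<in>{i, j, k}. - 1 < \<alpha> m \<and> \<alpha> m < 1"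
    and l: "\<alpha> l = - 1" "0 < \<alpha> i + \<alpha> j"
  obtains \<theta> where "plane \<theta>" "\<theta> j = \<theta> i" "\<theta> k = - \<theta> i" "\<theta> l = - \<theta> i" "\<theta> i \<noteq> 0"
proof (rule plane_pair_alive[OF e])
  have A: "sum \<alpha> I = \<alpha> i + \<alpha> j + \<alpha> k - 1" unfolding enum_sum[OF e] using l by simp
  have in3: "- 1 < \<alpha> i" "- 1 < \<alpha> j" "- 1 < \<alpha> k" "\<alpha> k < 1" using inner by auto
  show "- 1 < \<alpha> i" "- 1 < \<alpha> j" "\<alpha> k < 1" by fact+
  show "\<alpha> l < 1" "\<alpha> k < 1 + sum \<alpha> I" "\<alpha> l < 1 + sum \<alpha> I" using A l in3 by linarith+
qed (rule that)

lemma no_inner3_minus2: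
  assumes e: "enum i j k l" and inner: "\<forall>m\<in>{i, j, k}. - 1 < \<alpha> m \<and> \<alpha> m < 1"
    and l: "\<alpha> l = - 1" "0 < \<alpha> i + \<alpha> j" "0 < \<alpha> i + \<alpha> k"
  shows False
proof -
  obtain \<theta>0 where t0: "plane \<theta>0" "\<theta>0 i = 0" "\<theta>0 j = 0" "\<theta>0 k = 0" "\<theta>0 l \<noteq> 0"
    using three_inner[OF e inner] by metis
  obtain \<theta>1 where t1: "plane \<theta>1" "\<theta>1 j = \<theta>1 i" "\<theta>1 k = - \<theta>1 i" "\<theta>1 l = - \<theta>1 i" "\<theta>1 i \<noteq> 0"
    using inner3_minus[OF e inner l(1,2)] .
  have inner': "\<forall>m\<in>{i, k, j}. - 1 < \<alpha> m \<and> \<alpha> m < 1" using inner by blast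
  obtain \<theta>2 where t2: "plane \<theta>2" "\<theta>2 k = \<theta>2 i" "\<theta>2 j = - \<theta>2 i" "\<theta>2 l = - \<theta>2 i" "\<theta>2 i \<noteq> 0"
    using inner3_minus[OF enum_swap(2)[OF e] inner' l(1,3)] .
  obtain x y z where xyz: "x \<noteq> 0 \<or> y \<noteq> 0 \<or> z \<noteq> 0" "\<forall>i\<in>I. x * \<theta>0 i + y * \<theta>1 i + z * \<theta>2 i = 0"
    using plane_dependent[OF t0(1) t1(1) t2(1)] .
  have "y * \<theta>1 i + z * \<theta>2 i = 0" "y * \<theta>1 i - z * \<theta>2 i = 0" "x * \<theta>0 l - y * \<theta>1 i - z * \<theta>2 i = 0"
    using xyz(2) enum_in[OF e] t0 t1 t2 by force+
  then have "y * \<theta>1 i = 0" "z * \<theta>2 i = 0" "x * \<theta>0 l = 0" by linarith+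
  then show False using xyz(1) t0(5) t1(5) t2(5) by simp
qed

text \<open>Now \<alpha> is (s, s, -s, -1), a combination of the members (1,1,-1,-1) and (0,0,0,1)
  of the plane.\<close>

lemma no_inner3_minus1:
  assumes e: "enum i j k l" and inner: "\<forall>m\<in>{i, j, k}. - 1 < \<alpha> m \<and> \<alpha> m < 1"
    and l: "\<alpha> l = - 1" "0 < \<alpha> i + \<alpha> j" "\<alpha> i + \<alpha> k = 0" "\<alpha> j + \<alpha> k = 0"
  shows False
proof -
  obtain \<theta>0 where t0: "plane \<theta>0" "\<theta>0 i = 0" "\<theta>0 j = 0" "\<theta>0 k = 0" "\<theta>0 l \<noteq> 0"
    using three_inner[OF e inner] by metis
  obtain \<theta>1 where t1: "plane \<theta>1" "\<theta>1 j = \<theta>1 i" "\<theta>1 k = - \<theta>1 i" "\<theta>1 l = - \<theta>1 i" "\<theta>1 i \<noteq> 0"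
    using inner3_minus[OF e inner l(1,2)] .
  have "\<alpha> j = \<alpha> i" "\<alpha> k = - \<alpha> i" using l by linarith+
  then have "\<forall>m\<in>I. \<alpha> m = \<alpha> i / \<theta>1 i * \<theta>1 m + (\<alpha> i - 1) / \<theta>0 l * \<theta>0 m"
    unfolding enum_all[OF e] using t0 t1 l(1) by simp
  then show False using plane_alpha2[OF t1(1) t0(1)] by blast
qed

lemma no_inner3_minus0:
  assumes e: "enum i j k l" and inner: "\<forall>m\<in>{i, j, k}. - 1 < \<alpha> m \<and> \<alpha> m < 1"
    and l: "\<alpha> l = - 1" "\<alpha> i = 0" "\<alpha> j = 0" "\<alpha> k = 0"
  shows False
proof -
  obtain \<theta>0 where t0: "plane \<theta>0" "\<theta>0 i = 0" "\<theta>0 j = 0" "\<theta>0 k = 0" "\<theta>0 l \<noteq> 0"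
    using three_inner[OF e inner] by metis
  have "\<forall>m\<in>I. \<theta>0 m = - \<theta>0 l * \<alpha> m" unfolding enum_all[OF e] using t0 l by simp
  then show False using plane_alpha[OF t0(1)] by blast
qed

text \<open>The plane contains (1,-1,1,-1) and (-1,1,1,-1). They span \<alpha> if
  \<open>\<alpha> i + \<alpha> j = 0\<close>; otherwise \<open>(1,1,1,1) - e_k\<close> is off the
  first hyperplane and yields a third independent member.\<close>

lemma no_inner2:
  assumes e: "enum i j k l" and inner: "- 1 < \<alpha> i" "\<alpha> i < 1" "- 1 < \<alpha> j" "\<alpha> j < 1" and kl: "\<alpha> k = 1" "\<alpha> l = - 1"
  shows False
proof -
  have A: "sum \<alpha> I = \<alpha> i + \<alpha> j" unfolding enum_sum[OF e] using kl by simp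
  have e1: "enum i k j l" "enum j k i l" using e unfolding enum_def by auto
  have nn: "0 \<le> \<alpha> i + \<alpha> j" using bounds(3)[of k] enum_in[OF e] kl A by simp
  obtain \<theta>1 where t1: "plane \<theta>1" "\<theta>1 k = \<theta>1 i" "\<theta>1 j = - \<theta>1 i" "\<theta>1 l = - \<theta>1 i" "\<theta>1 i \<noteq> 0"
    by (rule plane_pair_alive[OF e1(1)]) (use inner kl A nn in auto)
  obtain \<theta>2 where t2: "plane \<theta>2" "\<theta>2 k = \<theta>2 j" "\<theta>2 i = - \<theta>2 j" "\<theta>2 l = - \<theta>2 j" "\<theta>2 j \<noteq> 0"
    by (rule plane_pair_alive[OF e1(2)]) (use inner kl A nn in auto)
  show False
  proof (cases "\<alpha> i + \<alpha> j = 0")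
    case True
    then have "\<alpha> j = - \<alpha> i" by linarith
    then have "\<forall>m\<in>I. \<alpha> m = (1 + \<alpha> i) / (2 * \<theta>1 i) * \<theta>1 m + (1 - \<alpha> i) / (2 * \<theta>2 j) * \<theta>2 m"
      unfolding enum_all[OF e] using t1 t2 kl by (simp add: field_simps)
    then show False using plane_alpha2[OF t1(1) t2(1)] by blast
  next
    case False
    then have pos: "0 < \<alpha> i + \<alpha> j" using nn by simp
    obtain \<theta>3 where t3: "plane \<theta>3" "\<theta>3 i = \<theta>3 j" "\<theta>3 i + \<theta>3 j + 2 * \<theta>3 l = 0"
    proof (rule plane_pair[OF e])
      fix \<theta> assume t: "plane \<theta>" "- 1 < \<alpha> i \<Longrightarrow> - 1 < \<alpha> j \<Longrightarrow> \<theta> i = \<theta> j"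
        "\<alpha> l < 1 \<Longrightarrow> \<alpha> k < 1 + sum \<alpha> I \<Longrightarrow> \<theta> i + \<theta> j + 2 * \<theta> l = 0"
      show thesis by (rule that[OF t(1) t(2) t(3)]) (use inner kl A pos in auto)
    qed
    obtain x y z where xyz: "x \<noteq> 0 \<or> y \<noteq> 0 \<or> z \<noteq> 0" "\<forall>i\<in>I. x * \<theta>1 i + y * \<theta>2 i + z * \<theta>3 i = 0"
      using plane_dependent[OF t1(1) t2(1) t3(1)] .
    have v3: "\<theta>3 j = \<theta>3 i" "\<theta>3 l = - \<theta>3 i" using t3 by linarith+
    have "x * \<theta>1 i - y * \<theta>2 j + z * \<theta>3 i = 0" "- (x * \<theta>1 i) + y * \<theta>2 j + z * \<theta>3 i = 0"
      "- (x * \<theta>1 i) - y * \<theta>2 j - z * \<theta>3 i = 0" "x * \<theta>1 i + y * \<theta>2 j + z * \<theta>3 k = 0"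
      using xyz(2) t1 t2 v3 unfolding enum_all[OF e] by simp_all
    then have "x * \<theta>1 i = 0" "y * \<theta>2 j = 0" "z * \<theta>3 i = 0" "z * \<theta>3 k = 0" by linarith+
    then have "z \<noteq> 0" "\<theta>3 i = 0" "\<theta>3 k = 0" using xyz(1) t1(5) t2(5) by auto
    then show False using plane_nonzero[OF t3(1)] enum_all[OF e] v3 by auto
  qed
qed

lemma half_minus:
  assumes e: "enum i j k l" and "- 1 < \<alpha> i" "\<alpha> j = 1" "\<alpha> k = 1" "\<alpha> l = - 1"
  obtains \<theta> where "plane \<theta>" "\<theta> j = \<theta> i" "\<theta> k = \<theta> i" "\<theta> l = - \<theta> i" "\<theta> i \<noteq> 0"
proof (rule plane_half_alive[OF e])
  have A: "sum \<alpha> I = \<alpha> i + 1" unfolding enum_sum[OF e] using assms by simp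
  then show "\<forall>m\<in>{i, j, k}. - 1 < \<alpha> m \<and> \<alpha> m < 1 + sum \<alpha> I" using assms by simp
qed (rule that)

lemma no_inner1:
  assumes e: "enum i j k l" and a: "- 1 < \<alpha> i" "\<alpha> i < 1" "\<alpha> j = 1" "\<alpha> k = 1" "\<alpha> l = - 1"
  shows False
proof -
  have A: "sum \<alpha> I = \<alpha> i + 1" unfolding enum_sum[OF e] using a by simp
  obtain \<theta>1 where t1: "plane \<theta>1" "\<theta>1 j = \<theta>1 i" "\<theta>1 k = \<theta>1 i" "\<theta>1 l = - \<theta>1 i" "\<theta>1 i \<noteq> 0"
    using half_minus[OF e a(1,3,4,5)] .
  have e1: "enum j k i l" using e unfolding enum_def by auto
  obtain \<theta>2 where t2: "plane \<theta>2" "\<theta>2 k = \<theta>2 j" "\<theta>2 i = - \<theta>2 j" "\<theta>2 l = - \<theta>2 j" "\<theta>2 j \<noteq> 0"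
    by (rule plane_pair_alive[OF e1]) (use a A in auto)
  have "\<forall>m\<in>I. \<alpha> m = (1 + \<alpha> i) / (2 * \<theta>1 i) * \<theta>1 m + (1 - \<alpha> i) / (2 * \<theta>2 j) * \<theta>2 m"
    unfolding enum_all[OF e] using t1 t2 a by (simp add: field_simps)
  then show False using plane_alpha2[OF t1(1) t2(1)] by blast
qed

lemma no_inner0_1:
  assumes e: "enum i j k l" and a: "\<alpha> i = 1" "\<alpha> j = 1" "\<alpha> k = 1" "\<alpha> l = - 1"
  shows False
proof -
  obtain \<theta> where t: "plane \<theta>" "\<theta> j = \<theta> i" "\<theta> k = \<theta> i" "\<theta> l = - \<theta> i"
    by (rule half_minus[OF e _ a(2-4)]) (use a(1) in auto)
  then have "\<forall>m\<in>I. \<theta> m = \<theta> i * \<alpha> m" unfolding enum_all[OF e] using a by simp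
  then show False using plane_alpha[OF t(1)] by blast
qed

lemma no_inner0_2:
  assumes e: "enum i j k l" and a: "\<alpha> i = 1" "\<alpha> j = 1" "\<alpha> k = - 1" "\<alpha> l = - 1"
  shows False
proof -
  have A: "sum \<alpha> I = 0" unfolding enum_sum[OF e] using a by simp
  obtain \<theta> where t: "plane \<theta>" "\<theta> j = \<theta> i" "\<theta> k = - \<theta> i" "\<theta> l = - \<theta> i"
    by (rule plane_pair_alive[OF e]) (use a A in auto)
  then have "\<forall>m\<in>I. \<theta> m = \<theta> i * \<alpha> m" unfolding enum_all[OF e] using a by simp
  then show False using plane_alpha[OF t(1)] by blast
qed

text \<open>The pairwise sums of the other three values are nonnegative by \<open>bounds\<close>.
  The cases record which of these values are 1 and, if none is, which pairwise sums vanish.\<close>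

lemma no_one_minus:
  assumes e: "enum i j k l" and l: "\<alpha> l = - 1" and gt: "- 1 < \<alpha> i" "- 1 < \<alpha> j" "- 1 < \<alpha> k"
  shows False
proof -
  note m = enum_in[OF e]
  have A: "sum \<alpha> I = \<alpha> i + \<alpha> j + \<alpha> k - 1" unfolding enum_sum[OF e] using l by simp
  have le: "\<alpha> i \<le> 1" "\<alpha> j \<le> 1" "\<alpha> k \<le> 1" using bounds(2) m by auto
  have pos: "0 \<le> \<alpha> j + \<alpha> k" "0 \<le> \<alpha> i + \<alpha> k" "0 \<le> \<alpha> i + \<alpha> j"
    using bounds(3)[of i] bounds(3)[of j] bounds(3)[of k] m A by auto
  have ee: "enum i k j l" "enum j i k l" "enum j k i l" "enum k i j l" "enum k j i l"
    using e unfolding enum_def by auto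
  have "\<alpha> i = 1 \<or> \<alpha> i < 1" "\<alpha> j = 1 \<or> \<alpha> j < 1" "\<alpha> k = 1 \<or> \<alpha> k < 1" using le by auto
  then consider "\<alpha> i = 1" "\<alpha> j = 1" "\<alpha> k = 1" | "\<alpha> i < 1" "\<alpha> j = 1" "\<alpha> k = 1" | "\<alpha> i = 1" "\<alpha> j < 1" "\<alpha> k = 1"
    | "\<alpha> i = 1" "\<alpha> j = 1" "\<alpha> k < 1" | "\<alpha> i < 1" "\<alpha> j < 1" "\<alpha> k = 1" | "\<alpha> i < 1" "\<alpha> j = 1" "\<alpha> k < 1"
    | "\<alpha> i = 1" "\<alpha> j < 1" "\<alpha> k < 1" | "\<alpha> i < 1" "\<alpha> j < 1" "\<alpha> k < 1"
    by blast
  then show False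
  proof cases
    case 1 then show False using no_inner0_1[OF e] l by blast
  next
    case 2 then show False using no_inner1[OF e] l gt by blast
  next
    case 3 then show False using no_inner1[OF ee(2)] l gt by blast
  next
    case 4 then show False using no_inner1[OF ee(4)] l gt by blast
  next
    case 5 then show False using no_inner2[OF e] l gt by blast
  next
    case 6 then show False using no_inner2[OF ee(1)] l gt by blast
  next
    case 7 then show False using no_inner2[OF ee(3)] l gt by blast
  next
    case 8
    then have inner: "\<forall>m\<in>{i, j, k}. - 1 < \<alpha> m \<and> \<alpha> m < 1" "\<forall>m\<in>{j, i, k}. - 1 < \<alpha> m \<and> \<alpha> m < 1"
      "\<forall>m\<in>{k, i, j}. - 1 < \<alpha> m \<and> \<alpha> m < 1" "\<forall>m\<in>{i, k, j}. - 1 < \<alpha> m \<and> \<alpha> m < 1"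
      "\<forall>m\<in>{j, k, i}. - 1 < \<alpha> m \<and> \<alpha> m < 1" using gt by auto
    have "\<alpha> i + \<alpha> j = 0 \<or> 0 < \<alpha> i + \<alpha> j" "\<alpha> i + \<alpha> k = 0 \<or> 0 < \<alpha> i + \<alpha> k"
      "\<alpha> j + \<alpha> k = 0 \<or> 0 < \<alpha> j + \<alpha> k" using pos by auto
    moreover have "\<alpha> i = 0" "\<alpha> j = 0" "\<alpha> k = 0"
      if "\<alpha> i + \<alpha> j = 0" "\<alpha> i + \<alpha> k = 0" "\<alpha> j + \<alpha> k = 0" using that by linarith+
    ultimately consider "0 < \<alpha> i + \<alpha> j" "0 < \<alpha> i + \<alpha> k" | "0 < \<alpha> i + \<alpha> j" "0 < \<alpha> j + \<alpha> k" | "0 < \<alpha> i + \<alpha> k" "0 < \<alpha> j + \<alpha> k"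
      | "0 < \<alpha> i + \<alpha> j" "\<alpha> i + \<alpha> k = 0" "\<alpha> j + \<alpha> k = 0" | "0 < \<alpha> i + \<alpha> k" "\<alpha> i + \<alpha> j = 0" "\<alpha> j + \<alpha> k = 0"
      | "0 < \<alpha> j + \<alpha> k" "\<alpha> i + \<alpha> j = 0" "\<alpha> i + \<alpha> k = 0" | "\<alpha> i = 0" "\<alpha> j = 0" "\<alpha> k = 0"
      by blast
    then show False
    proof cases
      case 1 then show False using no_inner3_minus2[OF e inner(1) l] by blast
    next
      case 2 then show False using no_inner3_minus2[OF ee(2) inner(2) l] by (simp add: add.commute)
    next
      case 3 then show False using no_inner3_minus2[OF ee(4) inner(3) l] by (simp add: add.commute)
    next
      case 4 then show False using no_inner3_minus1[OF e inner(1) l] by blast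
    next
      case 5 then show False using no_inner3_minus1[OF ee(1) inner(4) l] by (simp add: add.commute)
    next
      case 6 then show False using no_inner3_minus1[OF ee(3) inner(5) l] by (simp add: add.commute)
    next
      case 7 then show False using no_inner3_minus0[OF e inner(1) l] by blast
    qed
  qed
qed

lemma two_minus:
  assumes e: "enum i j k l" and a: "\<alpha> k = - 1" "\<alpha> l = - 1"
  shows False
proof -
  note m = enum_in[OF e]
  have "sum \<alpha> I = \<alpha> i + \<alpha> j - 2" unfolding enum_sum[OF e] using a by simp
  \<comment> \<open>The bound \<open>\<alpha> i \<le> 1 + sum \<alpha> I\<close> now reads
    \<open>1 \<le> \<alpha> j\<close>, and symmetrically.\<close>
  then have "\<alpha> i = 1" "\<alpha> j = 1" using bounds[of i] bounds[of j] m by auto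
  then show False using no_inner0_2[OF e] a by blast
qed

lemma twelve_false: False
proof (cases "\<exists>l\<in>I. \<alpha> l = - 1")
  case True
  then obtain l where l: "l \<in> I" "\<alpha> l = - 1" by blast
  then obtain i j k where e: "enum i j k l" using enum_exists by blast
  have ee: "enum j k i l" "enum i k j l" using e unfolding enum_def by auto
  have "\<alpha> i \<noteq> - 1" "\<alpha> j \<noteq> - 1" "\<alpha> k \<noteq> - 1"
    using two_minus[OF e] two_minus[OF ee(1)] two_minus[OF ee(2)] l(2) by blast+
  then have "- 1 < \<alpha> i" "- 1 < \<alpha> j" "- 1 < \<alpha> k"
    using bounds(1) enum_in[OF e] by force+
  then show False using no_one_minus[OF e l(2)] by blast
next
  case False
  then have gt: "- 1 < \<alpha> i" if "i \<in> I" for i using bounds(1)[OF that] that by (metis less_le)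
  obtain i0 j0 k0 where e0: "enum i0 j0 k0 0" using enum_exists[of 0] unfolding I_def by auto
  show False
  proof (cases "\<forall>i\<in>I. \<alpha> i < 1 + sum \<alpha> I")
    case True
    then show False using no_all_alive[OF e0] gt by blast
  next
    case False
    \<comment> \<open>By \<open>bounds\<close>, this \<open>\<alpha> l\<close> is the largest value:
      either it is 1 and the other three lie strictly between -1 and 1, or all four do.\<close>
    then obtain l where l: "l \<in> I" "\<alpha> l = 1 + sum \<alpha> I" using bounds(3) by force
    then obtain i j k where e: "enum i j k l" using enum_exists by blast
    note m = enum_in[OF e]
    have s: "\<alpha> i + \<alpha> j + \<alpha> k = - 1" using l(2) unfolding enum_sum[OF e] by simp
    show False
    proof (cases "\<alpha> l = 1")
      case True
      have "\<forall>m\<in>{i, j, k}. - 1 < \<alpha> m \<and> \<alpha> m < 1" using gt[of i] gt[of j] gt[of k] m s by auto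
      then show False using no_inner3_plus[OF e _ True s] by blast
    next
      case False
      then have "\<alpha> l < 1" using bounds(2)[OF l(1)] by simp
      then have "\<forall>i\<in>I. - 1 < \<alpha> i \<and> \<alpha> i < 1" using gt bounds(3) l(2) by force
      then show False by (rule no_all_inner)
    qed
  qed
qed

end

section \<open>Upper bounds\<close>

lemma T_shaped_functionals:
  assumes n: "0 < n" and C: "C \<subseteq> carrier_vec n" and T: "T_shaped n C"
  obtains a :: "nat \<Rightarrow> nat \<Rightarrow> real" and d :: "nat \<Rightarrow> real"
  where "\<forall>w. (\<forall>i<n. (\<Sum>k<n. w k * a k i) = 0) \<longrightarrow> (\<forall>k<n. w k = 0)"
    "\<forall>c\<in>C. \<exists>k. 0 < k \<and> k < n \<and> (\<Sum>i<n. a k i * c $ i) + d k = 0 \<and>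
       (\<forall>j. k < j \<and> j < n \<longrightarrow> 0 \<le> (\<Sum>i<n. a j i * c $ i) + d j)"
proof -
  obtain f where f: "affine_transformation n f" and fT: "\<forall>c\<in>C. \<exists>k. 0 < k \<and> k < n \<and> f c $ k = 0 \<and>
      (\<forall>i. k < i \<and> i < n \<longrightarrow> 0 \<le> f c $ i)"
    using T T_shaped_iff[OF n] by auto
  obtain A b where A: "A \<in> carrier_mat n n" and b: "b \<in> carrier_vec n" and inv: "invertible_mat A"
    and fA: "\<And>x. x \<in> carrier_vec n \<Longrightarrow> f x = A *\<^sub>v x + b"
    using f unfolding affine_transformation_def by blast
  obtain B where B: "B * A = 1\<^sub>m n" "B \<in> carrier_mat n n"
    using inv A unfolding invertible_mat_def inverts_mat_def
    by (metis carrier_matD carrier_matI index_mult_mat(2,3) index_one_mat(2,3))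
  have "det B * det A = 1" using det_mult[OF B(2) A] B(1) by simp
  then have "det (transpose_mat A) \<noteq> 0" using det_transpose[OF A] by auto
  then have ker: "v = 0\<^sub>v n" if "v \<in> carrier_vec n" "transpose_mat A *\<^sub>v v = 0\<^sub>v n" for v
    using det_0_iff_vec_prod_zero_field[of "transpose_mat A" n] A that by auto
  have val: "f c $ k = (\<Sum>i<n. A $$ (k, i) * c $ i) + b $ k" if "c \<in> carrier_vec n" "k < n" for c k
    using fA[OF that(1)] that A b by (simp add: scalar_prod_def lessThan_atLeast0)
  show ?thesis
  proof (rule that[of "\<lambda>k i. A $$ (k, i)" "\<lambda>k. b $ k"])
    show "\<forall>w. (\<forall>i<n. (\<Sum>k<n. w k * A $$ (k, i)) = 0) \<longrightarrow> (\<forall>k<n. w k = 0)"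
    proof (intro allI impI)
      fix w k assume w: "\<forall>i<n. (\<Sum>k<n. w k * A $$ (k, i)) = 0" and k: "k < n"
      have "transpose_mat A *\<^sub>v vec n w = 0\<^sub>v n"
        using A w by (intro eq_vecI) (auto simp: scalar_prod_def lessThan_atLeast0 mult.commute)
      then have "vec n w = 0\<^sub>v n" by (rule ker[rotated]) simp
      then have "vec n w $ k = 0" using k by simp
      then show "w k = 0" using k by simp
    qed
    show "\<forall>c\<in>C. \<exists>k. 0 < k \<and> k < n \<and> (\<Sum>i<n. A $$ (k, i) * c $ i) + b $ k = 0 \<and>
       (\<forall>j. k < j \<and> j < n \<longrightarrow> 0 \<le> (\<Sum>i<n. A $$ (j, i) * c $ i) + b $ j)"
    proof
      fix c assume c: "c \<in> C"
      then have cc: "c \<in> carrier_vec n" using C by blast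
      obtain k where k: "0 < k" "k < n" "f c $ k = 0" "\<forall>i. k < i \<and> i < n \<longrightarrow> 0 \<le> f c $ i"
        using fT c by blast
      show "\<exists>k. 0 < k \<and> k < n \<and> (\<Sum>i<n. A $$ (k, i) * c $ i) + b $ k = 0 \<and>
       (\<forall>j. k < j \<and> j < n \<longrightarrow> 0 \<le> (\<Sum>i<n. A $$ (j, i) * c $ i) + b $ j)"
        using k val[OF cc] by (intro exI[of _ k]) auto
    qed
  qed
qed

lemma t_number_le:
  assumes "C \<subseteq> carrier_vec n" "finite C" "\<not> T_shaped n C" "card C \<le> N"
  shows "t_number n \<le> enat N"
proof -
  have "t_number n \<le> (if finite C then enat (card C) else \<infinity>)"
    unfolding t_number_def by (rule INF_lower) (use assms in simp)
  also have "\<dots> \<le> enat N" using assms by simp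
  finally show ?thesis .
qed

text \<open>A hyperplane meets the moment curve in at most \<open>n\<close> points, so \<open>n - 1\<close> hyperplanes
  cannot cover \<open>n (n - 1) + 1\<close> of its points.\<close>

lemma t_number_moment_curve:
  assumes n: "1 \<le> n"
  shows "t_number n \<le> enat (n\<^sup>2 - n + 1)"
proof -
  define N where "N = n\<^sup>2 - n + 1"
  define c where "c t = vec n (\<lambda>i. real t ^ Suc i)" for t
  have C: "c ` {1..N} \<subseteq> carrier_vec n" by (auto simp: c_def)
  have "\<not> T_shaped n (c ` {1..N})"
  proof
    assume T: "T_shaped n (c ` {1..N})"
    have pos: "0 < n" using n by simp
    obtain a :: "nat \<Rightarrow> nat \<Rightarrow> real" and d :: "nat \<Rightarrow> real" where ind: "\<forall>w. (\<forall>i<n. (\<Sum>k<n. w k * a k i) = 0) \<longrightarrow> (\<forall>k<n. w k = (0::real))"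
      and cov: "\<forall>x\<in>c ` {1..N}. \<exists>k. 0 < k \<and> k < n \<and> (\<Sum>i<n. a k i * x $ i) + d k = 0 \<and>
       (\<forall>j. k < j \<and> j < n \<longrightarrow> 0 \<le> (\<Sum>i<n. a j i * x $ i) + d j)"
      using T_shaped_functionals[OF pos C T] .
    \<comment> \<open>The \<open>k\<close>-th functional along the curve. It is nonzero because row
      \<open>k\<close> is, by independence.\<close>
    define p where "p k = (\<Sum>i<n. monom (a k i) (Suc i)) + [:d k:]" for k
    have poly: "poly (p k) x = (\<Sum>i<n. a k i * x ^ Suc i) + d k" for k x
      by (simp add: p_def poly_sum poly_monom)
    have deg: "degree (p k) \<le> n" for k
      unfolding p_def
    proof (intro degree_add_le degree_sum_le)
      show "degree (monom (a k i) (Suc i)) \<le> n" if "i \<in> {..<n}" for i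
        using degree_monom_le[of "a k i" "Suc i"] that by simp
    qed auto
    have nz: "p k \<noteq> 0" if k: "k < n" for k
    proof
      assume "p k = 0"
      have "a k i = 0" if "i < n" for i
      proof -
        have "coeff (p k) (Suc i) = (\<Sum>j<n. if j = i then a k j else 0)"
          by (simp add: p_def coeff_sum if_distrib cong: if_cong)
        then show ?thesis using \<open>p k = 0\<close> that by simp
      qed
      then have "\<forall>i<n. (\<Sum>j<n. (if j = k then 1 else 0) * a j i) = 0"
        by (auto intro!: sum.neutral)
      then have "\<forall>j<n. (if j = k then 1 else 0) = (0::real)" using ind[rule_format, of "\<lambda>j. if j = k then 1 else 0"] by auto
      then show False using k by auto
    qed
    have "real ` {1..N} \<subseteq> (\<Union>k\<in>{1..<n}. {x. poly (p k) x = 0})"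
    proof
      fix x assume "x \<in> real ` {1..N}"
      then obtain t where t: "t \<in> {1..N}" "x = real t" by blast
      then obtain k where k: "0 < k" "k < n" "(\<Sum>i<n. a k i * c t $ i) + d k = 0" using cov by blast
      have "(\<Sum>i<n. a k i * c t $ i) = (\<Sum>i<n. a k i * x ^ Suc i)"
        using t by (intro sum.cong) (auto simp: c_def)
      then have "poly (p k) x = 0" unfolding poly using k by simp
      then show "x \<in> (\<Union>k\<in>{1..<n}. {x. poly (p k) x = 0})" using k by auto
    qed
    moreover have fin: "finite {x. poly (p k) x = 0}" if "k \<in> {1..<n}" for k
      using poly_roots_finite nz that by auto
    ultimately have "card (real ` {1..N}) \<le> card (\<Union>k\<in>{1..<n}. {x. poly (p k) x = 0})"
      by (intro card_mono) auto
    also have "\<dots> \<le> (\<Sum>k\<in>{1..<n}. card {x. poly (p k) x = 0})" by (rule card_UN_le) simp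
    also have "\<dots> \<le> (\<Sum>k\<in>{1..<n}. n)"
    proof (rule sum_mono)
      fix k assume "k \<in> {1..<n}"
      then have "card {x. poly (p k) x = 0} \<le> degree (p k)" using nz by (intro card_poly_roots_bound) auto
      then show "card {x. poly (p k) x = 0} \<le> n" using deg[of k] by linarith
    qed
    also have "\<dots> = n\<^sup>2 - n" by (simp add: power2_eq_square diff_mult_distrib)
    finally have "card (real ` {1..N}) \<le> n\<^sup>2 - n" .
    moreover have "card (real ` {1..N}) = N" by (simp add: card_image)
    ultimately show False by (simp add: N_def)
  qed
  moreover have "card (c ` {1..N}) \<le> N" using card_image_le[of "{1..N}" c] by simp
  ultimately show ?thesis using t_number_le[OF C] unfolding N_def by simp
qed

lemma sum_unit_vec:
  fixes a :: "nat \<Rightarrow> real"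
  assumes "i < n"
  shows "(\<Sum>j<n. a j * (s \<cdot>\<^sub>v unit_vec n i) $ j) = s * a i"
proof -
  have "(\<Sum>j<n. a j * (s \<cdot>\<^sub>v unit_vec n i) $ j) = (\<Sum>j<n. if j = i then s * a j else 0)"
    using assms by (intro sum.cong) auto
  then show ?thesis using assms by simp
qed

text \<open>As \<open>0 < d 2\<close>, at most one of \<open>e_i\<close> and \<open>-e_i\<close> is
  on the first plane; if \<open>d 1 \<noteq> 0\<close>, at most one is on the second. So each plane
  contains exactly one of them, which makes the two normals dependent.\<close>

lemma t_number_3_le: "t_number 3 \<le> 6"
proof -
  define C :: "real vec set" where "C = (\<lambda>i. 1 \<cdot>\<^sub>v unit_vec 3 i) ` {..<3} \<union> (\<lambda>i. - 1 \<cdot>\<^sub>v unit_vec 3 i) ` {..<3}"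
  have C: "C \<subseteq> carrier_vec 3" "finite C" by (auto simp: C_def)
  have "card ((\<lambda>i. 1 \<cdot>\<^sub>v unit_vec 3 i :: real vec) ` {..<3}) \<le> 3" "card ((\<lambda>i. - 1 \<cdot>\<^sub>v unit_vec 3 i :: real vec) ` {..<3}) \<le> 3"
    by (metis card_image_le card_lessThan finite_lessThan)+
  then have card: "card C \<le> 6" unfolding C_def
    using card_Un_le[of "(\<lambda>i. 1 \<cdot>\<^sub>v unit_vec 3 i :: real vec) ` {..<3}" "(\<lambda>i. - 1 \<cdot>\<^sub>v unit_vec 3 i) ` {..<3}"] by linarith
  have "\<not> T_shaped 3 C"
  proof
    assume T: "T_shaped 3 C"
    have pos: "0 < (3::nat)" by simp
    obtain a :: "nat \<Rightarrow> nat \<Rightarrow> real" and d :: "nat \<Rightarrow> real" where ind: "\<forall>w. (\<forall>i<3. (\<Sum>k<3. w k * a k i) = 0) \<longrightarrow> (\<forall>k<3. w k = (0::real))"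
      and cov: "\<forall>x\<in>C. \<exists>k. 0 < k \<and> k < 3 \<and> (\<Sum>i<3. a k i * x $ i) + d k = 0 \<and>
       (\<forall>j. k < j \<and> j < 3 \<longrightarrow> 0 \<le> (\<Sum>i<3. a j i * x $ i) + d j)"
      using T_shaped_functionals[OF pos C(1) T] .
    have key: "s * a 2 i + d 2 = 0 \<or> s * a 1 i + d 1 = 0 \<and> 0 \<le> s * a 2 i + d 2"
      if i: "i < 3" and s: "s = 1 \<or> s = - 1" for i s
    proof -
      have mem: "s \<cdot>\<^sub>v unit_vec 3 i \<in> C" unfolding C_def using s i by blast
      obtain k where k: "0 < k" "k < 3" "s * a k i + d k = 0" "\<forall>j. k < j \<and> j < 3 \<longrightarrow> 0 \<le> s * a j i + d j"
        using bspec[OF cov mem, unfolded sum_unit_vec[OF i]] by blast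
      then have "k = 1 \<or> k = 2" by auto
      then show ?thesis using k by auto
    qed
    have w3: "x = 0 \<and> y = 0" if xy: "\<And>i. i < 3 \<Longrightarrow> x * a 1 i + y * a 2 i = 0" for x y
    proof -
      define w :: "nat \<Rightarrow> real" where "w k = (if k = 1 then x else if k = 2 then y else 0)" for k
      have "{..<3} = {0, 1, 2::nat}" by auto
      then have "(\<Sum>k<3. w k * a k i) = x * a 1 i + y * a 2 i" for i by (simp add: w_def)
      then have "\<forall>i<3. (\<Sum>k<3. w k * a k i) = 0" using xy by (simp only:) simp
      then have "w 1 = 0" "w 2 = 0" using ind[rule_format, of w] by simp_all
      then show ?thesis by (simp add: w_def)
    qed
    have d2: "0 < d 2"
    proof (rule ccontr)
      assume "\<not> 0 < d 2"
      then have "a 2 i = 0" if "i < 3" for i using key[OF that, of 1] key[OF that, of "- 1"] by auto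
      then show False using w3[of 0 1] by simp
    qed
    show False
    proof (cases "d 1 = 0")
      case True
      then have "a 1 i = 0" if "i < 3" for i using key[OF that, of 1] key[OF that, of "- 1"] d2 by auto
      then show False using w3[of 1 0] by simp
    next
      case False
      have "d 2 * a 1 i + d 1 * a 2 i = 0" if "i < 3" for i
      proof -
        have "(a 2 i = - d 2 \<and> a 1 i = d 1) \<or> (a 2 i = d 2 \<and> a 1 i = - d 1)"
          using key[OF that, of 1] key[OF that, of "- 1"] d2 False by auto
        then show ?thesis by auto
      qed
      then show False using w3[of "d 2" "d 1"] d2 by simp
    qed
  qed
  from t_number_le[OF C this card] show ?thesis by (simp add: numeral_eq_enat)
qed

lemma t_number_4_le: "t_number 4 \<le> 12"
proof -
  define g :: "nat \<Rightarrow> real vec" where "g i = vec 4 (\<lambda>j. if j = i then 0 else 1)" for i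
  define C where "C = (\<lambda>i. 1 \<cdot>\<^sub>v unit_vec 4 i) ` {..<4} \<union> ((\<lambda>i. - 1 \<cdot>\<^sub>v unit_vec 4 i) ` {..<4} \<union> g ` {..<4})"
  have C: "C \<subseteq> carrier_vec 4" "finite C" by (auto simp: C_def g_def)
  have c4: "card (f ` {..<4}) \<le> 4" for f :: "nat \<Rightarrow> real vec" by (metis card_image_le card_lessThan finite_lessThan)
  have card: "card C \<le> 12"
    unfolding C_def using c4[of "\<lambda>i. 1 \<cdot>\<^sub>v unit_vec 4 i"] c4[of "\<lambda>i. - 1 \<cdot>\<^sub>v unit_vec 4 i"] c4[of g]
      card_Un_le[of "(\<lambda>i. 1 \<cdot>\<^sub>v unit_vec 4 i) ` {..<4}" "(\<lambda>i. - 1 \<cdot>\<^sub>v unit_vec 4 i) ` {..<4} \<union> g ` {..<4}"]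
      card_Un_le[of "(\<lambda>i. - 1 \<cdot>\<^sub>v unit_vec 4 i) ` {..<4}" "g ` {..<4}"] by linarith
  have "\<not> T_shaped 4 C"
  proof
    assume T: "T_shaped 4 C"
    have pos: "0 < (4::nat)" by simp
    obtain a :: "nat \<Rightarrow> nat \<Rightarrow> real" and d :: "nat \<Rightarrow> real" where ind: "\<forall>w. (\<forall>i<4. (\<Sum>k<4. w k * a k i) = 0) \<longrightarrow> (\<forall>k<4. w k = (0::real))"
      and cov: "\<forall>x\<in>C. \<exists>k. 0 < k \<and> k < 4 \<and> (\<Sum>i<4. a k i * x $ i) + d k = 0 \<and>
       (\<forall>j. k < j \<and> j < 4 \<longrightarrow> 0 \<le> (\<Sum>i<4. a j i * x $ i) + d j)"
      using T_shaped_functionals[OF pos C(1) T] .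
    have T3: "in_T3 (F 1) (F 2) (F 3)" if x: "x \<in> C" and F: "\<And>k. (\<Sum>i<4. a k i * x $ i) + d k = F k" for x F
    proof -
      obtain k where k: "0 < k" "k < 4" "F k = 0" "\<forall>j. k < j \<and> j < 4 \<longrightarrow> 0 \<le> F j"
        using bspec[OF cov x, unfolded F] by blast
      then have "k = 1 \<or> k = 2 \<or> k = 3" by auto
      then show ?thesis using k by (auto simp: in_T3_def in_T2_def)
    qed
    have e: "in_T3 (d 1 + s * a 1 i) (d 2 + s * a 2 i) (d 3 + s * a 3 i)" if "i < 4" "s = 1 \<or> s = - 1" for i s
      by (rule T3[of "s \<cdot>\<^sub>v unit_vec 4 i"]) (use that sum_unit_vec[OF that(1)] in \<open>auto simp: C_def\<close>)
    have sg: "(\<Sum>j<4. a k j * g i $ j) = sum (a k) {..<4} - a k i" if "i < 4" for i k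
    proof -
      have "(\<Sum>j<4. a k j * g i $ j) = (\<Sum>j<4. a k j - (if j = i then a k j else 0))"
        by (intro sum.cong) (auto simp: g_def)
      then show ?thesis using that by (simp add: sum_subtractf)
    qed
    have gi: "in_T3 (d 1 + sum (a 1) {..<4} - a 1 i) (d 2 + sum (a 2) {..<4} - a 2 i) (d 3 + sum (a 3) {..<4} - a 3 i)"
      if "i < 4" for i
      by (rule T3[of "g i"]) (use that sg[OF that] in \<open>auto simp: C_def\<close>)
    have I4: "{..<4} = {0, 1, 2, 3::nat}" by auto
    have w4: "x = 0 \<and> y = 0 \<and> z = 0" if xyz: "\<And>i. i < 4 \<Longrightarrow> x * a 1 i + y * a 2 i + z * a 3 i = 0" for x y z
    proof -
      define w :: "nat \<Rightarrow> real" where "w k = (if k = 1 then x else if k = 2 then y else if k = 3 then z else 0)" for k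
      have "(\<Sum>k<4. w k * a k i) = x * a 1 i + y * a 2 i + z * a 3 i" for i by (simp add: w_def I4)
      then have "\<forall>i<4. (\<Sum>k<4. w k * a k i) = 0" using xyz by (simp only:) simp
      then have "w 1 = 0" "w 2 = 0" "w 3 = 0" using ind[rule_format, of w] by simp_all
      then show ?thesis by (simp add: w_def)
    qed
    have d3: "0 < d 3"
    proof (rule ccontr)
      assume "\<not> 0 < d 3"
      then have "a 3 i = 0" if "i < 4" for i using e[OF that, of 1] e[OF that, of "- 1"] by (auto simp: in_T3_def)
      then show False using w4[of 0 0 1] by simp
    qed
    have scale: "in_T3 y1 y2 (y3 / d 3)" if "in_T3 y1 y2 y3" for y1 y2 y3
      using that d3 by (auto simp: in_T3_def)
    \<comment> \<open>Dividing the last functional by \<open>d 3\<close> makes its constant term 1;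
      \<open>in_T3\<close> depends only on the sign of that coordinate.\<close>
    interpret twelve_points "\<lambda>i. a 3 i / d 3" "a 2" "a 1" "d 1" "d 2" "{0, 1, 2, 3}"
    proof (unfold_locales, goal_cases)
      case (1 i)
      then have "i < 4" by auto
      from scale[OF e[OF this, of 1]] show ?case using d3 by (simp add: add_divide_distrib)
    next
      case (2 i)
      then have "i < 4" by auto
      from scale[OF e[OF this, of "- 1"]] show ?case using d3 by (simp add: diff_divide_distrib)
    next
      case (3 i)
      then have "i < 4" by auto
      from scale[OF gi[OF this]] show ?case
        using d3 unfolding I4[symmetric] sum_divide_distrib[symmetric] by (simp add: add_divide_distrib diff_divide_distrib)
    next
      case (4 x y z)
      have "x * a 1 i + y * a 2 i + z / d 3 * a 3 i = 0" if "i < 4" for i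
      proof -
        have "i \<in> {0, 1, 2, 3}" using that by auto
        from bspec[OF 4 this] show ?thesis by simp
      qed
      from w4[OF this] show ?case using d3 by simp
    qed
    show False by (rule twelve_false)
  qed
  from t_number_le[OF C this card] show ?thesis by (simp add: numeral_eq_enat)
qed

text \<open>A weak bound that supplies the premise \<open>Suc n < k\<close> of
  \<open>T_bound_step_large\<close>.\<close>

lemma T_bound_ge:
  assumes "3 \<le> n"
  shows "T_bound n (n + 3)"
  using assms
proof (induction n rule: dec_induct)
  case base
  then show ?case using T_bound_3 by simp
next
  case (step n)
  then have "T_bound (Suc n) (n + 3 + Suc n)" by (intro T_bound_step) auto
  then show ?case unfolding T_bound_def by force
qed

text \<open>The bound in (7) without division or subtraction. It starts at 12 and grows from
  \<open>n\<close> to \<open>Suc n\<close> by \<open>n + 2\<close>, the gain of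
  \<open>T_bound_step_large\<close>.\<close>

lemma T_bound_quadratic:
  assumes "4 \<le> n"
  shows "\<exists>m. T_bound n m \<and> 2 * m + 4 = n\<^sup>2 + 3 * n"
  using assms
proof (induction n rule: dec_induct)
  case base
  then show ?case using T_bound_4_12 by (intro exI[of _ 12]) simp
next
  case (step n)
  then obtain m where m: "T_bound n m" "2 * m + 4 = n\<^sup>2 + 3 * n" by blast
  have "4 * n \<le> n\<^sup>2" using step(1) by (simp add: power2_eq_square)
  then have "Suc n < m" using m(2) step(1) by linarith
  then have "T_bound (Suc n) (m + n + 2)" using T_bound_step_large[of n m] m(1) step(1) by simp
  moreover have "2 * (m + n + 2) + 4 = (Suc n)\<^sup>2 + 3 * Suc n"
    using m(2) by (simp add: power2_eq_square)
  ultimately show ?case by blast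
qed

lemma t_number_step:
  assumes n: "4 \<le> n"
  shows "t_number (n - 1) + enat n + 1 \<le> t_number n"
proof -
  have "1 \<le> n - 1" using n by simp
  \<comment> \<open>The upper bound makes \<open>t_number (n - 1)\<close> finite, so it can serve as
    the \<open>k\<close> of the recursion.\<close>
  from enat_ile[OF t_number_moment_curve[OF this]] obtain k where k: "t_number (n - 1) = enat k" by blast
  have "enat (n - 1 + 3) \<le> enat k" using T_bound_ge[of "n - 1"] n k unfolding T_bound_iff by simp
  then have "Suc (n - 1) < k" by simp
  moreover have "T_bound (n - 1) k" using k unfolding T_bound_iff by simp
  ultimately have "T_bound (Suc (n - 1)) (k + (n - 1) + 2)" using n by (intro T_bound_step_large) auto
  moreover have "Suc (n - 1) = n" "k + (n - 1) + 2 = k + n + 1" using n by auto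
  ultimately have "enat (k + n + 1) \<le> t_number n" unfolding T_bound_iff by simp
  then show ?thesis unfolding k by (simp add: one_enat_def)
qed

theorem theorem4p4:
  shows "t_number 1 = 1 \<and>
         t_number 2 = 3 \<and>
         t_number 3 = 6 \<and>
         t_number 4 = 12 \<and>
         (\<forall>n::nat. n \<ge> 1 \<longrightarrow> t_number n \<le> enat (n\<^sup>2 - n + 1)) \<and>
         (\<forall>n::nat. n \<ge> 4 \<longrightarrow> t_number n \<ge> t_number (n - 1) + enat n + 1) \<and>
         (\<forall>n::nat. n \<ge> 4 \<longrightarrow>
            ereal_of_enat (t_number n) \<ge> ereal (1 / 2 * ((real n)\<^sup>2 + 3 * real n - 4)))"
proof (intro conjI allI impI)
  have "t_number 1 \<le> enat 1" using t_number_moment_curve[of 1] by simp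
  moreover have "enat 1 \<le> t_number 1" using T_bound_1 unfolding T_bound_iff .
  ultimately show "t_number 1 = 1" by (simp add: one_enat_def)
next
  have "t_number 2 \<le> enat 3" using t_number_moment_curve[of 2] by simp
  moreover have "enat 3 \<le> t_number 2" using T_bound_2 unfolding T_bound_iff .
  ultimately show "t_number 2 = 3" by (simp add: numeral_eq_enat)
next
  have "enat 6 \<le> t_number 3" using T_bound_3 unfolding T_bound_iff .
  then show "t_number 3 = 6" using t_number_3_le by (simp add: numeral_eq_enat)
next
  have "enat 12 \<le> t_number 4" using T_bound_4_12 unfolding T_bound_iff .
  then show "t_number 4 = 12" using t_number_4_le by (simp add: numeral_eq_enat)
next
  fix n :: nat assume "1 \<le> n"
  then show "t_number n \<le> enat (n\<^sup>2 - n + 1)" by (rule t_number_moment_curve)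
next
  fix n :: nat assume "4 \<le> n"
  then show "t_number (n - 1) + enat n + 1 \<le> t_number n" by (rule t_number_step)
next
  fix n :: nat assume "4 \<le> n"
  then obtain m where m: "T_bound n m" "2 * m + 4 = n\<^sup>2 + 3 * n" using T_bound_quadratic by blast
  have "real (2 * m + 4) = real (n\<^sup>2 + 3 * n)" using m(2) by simp
  then have "1 / 2 * ((real n)\<^sup>2 + 3 * real n - 4) = real m" by simp
  moreover have "ereal_of_enat (enat m) \<le> ereal_of_enat (t_number n)"
    using m(1) unfolding T_bound_iff by (simp only: ereal_of_enat_le_iff)
  ultimately show "ereal (1 / 2 * ((real n)\<^sup>2 + 3 * real n - 4)) \<le> ereal_of_enat (t_number n)"
    by simp
qed

end
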